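(* Consider the generalized equation $0\in\Phi x=Fx+Tx$ in the expectation setting $Fx=\mathbb{E}_\xi[\mathbf F(x,\xi)]$ under the standing assumptions of the context, with $L\rho<1$. Let $\hat L>L$ with $\hat L\rho<1$, $\bar\beta:=\frac{\lambda(4-\hat L\lambda)-4\rho}{4(1-\rho\hat L)}$, and $$2\rho\le\lambda<\tfrac{2(1+\sqrt{1-\hat L\rho})}{\hat L},\quad 0<\mu<\tfrac23,\quad \nu:=\tfrac\mu2,\quad 0<\beta\le\tfrac{(2-\mu)\bar\beta}{2+\mu},\quad t_k:=\mu(k+r),\quad \eta_k:=\tfrac{2\beta(t_k-1)}{t_k-\nu},\quad r\ge5+\tfrac1\mu .$$ Let $\epsilon\in(0,1/2]$ be a given tolerance. Let $\{(x^k,z^k)\}$ be generated by the VFOSA$_+$ iteration (see context) where $\widetilde F^k$ is the HSGD estimator (see context) with $$\tau_k:=1-\sqrt{\frac{(1-\theta)t_{k-1}(t_{k-1}-1)}{t_k(t_k-1)}}\ \text{ for }\theta:=\epsilon,\qquad b_k=b:=\Big\lfloor\frac{c_b}{\epsilon}\Big\rfloor,\qquad \hat b_k=\hat b:=\Big\lfloor\frac{\hat c_b}{\epsilon^2}\Big\rfloor,\qquad n_0:=\Big\lfloor\frac{c_n}{\epsilon}\Big\rfloor,$$ where $c_b$, $\hat c_b$ and $c_n$ are suitable constants independent of $\epsilon$. Then the expected total number $\bar{\mathcal T}_K$ of oracle calls $\mathbf F(\cdot,\xi)$ and evaluations of $J_{\lambda T}$ to obtain $x^K$ such that $\mathbb{E}[\|G_\lambda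 x^K\|^2]\le\epsilon^2$ is at most $\bar{\mathcal T}_K=\mathcal O(\epsilon^{-3})$ (with constants independent of $\epsilon$).
   Context: Problem: $F:\mathbb{R}^p\to\mathbb{R}^p$ is single-valued with $Fx=\mathbb{E}_\xi[\mathbf F(x,\xi)]$ for a random variable $\xi$ (unbiased stochastic oracle), $T:\mathbb{R}^p\rightrightarrows2^{\mathbb{R}^p}$ is possibly multi-valued, $\Phi:=F+T$, $\mathrm{zer}(\Phi):=\{x:0\in\Phi x\}$, $\mathrm{dom}(\Phi)=\{x:\Phi x\neq\emptyset\}$. Standing assumptions. $\mathrm{zer}(\Phi)\neq\emptyset$. There is $\sigma\ge0$ with $\mathbb{E}_\xi[\|\mathbf F(x,\xi)-Fx\|^2]\le\sigma^2$ for all $x\in\mathrm{dom}(F)$. $T$ is maximally $\rho$-co-hypomonotone for some $\rho\ge0$: $\langle u-v,x-y\rangle\ge-\rho\|u-v\|^2$ for all $(x,u),(y,v)$ in the graph of $T$, and the graph is not properly contained in that of another such operator. There is $L>0$ with $\langle Fx-Fy,x-y\rangle\ge\frac1L\mathbb{E}_\xi[\|\mathbf F(x,\xi)-\mathbf F(y,\xi)\|^2]$ for all $x,y\in\mathrm{dom}(F)$. Operators: for $\lambda>0$, $J_{\lambda T}x:=\{w:x\in w+\lambda Tw\}$ and $G_\lambda x:=\frac1\lambda\big(x-J_{\lambda T}(x-\lambda Fx)\big)$. VFOSA$_+$ iteration: given $x^0\in\mathrm{dom}(\Phi)$, $z^0:=x^0$, for $k\ge0$: $y^k:=\frac{t_k-1}{t_k}x^k+\frac1{t_k}z^k$;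 $x^{k+1}:=y^k-\eta_k\widetilde G_\lambda^k$; $z^{k+1}:=z^k+\nu(x^{k+1}-y^k)$, where $\widetilde G_\lambda^k:=\frac1\lambda\big(x^k-J_{\lambda T}(x^k-\lambda\widetilde F^k)\big)$ and $\widetilde F^k$ is a stochastic estimator of $Fx^k$. HSGD (hybrid SGD) estimator: $\widetilde F^0$ is an initial estimate with $\mathbb{E}_0[\|\widetilde F^0-Fx^0\|^2]\le\sigma^2/n_0$ (obtained from a sample of size $n_0$); for $k\ge1$, with an i.i.d. mini-batch $\mathcal S_k$ of $\xi$ of size $b_k$, $\widetilde F^k:=(1-\tau_k)\big[\widetilde F^{k-1}+\frac1{b_k}\sum_{\xi_i\in\mathcal S_k}(\mathbf F(x^k,\xi_i)-\mathbf F(x^{k-1},\xi_i))\big]+\tau_k\bar Fx^k$, where $\tau_k\in[0,1]$ and $\bar Fx^k$ is an unbiased estimator of $Fx^k$ built from an i.i.d. sample $\hat{\mathcal S}_k$ of size $\hat b_k$ with $\mathbb{E}_{\hat{\mathcal S}_k}[\|\bar Fx^k-Fx^k\|^2]\le\sigma^2/\hat b_k$; $\mathcal S_k$ and $\hat{\mathcal S}_k$ may be dependent. *)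

theory Defs
  imports "HOL-Probability.Probability"
begin

text \<open>Set-valued operators are functions \<^typ>\<open>'a \<Rightarrow> 'a set\<close>.\<close>

definition op_graph :: "('a \<Rightarrow> 'a set) \<Rightarrow> ('a \<times> 'a) set" where
  "op_graph T = {(x, u). u \<in> T x}"

definition op_dom :: "('a \<Rightarrow> 'a set) \<Rightarrow> 'a set" where
  "op_dom T = {x. T x \<noteq> {}}"

definition zer :: "('a::zero \<Rightarrow> 'a set) \<Rightarrow> 'a set" where
  "zer T = {x. 0 \<in> T x}"

definition op_sum :: "('a::plus \<Rightarrow> 'a) \<Rightarrow> ('a \<Rightarrow> 'a set) \<Rightarrow> 'a \<Rightarrow> 'a set" where
  "op_sum F T x = {F x + u | u. u \<in> T x}"

definition cohypomonotone :: "real \<Rightarrow> ('a::real_inner \<Rightarrow> 'a set) \<Rightarrow> bool" where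
  "cohypomonotone \<rho> T \<longleftrightarrow>
     (\<forall>(x, u) \<in> op_graph T. \<forall>(y, v) \<in> op_graph T. (u - v) \<bullet> (x - y) \<ge> - \<rho> * (norm (u - v))\<^sup>2)"

definition maximally_cohypomonotone :: "real \<Rightarrow> ('a::real_inner \<Rightarrow> 'a set) \<Rightarrow> bool" where
  "maximally_cohypomonotone \<rho> T \<longleftrightarrow>
     cohypomonotone \<rho> T \<and> (\<forall>T'. cohypomonotone \<rho> T' \<longrightarrow> \<not> op_graph T \<subset> op_graph T')"

definition resolvent :: "real \<Rightarrow> ('a::real_vector \<Rightarrow> 'a set) \<Rightarrow> 'a \<Rightarrow> 'a set" where
  "resolvent lam T x = {w. \<exists>u \<in> T w. x = w + lam *\<^sub>R u}"

text \<open>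
  The forward-backward residual at \<open>x\<close>, with \<open>v\<close> in the place of \<open>F x\<close>. The use of
  \<^const>\<open>the_elem\<close> is meaningful where the resolvent is single-valued with full domain; for a
  maximally \<open>\<rho>\<close>-co-hypomonotone \<open>T\<close> this is so when \<open>lam > \<rho>\<close>.
\<close>

definition residual :: "real \<Rightarrow> ('a::real_vector \<Rightarrow> 'a set) \<Rightarrow> 'a \<Rightarrow> 'a \<Rightarrow> 'a" where
  "residual lam T x v = (1 / lam) *\<^sub>R (x - the_elem (resolvent lam T (x - lam *\<^sub>R v)))"

definition G_op :: "real \<Rightarrow> ('a::real_vector \<Rightarrow> 'a) \<Rightarrow> ('a \<Rightarrow> 'a set) \<Rightarrow> 'a \<Rightarrow> 'a" where
  "G_op lam F T x = residual lam T x (F x)"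

text \<open>The accelerated iteration along one sample path; \<open>f k\<close> is the estimate of \<open>F (x k)\<close>.\<close>

definition vfosa_plus ::
  "real \<Rightarrow> ('a::real_vector \<Rightarrow> 'a set) \<Rightarrow> (nat \<Rightarrow> real) \<Rightarrow> real \<Rightarrow> (nat \<Rightarrow> real) \<Rightarrow> 'a
     \<Rightarrow> (nat \<Rightarrow> 'a) \<Rightarrow> (nat \<Rightarrow> 'a) \<Rightarrow> (nat \<Rightarrow> 'a) \<Rightarrow> bool" where
  "vfosa_plus lam T t \<nu> \<eta> x0 f x z \<longleftrightarrow>
     x 0 = x0 \<and> z 0 = x0 \<and>
     (\<forall>k. let y = ((t k - 1) / t k) *\<^sub>R x k + (1 / t k) *\<^sub>R z k in
        x (Suc k) = y - \<eta> k *\<^sub>R residual lam T (x k) (f k) \<and>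
        z (Suc k) = z k + \<nu> *\<^sub>R (x (Suc k) - y))"

text \<open>
  A sample of size \<open>n\<close> is a family \<open>X\<close> of which only the indices below \<open>n\<close> matter;
  \<open>batch n X \<omega>\<close> is its value, as an element of the \<open>n\<close>-fold product space.
\<close>

definition iid_sample :: "'w measure \<Rightarrow> 's measure \<Rightarrow> nat \<Rightarrow> (nat \<Rightarrow> 'w \<Rightarrow> 's) \<Rightarrow> bool" where
  "iid_sample M D n X \<longleftrightarrow>
     prob_space.indep_vars M (\<lambda>_. D) X {..<n} \<and> (\<forall>i<n. distr M D (X i) = D)"

definition batch :: "nat \<Rightarrow> (nat \<Rightarrow> 'w \<Rightarrow> 's) \<Rightarrow> 'w \<Rightarrow> nat \<Rightarrow> 's" where
  "batch n X \<omega> = (\<lambda>i\<in>{..<n}. X i \<omega>)"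

text \<open>
  The samples of one run: \<open>S k\<close> and \<open>S' k\<close> (\<open>k \<ge> 1\<close>) are the two mini-batches of iteration \<open>k\<close>,
  of sizes \<open>b k\<close> and \<open>b' k\<close>, and \<open>S' 0\<close> is the initial sample, of size \<open>n0\<close>; \<open>S 0\<close> is empty.
  The samples of different iterations are independent, but \<open>S k\<close> and \<open>S' k\<close> may be dependent.
\<close>

definition fresh_samples ::
  "'w measure \<Rightarrow> 's measure \<Rightarrow> nat \<Rightarrow> (nat \<Rightarrow> nat) \<Rightarrow> (nat \<Rightarrow> nat)
     \<Rightarrow> (nat \<Rightarrow> nat \<Rightarrow> 'w \<Rightarrow> 's) \<Rightarrow> (nat \<Rightarrow> nat \<Rightarrow> 'w \<Rightarrow> 's) \<Rightarrow> bool" where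
  "fresh_samples M D n0 b b' S S' \<longleftrightarrow>
     (let m = b(0 := 0); m' = b'(0 := n0) in
       (\<forall>k. iid_sample M D (m k) (S k) \<and> iid_sample M D (m' k) (S' k)) \<and>
       prob_space.indep_vars M
         (\<lambda>k. PiM {..<m k} (\<lambda>_. D) \<Otimes>\<^sub>M PiM {..<m' k} (\<lambda>_. D))
         (\<lambda>k \<omega>. (batch (m k) (S k) \<omega>, batch (m' k) (S' k) \<omega>)) UNIV)"

definition initial_estimator ::
  "'s measure \<Rightarrow> real \<Rightarrow> nat \<Rightarrow> 'a::euclidean_space \<Rightarrow> ((nat \<Rightarrow> 's) \<Rightarrow> 'a) \<Rightarrow> bool" where
  "initial_estimator D \<sigma> n v E0 \<longleftrightarrow>
     (let P = PiM {..<n} (\<lambda>_. D) in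
       E0 \<in> borel_measurable P \<and>
       integrable P (\<lambda>s. (norm (E0 s - v))\<^sup>2) \<and>
       (\<integral>s. (norm (E0 s - v))\<^sup>2 \<partial>P) \<le> \<sigma>\<^sup>2 / real n)"

definition unbiased_estimator ::
  "'s measure \<Rightarrow> real \<Rightarrow> nat \<Rightarrow> ('a::euclidean_space \<Rightarrow> 'a) \<Rightarrow> ('a \<Rightarrow> (nat \<Rightarrow> 's) \<Rightarrow> 'a) \<Rightarrow> bool" where
  "unbiased_estimator D \<sigma> n F E \<longleftrightarrow>
     (let P = PiM {..<n} (\<lambda>_. D) in
       case_prod E \<in> borel_measurable (borel \<Otimes>\<^sub>M P) \<and>
       (\<forall>x. integrable P (E x) \<and> (\<integral>s. E x s \<partial>P) = F x \<and>
            integrable P (\<lambda>s. (norm (E x s - F x))\<^sup>2) \<and>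
            (\<integral>s. (norm (E x s - F x))\<^sup>2 \<partial>P) \<le> \<sigma>\<^sup>2 / real n))"

text \<open>
  \<open>f k \<omega>\<close> is the hybrid SGD estimate of \<open>F (x k \<omega>)\<close>. The oracle is \<open>Fo\<close>, the initial estimate is
  the function \<open>E0\<close> of the initial sample, and \<open>E k u s\<close> is the unbiased estimate of \<open>F u\<close> built
  from the sample \<open>s\<close>.
\<close>

definition hsgd_estimates ::
  "'w measure \<Rightarrow> ('a::euclidean_space \<Rightarrow> 's \<Rightarrow> 'a) \<Rightarrow> (nat \<Rightarrow> real) \<Rightarrow> nat \<Rightarrow> (nat \<Rightarrow> nat) \<Rightarrow> (nat \<Rightarrow> nat)
     \<Rightarrow> (nat \<Rightarrow> nat \<Rightarrow> 'w \<Rightarrow> 's) \<Rightarrow> (nat \<Rightarrow> nat \<Rightarrow> 'w \<Rightarrow> 's)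
     \<Rightarrow> ((nat \<Rightarrow> 's) \<Rightarrow> 'a) \<Rightarrow> (nat \<Rightarrow> 'a \<Rightarrow> (nat \<Rightarrow> 's) \<Rightarrow> 'a)
     \<Rightarrow> (nat \<Rightarrow> 'w \<Rightarrow> 'a) \<Rightarrow> (nat \<Rightarrow> 'w \<Rightarrow> 'a) \<Rightarrow> bool" where
  "hsgd_estimates M Fo \<tau> n0 b b' S S' E0 E x f \<longleftrightarrow>
     (\<forall>\<omega> \<in> space M.
        f 0 \<omega> = E0 (batch n0 (S' 0) \<omega>) \<and>
        (\<forall>k \<ge> 1. f k \<omega> =
           (1 - \<tau> k) *\<^sub>R (f (k - 1) \<omega> +
              (1 / real (b k)) *\<^sub>R (\<Sum>i<b k. Fo (x k \<omega>) (S k i \<omega>) - Fo (x (k - 1) \<omega>) (S k i \<omega>)))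
           + \<tau> k *\<^sub>R E k (x k \<omega>) (batch (b' k) (S' k) \<omega>)))"

text \<open>
  Work needed to reach \<open>x K\<close>, i.e. for the iterations \<open>0, \<dots>, K - 1\<close>: the initial estimate takes
  \<open>n0\<close> oracle calls, the estimate at \<open>k \<ge> 1\<close> takes two calls for each point of \<open>S k\<close> and one for
  each point of \<open>S' k\<close> (no call is shared), and each iteration takes one resolvent evaluation.
  These numbers are not random, so this is also the expected work.
\<close>

definition oracle_calls :: "nat \<Rightarrow> (nat \<Rightarrow> nat) \<Rightarrow> (nat \<Rightarrow> nat) \<Rightarrow> nat \<Rightarrow> nat" where
  "oracle_calls n0 b b' k = (if k = 0 then n0 else 2 * b k + b' k)"

definition total_work :: "nat \<Rightarrow> (nat \<Rightarrow> nat) \<Rightarrow> (nat \<Rightarrow> nat) \<Rightarrow> nat \<Rightarrow> nat" where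
  "total_work n0 b b' K = (\<Sum>k<K. oracle_calls n0 b b' k + 1)"

end

theory Submission
  imports Defs
begin

text \<open>
  Zeros of \<open>F + T\<close> are zeros of the forward-backward residual \<open>G\<close>, which is single-valued and
  satisfies
  \<open>(G x - G y) \<bullet> (x - y) \<ge> \<beta>' * (norm (G x - G y))\<^sup>2 + \<Lambda> * gap x y\<close>,
  where \<open>gap x y\<close> is the mean square of \<open>Fo x s - Fo y s\<close> and \<open>\<Lambda> = 1 / L - 1 / L' > 0\<close>
  (\<open>G_cocoercive\<close>). The strict inequality \<open>L' > L\<close> is what leaves the multiple of \<open>gap\<close> over, and
  this surplus pays for the drift of the recursive estimator. That \<open>G\<close> makes sense at all is
  Minty's theorem in its co-hypomonotone form (\<open>resolvent_nonempty\<close>).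

  Let \<open>u k = t k * (t k - 1)\<close>, let \<open>e k\<close> be the mean square error of the \<open>k\<close>-th estimate and \<open>d k\<close>
  the mean of \<open>gap (x (k + 1)) (x k)\<close>. A potential with mean \<open>v k\<close>, which dominates a positive
  definite quadratic form in \<open>t k *\<^sub>R G (x k)\<close> and \<open>z k - xs\<close> for a zero \<open>xs\<close>, obeys (\<open>lyap_step\<close>)
  \<open>v (k + 1) + \<Lambda> * u k * d k \<le> (1 + a / u k) * v k + c * u k * e k\<close>,
  and the estimator obeys (\<open>error_step\<close>)
  \<open>e (k + 1) \<le> (1 - \<tau> (k + 1))\<^sup>2 * (e k + 2 / b * d k) + 2 * (\<tau> (k + 1))\<^sup>2 * \<sigma>\<^sup>2 / b'\<close>.
  The weights \<open>\<tau>\<close> are chosen so that \<open>u (k + 1) * (1 - \<tau> (k + 1))\<^sup>2 = (1 - \<epsilon>) * u k\<close>. In the sum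
  \<open>v k + (c / \<epsilon>) * u k * e k\<close> the contraction by \<open>1 - \<epsilon>\<close> therefore releases exactly the amount
  \<open>c * u k * e k\<close> that the potential is charged; the surplus outweighs the terms in \<open>d k\<close> once \<open>b\<close> is a large
  multiple of \<open>1 / \<epsilon>\<close>; the factors \<open>1 + a / u k\<close> have a bounded product, because \<open>u\<close> grows
  quadratically; and each step adds noise of order \<open>\<epsilon>\<close> when \<open>b'\<close> is of order \<open>1 / \<epsilon>\<^sup>2\<close>, because
  \<open>u k * (\<tau> k)\<^sup>2\<close> is bounded for \<open>k\<close> up to order \<open>1 / \<epsilon>\<close>. So the sum stays bounded over
  \<open>K \<approx> m / \<epsilon>\<close> steps (\<open>coupled_recursion_bound\<close>), and since the potential dominates a multiple of
  \<open>(t K)\<^sup>2 * (norm (G (x K)))\<^sup>2\<close>, the mean of \<open>(norm (G (x K)))\<^sup>2\<close> is of order \<open>\<epsilon>\<^sup>2\<close>. A step costs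
  \<open>2 * b + b' + 1\<close>, of order \<open>1 / \<epsilon>\<^sup>2\<close>, which gives the total of order \<open>1 / \<epsilon>\<^sup>3\<close>.

  The constants do not depend on each other in a circle: \<open>a\<close> and \<open>c\<close> come from \<open>\<mu>\<close>, \<open>\<beta>\<close> and \<open>\<beta>'\<close>;
  \<open>m\<close> is fixed next, assuming that the accumulated noise is at most 1, and the constant in \<open>b'\<close> is chosen
  last, so large that over \<open>m / \<epsilon>\<close> steps this assumption holds.
\<close>

section \<open>Resolvents of co-hypomonotone operators\<close>

text \<open>
  Each condition on \<open>u\<close> says that \<open>u\<close> lies in a ball, with quadratic function
  \<open>(norm u)\<^sup>2 - 2 * (u \<bullet> q) + c\<close> for \<open>q = a + p / 2\<close> and \<open>c = a \<bullet> a + a \<bullet> p\<close>. By Lagrangian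
  duality the common point is the \<open>q\<close>-component of a maximiser of the dual function
  \<open>c - (norm q)\<^sup>2\<close> over the convex hull of the data. The pairwise condition makes this function
  nonpositive on the hull, and first-order optimality in the direction of one datum is the
  inequality of the corresponding ball.
\<close>

lemma monotone_balls_meet_finite:
  fixes I :: "('a::euclidean_space \<times> 'a) set"
  assumes fin: "finite I"
    and mono: "\<And>a p b q. (a, p) \<in> I \<Longrightarrow> (b, q) \<in> I \<Longrightarrow> (norm (a - b))\<^sup>2 + (a - b) \<bullet> (p - q) \<le> 0"
  shows "\<exists>u. \<forall>(a, p)\<in>I. (norm (u - a))\<^sup>2 \<le> (u - a) \<bullet> p"
proof (cases "I = {}")
  case False
  define P where "P = (\<lambda>(a, p). (a, p, a \<bullet> a + a \<bullet> p)) ` I"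
  define H where "H = convex hull P"
  \<comment> \<open>The pairwise condition is affine in each of the two triples, so it passes to the hull one argument at a time.\<close>
  have h: "c + c' - 2 * (a \<bullet> a') - a \<bullet> p' - a' \<bullet> p \<le> 0"
    if "(a, p, c) \<in> P" "(a', p', c') \<in> P" for a p c a' p' c'
  proof -
    from that have "(norm (a - a'))\<^sup>2 + (a - a') \<bullet> (p - p') \<le> 0" "c = a \<bullet> a + a \<bullet> p" "c' = a' \<bullet> a' + a' \<bullet> p'"
      using mono by (auto simp: P_def)
    then show ?thesis
      by (simp add: power2_norm_eq_inner inner_diff_left inner_diff_right inner_commute)
  qed
  have half: "H \<subseteq> {y. (- 2 *\<^sub>R a' - p', - a', 1) \<bullet> y \<le> - c'}"
    if "\<And>a p c. (a, p, c) \<in> P \<Longrightarrow> c + c' - 2 * (a \<bullet> a') - a \<bullet> p' - a' \<bullet> p \<le> 0"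
    for a' p' :: 'a and c' :: real
    unfolding H_def
  proof (rule hull_minimal)
    show "P \<subseteq> {y. (- 2 *\<^sub>R a' - p', - a', 1) \<bullet> y \<le> - c'}"
      using that by (auto simp: inner_diff_left inner_commute algebra_simps)
  qed (rule convex_halfspace_le)
  have h1: "c + c' - 2 * (a \<bullet> a') - a \<bullet> p' - a' \<bullet> p \<le> 0"
    if "(a, p, c) \<in> H" "(a', p', c') \<in> P" for a p c a' p' c'
    using half[OF h[OF _ that(2)]] that(1)
    by (auto simp: inner_diff_left inner_commute algebra_simps)
  have h2: "c + c' - 2 * (a \<bullet> a') - a \<bullet> p' - a' \<bullet> p \<le> 0"
    if "(a, p, c) \<in> H" "(a', p', c') \<in> H" for a p c a' p' c'
  proof -
    have "c1 + c - 2 * (a1 \<bullet> a) - a1 \<bullet> p - a \<bullet> p1 \<le> 0" if "(a1, p1, c1) \<in> P" for a1 p1 c1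
      using h1[OF \<open>(a, p, c) \<in> H\<close> that] by (simp add: inner_commute algebra_simps)
    from half[OF this] that(2) show ?thesis
      by (auto simp: inner_diff_left inner_commute algebra_simps)
  qed
  define d where "d = (\<lambda>y :: 'a \<times> 'a \<times> real. snd (snd y) - (norm (fst y + (1/2) *\<^sub>R fst (snd y)))\<^sup>2)"
  have "compact H" "H \<noteq> {}"
    using fin False by (auto simp: H_def P_def intro: finite_imp_compact_convex_hull)
  moreover have "continuous_on H d"
    unfolding d_def by (intro continuous_intros)
  ultimately obtain y where y: "y \<in> H" "\<And>y'. y' \<in> H \<Longrightarrow> d y' \<le> d y"
    by (meson continuous_attains_sup)
  obtain a0 p0 c0 where y_eq: "y = (a0, p0, c0)" by (cases y) auto
  define u where "u = a0 + (1/2) *\<^sub>R p0"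
  have d0: "d y \<le> 0"
  proof -
    have "(norm u)\<^sup>2 = a0 \<bullet> a0 + a0 \<bullet> p0 + (norm p0)\<^sup>2 / 4"
      by (simp add: u_def power2_norm_eq_inner inner_add_left inner_add_right inner_commute)
    moreover have "c0 \<le> a0 \<bullet> a0 + a0 \<bullet> p0" using h2[of a0 p0 c0 a0 p0 c0] y(1) y_eq by simp
    moreover have "0 \<le> (norm p0)\<^sup>2 / 4" by simp
    ultimately have "c0 - (norm u)\<^sup>2 \<le> 0" by linarith
    then show ?thesis by (simp add: d_def y_eq u_def)
  qed
  have "(norm (u - a))\<^sup>2 \<le> (u - a) \<bullet> p" if ap: "(a, p) \<in> I" for a p
  proof -
    define c where "c = a \<bullet> a + a \<bullet> p"
    define q where "q = a + (1/2) *\<^sub>R p"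
    have inH: "(a, p, c) \<in> H"
      unfolding H_def by (rule hull_inc) (use ap in \<open>auto simp: P_def c_def\<close>)
    have step: "(c - c0) - 2 * (u \<bullet> (q - u)) \<le> s * (norm (q - u))\<^sup>2" if s: "0 < s" "s < 1" for s :: real
    proof -
      have "(1 - s) *\<^sub>R y + s *\<^sub>R (a, p, c) \<in> H"
        using y(1) inH s unfolding H_def by (intro convexD[OF convex_convex_hull]) auto
      from y(2)[OF this] have "c0 + s * (c - c0) - (norm (u + s *\<^sub>R (q - u)))\<^sup>2 \<le> c0 - (norm u)\<^sup>2"
        by (simp add: d_def y_eq u_def q_def algebra_simps)
      moreover have "(norm (u + s *\<^sub>R (q - u)))\<^sup>2 = (norm u)\<^sup>2 + 2 * s * (u \<bullet> (q - u)) + s\<^sup>2 * (norm (q - u))\<^sup>2"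
        unfolding power2_norm_eq_inner
        by (simp add: inner_add_left inner_add_right inner_commute power2_eq_square algebra_simps)
      ultimately have "s * ((c - c0) - 2 * (u \<bullet> (q - u))) \<le> s * (s * (norm (q - u))\<^sup>2)"
        by (simp add: algebra_simps power2_eq_square)
      then show ?thesis using s(1) by simp
    qed
    have "(c - c0) - 2 * (u \<bullet> (q - u)) \<le> 0"
    proof (rule tendsto_le)
      show "((\<lambda>s. s * (norm (q - u))\<^sup>2) \<longlongrightarrow> 0) (at_right 0)"
        by (rule tendsto_eq_intros refl | simp)+
      show "((\<lambda>s. (c - c0) - 2 * (u \<bullet> (q - u))) \<longlongrightarrow> (c - c0) - 2 * (u \<bullet> (q - u))) (at_right (0::real))"
        by simp
      show "\<forall>\<^sub>F s in at_right 0. (c - c0) - 2 * (u \<bullet> (q - u)) \<le> s * (norm (q - u))\<^sup>2"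
        using step unfolding eventually_at_right_field by (auto intro: exI[of _ 1])
    qed simp
    moreover have "c0 - (norm u)\<^sup>2 \<le> 0" using d0 by (simp add: d_def y_eq u_def)
    moreover have "(norm (u - a))\<^sup>2 - (u - a) \<bullet> p = (norm u)\<^sup>2 - 2 * (u \<bullet> q) + c"
      unfolding power2_norm_eq_inner q_def c_def
      by (simp add: inner_add_left inner_add_right inner_diff_left inner_diff_right inner_commute)
    ultimately show ?thesis
      by (simp add: inner_diff_right power2_norm_eq_inner)
  qed
  then show ?thesis by blast
qed auto

text \<open>
  The balls are compact, so the finite intersection property reduces this to the finite case.
\<close>

lemma monotone_balls_meet:
  fixes I :: "('a::euclidean_space \<times> 'a) set"
  assumes mono: "\<And>a p b q. (a, p) \<in> I \<Longrightarrow> (b, q) \<in> I \<Longrightarrow> (norm (a - b))\<^sup>2 + (a - b) \<bullet> (p - q) \<le> 0"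
  shows "\<exists>u. \<forall>(a, p)\<in>I. (norm (u - a))\<^sup>2 \<le> (u - a) \<bullet> p"
proof (cases "I = {}")
  case False
  define B where "B = (\<lambda>(a :: 'a, p). {u. (norm (u - a))\<^sup>2 \<le> (u - a) \<bullet> p})"
  have closed: "closed (B i)" for i
    by (cases i) (auto simp: B_def intro!: closed_Collect_le continuous_intros)
  have bounded: "bounded (B i)" for i
  proof -
    obtain a p where i: "i = (a, p)" by (cases i)
    have "norm (u - a) \<le> norm p" if "u \<in> B i" for u
    proof -
      have "norm (u - a) * norm (u - a) \<le> (u - a) \<bullet> p"
        using that by (simp add: B_def i power2_eq_square)
      also have "\<dots> \<le> norm (u - a) * norm p" by (rule norm_cauchy_schwarz)
      finally show ?thesis
        by (metis mult_le_cancel_left_pos norm_ge_zero order_le_less)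
    qed
    then have "B i \<subseteq> cball a (norm p)" by (auto simp: dist_norm norm_minus_commute)
    then show ?thesis using bounded_cball bounded_subset by blast
  qed
  obtain i0 where i0: "i0 \<in> I" using False by blast
  have "B i0 \<inter> \<Inter> (B ` I) \<noteq> {}"
  proof (rule compact_imp_fip)
    show "compact (B i0)" using closed bounded compact_eq_bounded_closed by blast
    show "closed C" if "C \<in> B ` I" for C using that closed by blast
    fix \<F> assume "finite \<F>" "\<F> \<subseteq> B ` I"
    then obtain J where J: "finite J" "J \<subseteq> I" "\<F> = B ` J"
      by (meson finite_subset_image)
    have "\<exists>u. \<forall>(a, p)\<in>insert i0 J. (norm (u - a))\<^sup>2 \<le> (u - a) \<bullet> p"
      using J i0 by (intro monotone_balls_meet_finite mono) auto
    then show "B i0 \<inter> \<Inter> \<F> \<noteq> {}" using J by (fastforce simp: B_def)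
  qed
  then show ?thesis by (fastforce simp: B_def)
qed auto

lemma cohypomonotoneD:
  assumes "cohypomonotone \<rho> T" "u \<in> T x" "v \<in> T y"
  shows "(u - v) \<bullet> (x - y) \<ge> - \<rho> * (norm (u - v))\<^sup>2"
  using assms by (force simp: cohypomonotone_def op_graph_def)

text \<open>
  Minty's theorem. A pair \<open>(w, u)\<close> with \<open>x = w + lam *\<^sub>R u\<close> may be added to the graph of \<open>T\<close> without
  violating co-hypomonotonicity exactly when \<open>u\<close> lies in one ball for every point of the graph, of
  the kind treated above after division by \<open>lam - \<rho>\<close>. Such a \<open>u\<close> exists, and by maximality the
  pair already belongs to the graph.
\<close>

lemma resolvent_nonempty:
  fixes T :: "'a::euclidean_space \<Rightarrow> 'a set"
  assumes T: "maximally_cohypomonotone \<rho> T" and lam: "lam > \<rho>"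
  shows "resolvent lam T x \<noteq> {}"
proof -
  define g where "g = lam - \<rho>"
  have g: "g > 0" using lam by (simp add: g_def)
  have mT: "cohypomonotone \<rho> T" using T by (simp add: maximally_cohypomonotone_def)
  define I where "I = {(a, (1 / g) *\<^sub>R (x - w - lam *\<^sub>R a)) | a w. a \<in> T w}"
  have "\<exists>u. \<forall>(a, p)\<in>I. (norm (u - a))\<^sup>2 \<le> (u - a) \<bullet> p"
  proof (rule monotone_balls_meet)
    fix a p b q assume "(a, p) \<in> I" "(b, q) \<in> I"
    then obtain w v where w: "a \<in> T w" "p = (1 / g) *\<^sub>R (x - w - lam *\<^sub>R a)"
      and v: "b \<in> T v" "q = (1 / g) *\<^sub>R (x - v - lam *\<^sub>R b)"
      by (auto simp: I_def)
    have pq: "p - q = (1 / g) *\<^sub>R (- (w - v) - lam *\<^sub>R (a - b))"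
      by (simp add: w v algebra_simps)
    have "g * ((a - b) \<bullet> (p - q)) = - ((a - b) \<bullet> (w - v)) - lam * (norm (a - b))\<^sup>2"
      using g by (simp add: pq power2_norm_eq_inner inner_diff_right algebra_simps)
    also have "\<dots> \<le> - (g * (norm (a - b))\<^sup>2)"
      using cohypomonotoneD[OF mT w(1) v(1)] by (simp add: g_def algebra_simps)
    finally have "g * ((norm (a - b))\<^sup>2 + (a - b) \<bullet> (p - q)) \<le> 0" by (simp add: algebra_simps)
    then show "(norm (a - b))\<^sup>2 + (a - b) \<bullet> (p - q) \<le> 0"
      using g by (simp add: mult_le_0_iff)
  qed
  then obtain u where u: "\<And>a w. a \<in> T w \<Longrightarrow>
      (norm (u - a))\<^sup>2 \<le> (u - a) \<bullet> ((1 / g) *\<^sub>R (x - w - lam *\<^sub>R a))"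
    unfolding I_def by blast
  define w where "w = x - lam *\<^sub>R u"
  have new: "(u - a) \<bullet> (w - v) \<ge> - \<rho> * (norm (u - a))\<^sup>2" if "a \<in> T v" for a v
  proof -
    have "g * (norm (u - a))\<^sup>2 \<le> (u - a) \<bullet> (x - v - lam *\<^sub>R a)"
      using u[OF that] g by (simp add: pos_le_divide_eq mult.commute del: scaleR_diff_right)
    moreover have "x - v - lam *\<^sub>R a = (w - v) + lam *\<^sub>R (u - a)"
      by (simp add: w_def algebra_simps)
    ultimately show ?thesis
      by (simp add: g_def inner_add_right power2_norm_eq_inner algebra_simps)
  qed
  define T' where "T' = T(w := insert u (T w))"
  have sym: "(a - u) \<bullet> (v - w) = (u - a) \<bullet> (w - v)" "norm (a - u) = norm (u - a)" for a v
    by (metis inner_minus_left inner_minus_right minus_diff_eq minus_minus, rule norm_minus_commute)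
  have "- \<rho> * (norm (b - c))\<^sup>2 \<le> (b - c) \<bullet> (y - z)" if "b \<in> T' y" "c \<in> T' z" for b c y z
  proof -
    consider "b \<in> T y" "c \<in> T z" | "b = u" "y = w" "c \<in> T z" | "b \<in> T y" "c = u" "z = w"
      | "b = u" "y = w" "c = u" "z = w"
      using \<open>b \<in> T' y\<close> \<open>c \<in> T' z\<close> by (auto simp: T'_def split: if_splits)
    then show ?thesis
    proof cases
      case 1 then show ?thesis by (rule cohypomonotoneD[OF mT])
    next
      case 2 then show ?thesis using new[of c z] by simp
    next
      case 3 then show ?thesis using new[of b y] by (simp add: sym)
    qed simp
  qed
  then have "cohypomonotone \<rho> T'" by (auto simp: cohypomonotone_def op_graph_def)
  moreover have "op_graph T \<subseteq> op_graph T'" by (auto simp: op_graph_def T'_def)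
  ultimately have "op_graph T' = op_graph T"
    using T unfolding maximally_cohypomonotone_def by blast
  moreover have "(w, u) \<in> op_graph T'" by (simp add: op_graph_def T'_def)
  ultimately have "u \<in> T w" by (simp add: op_graph_def)
  then have "w \<in> resolvent lam T x" by (auto simp: resolvent_def w_def)
  then show ?thesis by blast
qed

section \<open>Co-coercivity of the forward-backward residual\<close>

text \<open>
  Expanding the square of the right-hand side, co-hypomonotonicity costs
  \<open>2 * lam * \<rho> * (norm (u - v))\<^sup>2\<close>, which \<open>lam\<^sup>2 * (norm (u - v))\<^sup>2\<close> covers since \<open>2 * \<rho> \<le> lam\<close>.
\<close>

lemma nonexpansive_estimate:
  fixes u v x y :: "'a::real_inner"
  assumes T: "cohypomonotone \<rho> T" "u \<in> T w" "v \<in> T w'" and lam: "lam > 0" "2 * \<rho> \<le> lam"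
  shows "norm (w - w') \<le> norm ((w + lam *\<^sub>R u) - (w' + lam *\<^sub>R v))"
proof -
  have "(norm ((w + lam *\<^sub>R u) - (w' + lam *\<^sub>R v)))\<^sup>2
      = (norm ((w - w') + lam *\<^sub>R (u - v)))\<^sup>2"
    by (simp add: algebra_simps)
  also have "\<dots> = (norm (w - w'))\<^sup>2 + 2 * lam * ((u - v) \<bullet> (w - w')) + lam\<^sup>2 * (norm (u - v))\<^sup>2"
    unfolding power2_norm_eq_inner
    by (simp add: inner_add_left inner_add_right inner_commute power2_eq_square algebra_simps)
  also have "\<dots> \<ge> (norm (w - w'))\<^sup>2 + lam * (lam - 2 * \<rho>) * (norm (u - v))\<^sup>2"
    using mult_left_mono[OF cohypomonotoneD[OF T], of "2 * lam"] lam
    by (simp add: algebra_simps power2_eq_square)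
  finally have "(norm ((w + lam *\<^sub>R u) - (w' + lam *\<^sub>R v)))\<^sup>2
      \<ge> (norm (w - w'))\<^sup>2 + lam * (lam - 2 * \<rho>) * (norm (u - v))\<^sup>2" .
  moreover have "lam * (lam - 2 * \<rho>) * (norm (u - v))\<^sup>2 \<ge> 0" using lam by simp
  ultimately have "(norm (w - w'))\<^sup>2 \<le> (norm ((w + lam *\<^sub>R u) - (w' + lam *\<^sub>R v)))\<^sup>2"
    by linarith
  then show ?thesis by (rule power2_le_imp_le) simp
qed

lemma residual_unique:
  fixes T :: "'a::euclidean_space \<Rightarrow> 'a set"
  assumes T: "cohypomonotone \<rho> T" and lam: "lam > 0" "2 * \<rho> \<le> lam"
    and u: "u \<in> T w" "x - lam *\<^sub>R v = w + lam *\<^sub>R u"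
  shows "residual lam T x v = v + u"
proof -
  have "resolvent lam T (x - lam *\<^sub>R v) = {w}"
  proof (intro equalityI subsetI)
    fix w' assume "w' \<in> resolvent lam T (x - lam *\<^sub>R v)"
    then obtain u' where "u' \<in> T w'" "x - lam *\<^sub>R v = w' + lam *\<^sub>R u'" by (auto simp: resolvent_def)
    with nonexpansive_estimate[OF T this(1) u(1) lam] u show "w' \<in> {w}" by simp
  qed (use u in \<open>auto simp: resolvent_def\<close>)
  then have "residual lam T x v = (1 / lam) *\<^sub>R (x - w)" by (simp add: residual_def)
  also have "x - w = lam *\<^sub>R (v + u)" using u(2) by (simp add: algebra_simps)
  finally show ?thesis using lam by simp
qed

text \<open>
  This describes the residual \<open>g\<close> without the resolvent: \<open>x - lam *\<^sub>R g\<close> is the forward-backward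
  point, and \<open>g - v\<close> is the value of \<open>T\<close> that was chosen there.
\<close>

lemma residual_witness:
  fixes T :: "'a::euclidean_space \<Rightarrow> 'a set"
  assumes T: "maximally_cohypomonotone \<rho> T" and rho: "\<rho> \<ge> 0" and lam: "lam > 0" "2 * \<rho> \<le> lam"
  shows "residual lam T x v - v \<in> T (x - lam *\<^sub>R residual lam T x v)"
proof -
  have "\<rho> < lam" using rho lam by linarith
  from resolvent_nonempty[OF T this] obtain w where "w \<in> resolvent lam T (x - lam *\<^sub>R v)" by blast
  then obtain u where u: "u \<in> T w" "x - lam *\<^sub>R v = w + lam *\<^sub>R u" by (auto simp: resolvent_def)
  have "residual lam T x v = v + u"
    using T by (intro residual_unique[where \<rho> = \<rho> and w = w] lam u) (simp add: maximally_cohypomonotone_def)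
  with u show ?thesis by (simp add: algebra_simps)
qed

lemma residual_nonexpansive:
  fixes T :: "'a::euclidean_space \<Rightarrow> 'a set"
  assumes T: "maximally_cohypomonotone \<rho> T" and rho: "\<rho> \<ge> 0" and lam: "lam > 0" "2 * \<rho> \<le> lam"
  shows "norm ((x - lam *\<^sub>R residual lam T x v) - (y - lam *\<^sub>R residual lam T y w))
    \<le> norm ((x - lam *\<^sub>R v) - (y - lam *\<^sub>R w))"
proof -
  have "cohypomonotone \<rho> T" using T by (simp add: maximally_cohypomonotone_def)
  from nonexpansive_estimate[OF this residual_witness[OF T rho lam] residual_witness[OF T rho lam] lam,
    of x v y w] show ?thesis by (simp add: algebra_simps)
qed

text \<open>
  An error in the estimate of \<open>F x\<close> enters the residual undamped but not amplified: the factor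
  \<open>1 / lam\<close> of the residual cancels the step length \<open>lam\<close> inside the nonexpansive resolvent.
\<close>

lemma residual_lipschitz_estimate:
  fixes T :: "'a::euclidean_space \<Rightarrow> 'a set"
  assumes T: "maximally_cohypomonotone \<rho> T" and rho: "\<rho> \<ge> 0" and lam: "lam > 0" "2 * \<rho> \<le> lam"
  shows "norm (residual lam T x v - residual lam T x w) \<le> norm (v - w)"
proof -
  have "lam * norm (residual lam T x v - residual lam T x w)
      = norm ((x - lam *\<^sub>R residual lam T x v) - (x - lam *\<^sub>R residual lam T x w))"
    using lam by (simp flip: scaleR_diff_right add: norm_minus_commute)
  also have "\<dots> \<le> norm ((x - lam *\<^sub>R v) - (x - lam *\<^sub>R w))"
    by (rule residual_nonexpansive[OF assms])
  also have "\<dots> = lam * norm (v - w)"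
    using lam by (simp flip: scaleR_diff_right add: norm_minus_commute)
  finally show ?thesis using lam by simp
qed

lemma residual_measurable:
  fixes T :: "'a::euclidean_space \<Rightarrow> 'a set"
  assumes T: "maximally_cohypomonotone \<rho> T" and rho: "\<rho> \<ge> 0" and lam: "lam > 0" "2 * \<rho> \<le> lam"
  shows "(\<lambda>(x, v). residual lam T x v) \<in> borel_measurable (borel \<Otimes>\<^sub>M borel)"
proof -
  define J where "J = (\<lambda>p. p - lam *\<^sub>R residual lam T p 0)"
  have J: "residual lam T x v = (1 / lam) *\<^sub>R (x - J (x - lam *\<^sub>R v))" for x v
    using lam by (simp add: J_def residual_def)
  have "1-lipschitz_on UNIV J"
    using residual_nonexpansive[OF assms, of _ 0 _ 0]
    by (intro lipschitz_onI) (auto simp: J_def dist_norm)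
  then have "continuous_on UNIV J" by (rule lipschitz_on_continuous_on)
  then have [measurable]: "J \<in> borel_measurable borel" by (rule borel_measurable_continuous_onI)
  show ?thesis unfolding J by measurable
qed

text \<open>
  With \<open>g\<close> and \<open>p\<close> the differences of the residuals and of the values of \<open>F\<close>, co-hypomonotonicity at
  the two forward-backward points and the assumption on \<open>F\<close> bound the inner product from below by a
  quadratic form in \<open>p\<close> and \<open>g\<close>. Completing the square in \<open>p\<close> leaves the stated constant. The
  term \<open>A\<close> is carried along for the surplus of co-coercivity of a stochastic oracle.
\<close>

lemma residual_cocoercive:
  fixes T :: "'a::euclidean_space \<Rightarrow> 'a set"
  assumes T: "maximally_cohypomonotone \<rho> T" and rho: "\<rho> \<ge> 0" and lam: "lam > 0" "2 * \<rho> \<le> lam"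
    and L': "L' > 0" "L' * \<rho> < 1"
    and mono: "(F x - F y) \<bullet> (x - y) \<ge> (1 / L') * (norm (F x - F y))\<^sup>2 + A"
  shows "(G_op lam F T x - G_op lam F T y) \<bullet> (x - y)
    \<ge> (lam * (4 - L' * lam) - 4 * \<rho>) / (4 * (1 - \<rho> * L')) * (norm (G_op lam F T x - G_op lam F T y))\<^sup>2 + A"
proof -
  define g p d where "g = G_op lam F T x - G_op lam F T y" and "p = F x - F y" and "d = x - y"
  define h where "h = 1 / L' - \<rho>"
  have h: "h > 0" using L' by (simp add: h_def field_simps)
  have cT: "cohypomonotone \<rho> T" using T by (simp add: maximally_cohypomonotone_def)
  have "- \<rho> * (norm (g - p))\<^sup>2 \<le> (g - p) \<bullet> (d - lam *\<^sub>R g)"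
    using cohypomonotoneD[OF cT residual_witness[OF T rho lam, of x "F x"] residual_witness[OF T rho lam, of y "F y"]]
    by (simp add: g_def p_def d_def G_op_def algebra_simps)
  then have "g \<bullet> d \<ge> p \<bullet> d + lam * (g \<bullet> g - p \<bullet> g) - \<rho> * (g \<bullet> g - 2 * (p \<bullet> g) + p \<bullet> p)"
    by (simp add: power2_norm_eq_inner inner_diff_left inner_diff_right inner_commute algebra_simps)
  moreover have "p \<bullet> d \<ge> (h + \<rho>) * (p \<bullet> p) + A"
    using mono by (simp add: p_def d_def h_def power2_norm_eq_inner)
  ultimately have "g \<bullet> d \<ge> h * (p \<bullet> p) - (lam - 2 * \<rho>) * (p \<bullet> g) + (lam - \<rho>) * (g \<bullet> g) + A"
    by (simp add: algebra_simps)
  \<comment> \<open>The form in \<open>p\<close> is smallest at \<open>p = c *\<^sub>R g\<close>.\<close>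
  moreover have "h * (p \<bullet> p) - (lam - 2 * \<rho>) * (p \<bullet> g) \<ge> - ((lam - 2 * \<rho>)\<^sup>2 / (4 * h)) * (g \<bullet> g)"
  proof -
    define c where "c = (lam - 2 * \<rho>) / (2 * h)"
    have c: "lam - 2 * \<rho> = 2 * h * c" using h by (simp add: c_def)
    have "0 \<le> h * ((p - c *\<^sub>R g) \<bullet> (p - c *\<^sub>R g))" using h by simp
    also have "\<dots> = h * (p \<bullet> p) - 2 * h * c * (p \<bullet> g) + h * c\<^sup>2 * (g \<bullet> g)"
      by (simp add: inner_diff_left inner_diff_right inner_commute power2_eq_square algebra_simps)
    also have "h * c\<^sup>2 = (lam - 2 * \<rho>)\<^sup>2 / (4 * h)"
      unfolding c using h by (simp add: power2_eq_square)
    finally show ?thesis by (simp add: c)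
  qed
  moreover have "(lam * (4 - L' * lam) - 4 * \<rho>) / (4 * (1 - \<rho> * L'))
      = (lam - \<rho>) - (lam - 2 * \<rho>)\<^sup>2 / (4 * h)"
  proof -
    have e: "1 - \<rho> * L' = L' * h" using L' by (simp add: h_def field_simps)
    have "L' * ((lam - \<rho>) * (4 * h) - (lam - 2 * \<rho>)\<^sup>2) = lam * (4 - L' * lam) - 4 * \<rho>"
      using L' by (simp add: h_def field_simps power2_eq_square)
    then show ?thesis unfolding e using h L'
      by (simp add: divide_simps) (simp add: algebra_simps power2_eq_square)
  qed
  ultimately show ?thesis
    unfolding g_def[symmetric] d_def[symmetric]
    by (simp add: power2_norm_eq_inner left_diff_distrib)
qed

lemma G_op_zero:
  fixes T :: "'a::euclidean_space \<Rightarrow> 'a set"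
  assumes "cohypomonotone \<rho> T" "lam > 0" "2 * \<rho> \<le> lam" and "x \<in> zer (op_sum F T)"
  shows "G_op lam F T x = 0"
proof -
  from assms(4) obtain u where u: "u \<in> T x" "0 = F x + u" by (auto simp: zer_def op_sum_def)
  then have e: "u = - F x" by (metis add_eq_0_iff)
  have "residual lam T x (F x) = F x + u"
    by (rule residual_unique[OF assms(1-3), where w = x]) (use u e in simp_all)
  then show ?thesis by (simp add: G_op_def flip: u(2))
qed

section \<open>The potential function along one step\<close>

lemma young_inner:
  fixes u v :: "'a::real_inner"
  assumes "a > 0"
  shows "a * (norm u)\<^sup>2 + 2 * b * (u \<bullet> v) + b\<^sup>2 / a * (norm v)\<^sup>2 \<ge> 0"
proof -
  have "0 \<le> a * (norm (u + (b / a) *\<^sub>R v))\<^sup>2" using assms by simp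
  also have "\<dots> = a * (norm u)\<^sup>2 + 2 * b * (u \<bullet> v) + b\<^sup>2 / a * (norm v)\<^sup>2"
    using assms unfolding power2_norm_eq_inner
    by (simp add: inner_add_left inner_add_right inner_commute power2_eq_square field_simps)
  finally show ?thesis .
qed

text \<open>
  The potential: \<open>w\<close> stands for the residual at \<open>x\<close>, and \<open>xs\<close> for a zero of it. The coefficient of
  the last square is \<open>(1 - \<mu>) / (\<mu> * \<eta>)\<close> for the step size \<open>\<eta> = 2 * \<beta> * (t - 1) / (t - \<mu> / 2)\<close>; with
  this value the inner product of \<open>w\<close> and \<open>z - xs\<close> cancels from the decrease along a step.
\<close>

definition lyap :: "real \<Rightarrow> real \<Rightarrow> 'a::real_inner \<Rightarrow> real \<Rightarrow> 'a \<Rightarrow> 'a \<Rightarrow> 'a \<Rightarrow> real" where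
  "lyap \<mu> \<beta> xs t w x z =
     \<beta> * (t - \<mu>) * (t - \<mu> - 1) * (norm w)\<^sup>2 + (t - \<mu>) * (w \<bullet> (x - z))
     + (1 - \<mu>) * (t - \<mu> / 2) / (2 * \<mu> * \<beta> * (t - 1)) * (norm (z - xs))\<^sup>2"

text \<open>
  Co-coercivity at \<open>x\<close> and \<open>xs\<close> replaces \<open>x\<close> by \<open>xs\<close> in the mixed term and raises the weight of
  \<open>(norm w)\<^sup>2\<close> to \<open>\<beta> * (t - \<mu>)\<^sup>2\<close>. What remains bounds a quadratic form in \<open>(t - \<mu>) *\<^sub>R w\<close> and \<open>z - xs\<close>
  with coefficients \<open>\<beta>\<close>, \<open>-1\<close> and \<open>(1 - \<mu>) / (2 * \<mu> * \<beta>)\<close> from above, and this form is positive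
  definite exactly for \<open>2 * (1 - \<mu>) > \<mu>\<close>, that is \<open>\<mu> < 2 / 3\<close>.
\<close>

lemma lyap_lower_bound:
  assumes mu: "0 < \<mu>" "\<mu> < 2 / 3" and beta: "0 < \<beta>" "\<beta> \<le> \<beta>'"
    and t: "t \<ge> 5 * \<mu> + 1"
    and mono: "w \<bullet> (x - xs) \<ge> \<beta>' * (norm w)\<^sup>2"
  shows "lyap \<mu> \<beta> xs t w x z \<ge> \<beta> * (2 - 3 * \<mu>) / (2 - \<mu>) * (t - \<mu>)\<^sup>2 * (norm w)\<^sup>2
      + (2 - 3 * \<mu>) / (8 * \<mu> * \<beta>) * (norm (z - xs))\<^sup>2"
proof -
  define s where "s = t - \<mu>"
  have s: "s \<ge> 1" using t mu by (simp add: s_def)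
  define C where "C = (1 - \<mu>) * (t - \<mu> / 2) / (2 * \<mu> * \<beta> * (t - 1))"
  have C: "C \<ge> (1 - \<mu>) / (2 * \<mu> * \<beta>)"
  proof -
    have "(1 - \<mu>) / (2 * \<mu> * \<beta>) * 1 \<le> (1 - \<mu>) / (2 * \<mu> * \<beta>) * ((t - \<mu> / 2) / (t - 1))"
      using mu beta t by (intro mult_left_mono) auto
    then show ?thesis by (simp add: C_def)
  qed
  \<comment> \<open>The part of \<open>\<beta>\<close> spent on absorbing the mixed term; the share \<open>2 * \<mu> / (2 - \<mu>)\<close> is below 1.\<close>
  define A where "A = 2 * \<mu> * \<beta> / (2 - \<mu>)"
  have A: "A > 0" using mu beta by (simp add: A_def)
  have "0 \<le> A * (norm (s *\<^sub>R w))\<^sup>2 + 2 * (- 1 / 2) * ((s *\<^sub>R w) \<bullet> (z - xs))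
      + (- 1 / 2)\<^sup>2 / A * (norm (z - xs))\<^sup>2"
    by (rule young_inner[OF A])
  then have 1: "0 \<le> A * s\<^sup>2 * (norm w)\<^sup>2 - s * (w \<bullet> (z - xs)) + (2 - \<mu>) / (8 * \<mu> * \<beta>) * (norm (z - xs))\<^sup>2"
    using mu beta by (simp add: A_def power_mult_distrib power2_eq_square field_simps)
  have 2: "s * (w \<bullet> (x - xs)) \<ge> s * (\<beta> * (norm w)\<^sup>2)"
    using mono beta s by (intro mult_left_mono) (auto intro: order_trans[OF mult_right_mono])
  have 3: "C * (norm (z - xs))\<^sup>2 \<ge> (1 - \<mu>) / (2 * \<mu> * \<beta>) * (norm (z - xs))\<^sup>2"
    using C by (intro mult_right_mono) auto
  have 4: "(1 - \<mu>) / (2 * \<mu> * \<beta>) = (2 - \<mu>) / (8 * \<mu> * \<beta>) + (2 - 3 * \<mu>) / (8 * \<mu> * \<beta>)"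
    using mu beta by (simp add: field_simps)
  have 5: "\<beta> = A + \<beta> * (2 - 3 * \<mu>) / (2 - \<mu>)"
  proof -
    have "A + \<beta> * (2 - 3 * \<mu>) / (2 - \<mu>) = \<beta> * (2 - \<mu>) / (2 - \<mu>)"
      unfolding A_def add_divide_distrib[symmetric] by (simp add: algebra_simps)
    then show ?thesis using mu by simp
  qed
  have "lyap \<mu> \<beta> xs t w x z = \<beta> * s * (s - 1) * (norm w)\<^sup>2 + s * (w \<bullet> (x - xs)) - s * (w \<bullet> (z - xs))
      + C * (norm (z - xs))\<^sup>2"
    by (simp add: lyap_def s_def C_def inner_diff_right algebra_simps)
  also have "\<dots> \<ge> \<beta> * s\<^sup>2 * (norm w)\<^sup>2 - s * (w \<bullet> (z - xs))
      + ((2 - \<mu>) / (8 * \<mu> * \<beta>) + (2 - 3 * \<mu>) / (8 * \<mu> * \<beta>)) * (norm (z - xs))\<^sup>2"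
    using 2 3[unfolded 4] by (simp add: algebra_simps power2_eq_square)
  also have "\<beta> * s\<^sup>2 * (norm w)\<^sup>2 = A * s\<^sup>2 * (norm w)\<^sup>2 + \<beta> * (2 - 3 * \<mu>) / (2 - \<mu>) * s\<^sup>2 * (norm w)\<^sup>2"
    by (subst 5) (simp add: distrib_right)
  finally show ?thesis using 1 by (simp add: s_def distrib_right)
qed

text \<open>
  Multiply co-coercivity of the residual between consecutive iterates by \<open>t * (t - 1)\<close>. The
  iteration expresses \<open>x' - x\<close> both by \<open>x - z\<close> and by \<open>x' - z'\<close>, so the mixed terms of the two
  potentials telescope, and what remains are squares. The weight of \<open>(norm w)\<^sup>2\<close> has a surplus of
  about \<open>\<beta> * (2 - 3 * \<mu>) * t\<close>, which absorbs the products of \<open>w\<close> with the error \<open>g - w\<close>; the products of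
  \<open>w' - w\<close> with the error are absorbed by \<open>(\<beta>' - \<beta>) * (norm (w' - w))\<^sup>2\<close>. For the
  product of the error with \<open>z - xs\<close> there is no such surplus. It is split into the error term with weight
  \<open>t * (t - 1)\<close> and a multiple of the potential divided by \<open>t * (t - 1)\<close>, which is summable along
  the run.
\<close>

lemma lyap_step:
  fixes w w' g x x' y z z' xs :: "'a::real_inner"
  assumes mu: "0 < \<mu>" "\<mu> < 2 / 3" and beta: "0 < \<beta>" "(2 + \<mu>) * \<beta> \<le> (2 - \<mu>) * \<beta>'"
    and t: "t \<ge> 5 * \<mu> + 1" and eta: "\<eta> = 2 * \<beta> * (t - 1) / (t - \<mu> / 2)"
    and y: "y = ((t - 1) / t) *\<^sub>R x + (1 / t) *\<^sub>R z"
    and x': "x' = y - \<eta> *\<^sub>R g" and z': "z' = z + (\<mu> / 2) *\<^sub>R (x' - y)"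
    and mono: "(w' - w) \<bullet> (x' - x) \<ge> \<beta>' * (norm (w' - w))\<^sup>2 + A"
    and mono0: "w \<bullet> (x - xs) \<ge> \<beta>' * (norm w)\<^sup>2"
  shows "lyap \<mu> \<beta> xs (t + \<mu>) w' x' z' + t * (t - 1) * A
    \<le> (1 + 2 * \<mu> * \<beta> / (2 - 3 * \<mu>) / (t * (t - 1))) * lyap \<mu> \<beta> xs t w x z
      + (\<beta>\<^sup>2 / (\<beta>' - \<beta>) + \<beta> * (2 - \<mu>) / (2 * (2 - 3 * \<mu>)) + \<beta> + 1) * (t * (t - 1)) * (norm (g - w))\<^sup>2"
proof -
  define q where "q = g - w"
  define u where "u = t * (t - 1)"
  \<comment> \<open>The share of \<open>(2 * \<beta> - \<eta>) * (norm w)\<^sup>2\<close> that goes into Young's inequality; the remaining share \<open>2 * \<mu> / (2 - \<mu>)\<close> pays for the growth of the weight of \<open>(norm w)\<^sup>2\<close> from one step to the next.\<close>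
  define k where "k = (2 - 3 * \<mu>) / (2 - \<mu>)"
  define W W' Q Y where "W = (norm w)\<^sup>2" and "W' = (norm w')\<^sup>2" and "Q = (norm q)\<^sup>2" and "Y = (norm (z - xs))\<^sup>2"
  have pos: "0 \<le> W" "0 \<le> W'" "0 \<le> Q" "0 \<le> Y" by (auto simp: W_def W'_def Q_def Y_def)
  have t1: "t > 1" "t - 1 > 0" "t - \<mu> / 2 > 0" "t > 0" using t mu by linarith+
  have u: "u > 0" "\<mu> \<le> u"
  proof -
    show "u > 0" using t1 by (simp add: u_def)
    have "1 * (5 * \<mu>) \<le> u" unfolding u_def using t t1 mu by (intro mult_mono) auto
    then show "\<mu> \<le> u" using mu by linarith
  qed
  have k: "0 < k" "1 - k = 2 * \<mu> / (2 - \<mu>)" using mu by (auto simp: k_def field_simps)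
  have bb: "\<beta> < \<beta>'" "2 * \<mu> * \<beta> \<le> \<beta>'"
  proof -
    have "(2 - \<mu>) * \<beta> < (2 + \<mu>) * \<beta>" using mu beta by (intro mult_strict_right_mono) auto
    then have "(2 - \<mu>) * \<beta> < (2 - \<mu>) * \<beta>'" using beta by linarith
    then show "\<beta> < \<beta>'" using mu by simp
    have "(4 * \<mu> - 2 * \<mu>\<^sup>2) \<le> 2 + \<mu>" using zero_le_power2[of "2 * \<mu> - 3 / 2"]
      by (simp add: power2_eq_square algebra_simps)
    then have "(4 * \<mu> - 2 * \<mu>\<^sup>2) * \<beta> \<le> (2 + \<mu>) * \<beta>" using beta by (intro mult_right_mono) auto
    then have "(2 - \<mu>) * (2 * \<mu> * \<beta>) \<le> (2 - \<mu>) * \<beta>'" using beta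
      by (simp add: algebra_simps power2_eq_square)
    then show "2 * \<mu> * \<beta> \<le> \<beta>'" using mu by simp
  qed
  have eta1: "(t - \<mu> / 2) * \<eta> = 2 * \<beta> * (t - 1)" using t1 by (simp add: eta)
  have eta_pos: "\<eta> > 0" using t1 beta by (simp add: eta)
  have eta2: "2 * \<beta> - \<eta> = \<beta> * (2 - \<mu>) / (t - \<mu> / 2)"
    using t1 by (simp add: eta field_simps)
  have eta3: "0 \<le> 2 * \<beta> - \<eta>" unfolding eta2 using t1 mu beta by simp
  have zz: "z' = z - (\<mu> / 2 * \<eta>) *\<^sub>R g" by (simp add: z' x')
  have d1: "t *\<^sub>R (x' - x) = - (x - z) - (t * \<eta>) *\<^sub>R g"
  proof -
    have "t *\<^sub>R y = (t - 1) *\<^sub>R x + z" using t1 by (simp add: y scaleR_add_right)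
    then show ?thesis by (simp add: x' algebra_simps)
  qed
  \<comment> \<open>Here the form of the step size enters: \<open>(t - \<mu> / 2) * \<eta>\<close> is \<open>2 * \<beta> * (t - 1)\<close>.\<close>
  have d2: "(t - 1) *\<^sub>R (x' - x) = - (x' - z') - (2 * \<beta> * (t - 1)) *\<^sub>R g"
  proof -
    have "(t - 1) *\<^sub>R (x' - x) = t *\<^sub>R (x' - x) - (x' - x)" by (simp add: algebra_simps)
    also have "\<dots> = z - x' - (t * \<eta>) *\<^sub>R g" by (simp add: d1)
    also have "\<dots> = - (x' - z') - ((t - \<mu> / 2) * \<eta>) *\<^sub>R g" by (simp add: zz algebra_simps)
    finally show ?thesis by (simp add: eta1)
  qed
  have I1: "(t - 1) * (w \<bullet> (x - z)) - t * (w' \<bullet> (x' - z'))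
      = u * ((w' - w) \<bullet> (x' - x) + 2 * \<beta> * (w' \<bullet> g) - \<eta> * (w \<bullet> g))"
  proof -
    have a0: "w \<bullet> (x - z) = - (t * (w \<bullet> (x' - x))) - t * \<eta> * (w \<bullet> g)"
      using arg_cong[OF d1, of "inner w"] by (simp add: inner_diff_right)
    have a: "(t - 1) * (w \<bullet> (x - z)) = - (t - 1) * (t * (w \<bullet> (x' - x))) - u * \<eta> * (w \<bullet> g)"
      by (subst a0) (simp add: u_def algebra_simps)
    have b0: "w' \<bullet> (x' - z') = - ((t - 1) * (w' \<bullet> (x' - x))) - (2 * \<beta> * (t - 1)) * (w' \<bullet> g)"
      using arg_cong[OF d2, of "inner w'"] by (simp add: inner_diff_right)
    have b: "t * (w' \<bullet> (x' - z')) = - t * ((t - 1) * (w' \<bullet> (x' - x))) - u * (2 * \<beta>) * (w' \<bullet> g)"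
      by (subst b0) (simp add: u_def algebra_simps)
    show ?thesis unfolding a b by (simp add: u_def inner_diff_left algebra_simps)
  qed
  define C where "C = (1 - \<mu>) * (t - \<mu> / 2) / (2 * \<mu> * \<beta> * (t - 1))"
  define C' where "C' = (1 - \<mu>) * (t + \<mu> - \<mu> / 2) / (2 * \<mu> * \<beta> * (t + \<mu> - 1))"
  have C: "C * (\<mu> * \<eta>) = 1 - \<mu>" using t1 mu beta by (simp add: C_def eta)
  have I3: "C' \<le> C"
  proof -
    have "(t + \<mu> - \<mu> / 2) / (t + \<mu> - 1) \<le> (t - \<mu> / 2) / (t - 1)"
    proof -
      have "(t + \<mu> - \<mu> / 2) * (t - 1) \<le> (t - \<mu> / 2) * (t + \<mu> - 1)"
      proof -
        have "(t - \<mu> / 2) * (t + \<mu> - 1) - (t + \<mu> - \<mu> / 2) * (t - 1) = \<mu> * (1 - \<mu> / 2)"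
          by (simp add: field_simps)
        moreover have "\<mu> * (1 - \<mu> / 2) \<ge> 0" using mu by simp
        ultimately show ?thesis by linarith
      qed
      then show ?thesis using t1 mu by (simp add: divide_le_eq pos_le_divide_eq field_simps)
    qed
    then have "(1 - \<mu>) / (2 * \<mu> * \<beta>) * ((t + \<mu> - \<mu> / 2) / (t + \<mu> - 1))
      \<le> (1 - \<mu>) / (2 * \<mu> * \<beta>) * ((t - \<mu> / 2) / (t - 1))"
      using mu beta by (intro mult_left_mono) auto
    then show ?thesis by (simp add: C_def C'_def)
  qed
  have I2: "C * Y - C * (norm (z' - xs))\<^sup>2 = (1 - \<mu>) * (g \<bullet> (z - xs)) - (1 - \<mu>) * (\<mu> * \<eta> / 4) * (norm g)\<^sup>2"
  proof -
    have "(norm (z' - xs))\<^sup>2 = (norm ((z - xs) - (\<mu> / 2 * \<eta>) *\<^sub>R g))\<^sup>2" by (simp add: zz algebra_simps)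
    also have "\<dots> = Y - \<mu> * \<eta> * (g \<bullet> (z - xs)) + (\<mu> * \<eta>) * (\<mu> * \<eta> / 4) * (norm g)\<^sup>2"
      unfolding Y_def power2_norm_eq_inner
      by (simp add: inner_diff_left inner_diff_right inner_commute algebra_simps)
    finally have e: "(norm (z' - xs))\<^sup>2
        = Y - \<mu> * \<eta> * (g \<bullet> (z - xs)) + (\<mu> * \<eta>) * (\<mu> * \<eta> / 4) * (norm g)\<^sup>2" .
    have "C * Y - C * (norm (z' - xs))\<^sup>2
        = (C * (\<mu> * \<eta>)) * (g \<bullet> (z - xs)) - (C * (\<mu> * \<eta>)) * (\<mu> * \<eta> / 4) * (norm g)\<^sup>2"
      unfolding e by (simp add: algebra_simps)
    then show ?thesis by (simp add: C)
  qed
  have I5: "(\<mu> * \<eta> / 4) * (norm g)\<^sup>2 \<le> \<mu> * \<beta> * (W + Q)"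
  proof -
    have "(norm g)\<^sup>2 + (norm (w - q))\<^sup>2 = 2 * (W + Q)"
      unfolding W_def Q_def q_def power2_norm_eq_inner
      by (simp add: inner_diff_left inner_diff_right inner_commute)
    moreover have "(norm (w - q))\<^sup>2 \<ge> 0" by simp
    ultimately have "(norm g)\<^sup>2 \<le> 2 * (W + Q)" by linarith
    then have "(\<mu> * \<eta> / 4) * (norm g)\<^sup>2 \<le> (\<mu> * (2 * \<beta>) / 4) * (2 * (W + Q))"
      using mu eta3 eta_pos beta pos by (intro mult_mono divide_right_mono mult_left_mono) auto
    then show ?thesis by (simp add: algebra_simps)
  qed
  \<comment> \<open>The coefficient of the last square of the potential is what makes the products of \<open>w\<close> and \<open>z - xs\<close> cancel here; only the product with the error \<open>q\<close> is left.\<close>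
  have I4: "(1 - \<mu>) * (w \<bullet> (x - z)) + (1 - \<mu>) * (g \<bullet> (z - xs))
      \<ge> (1 - \<mu>) * \<beta>' * W - (u * Q + Y / (4 * u))"
  proof -
    have "(1 - \<mu>) * (w \<bullet> (x - xs)) \<ge> (1 - \<mu>) * (\<beta>' * W)"
      using mono0 mu by (intro mult_left_mono) (auto simp: W_def)
    moreover have "(1 - \<mu>) * (q \<bullet> (z - xs)) \<ge> - (u * Q + Y / (4 * u))"
    proof -
      have "0 \<le> u * (norm q)\<^sup>2 + 2 * ((1 - \<mu>) / 2) * (q \<bullet> (z - xs)) + ((1 - \<mu>) / 2)\<^sup>2 / u * Y"
        unfolding Y_def by (rule young_inner) (rule u)
      moreover have "((1 - \<mu>) / 2)\<^sup>2 / u * Y \<le> (1 / 2)\<^sup>2 / u * Y"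
        using mu u pos by (intro mult_right_mono divide_right_mono power_mono) auto
      moreover have "2 * ((1 - \<mu>) / 2) * (q \<bullet> (z - xs)) = (1 - \<mu>) * (q \<bullet> (z - xs))" "(1 / 2)\<^sup>2 / u * Y = Y / (4 * u)"
        by (simp_all add: power2_eq_square)
      ultimately show ?thesis unfolding Q_def by linarith
    qed
    moreover have "(w \<bullet> (x - z)) + (g \<bullet> (z - xs)) = w \<bullet> (x - xs) + q \<bullet> (z - xs)"
      by (simp add: q_def inner_diff_left inner_diff_right)
    ultimately show ?thesis unfolding distrib_left[symmetric] mult.assoc by (simp only: distrib_left)
  qed
  \<comment> \<open>\<open>\<beta>' - \<beta>\<close> absorbs the product of the error with \<open>w' - w\<close>, and the share \<open>k\<close> of \<open>2 * \<beta> - \<eta>\<close> its product with \<open>w\<close>.\<close>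
  have I6: "(w' - w) \<bullet> (x' - x) + 2 * \<beta> * (w' \<bullet> g) - \<eta> * (w \<bullet> g)
      \<ge> A + \<beta> * W' - \<beta> * W + (1 - k) * (2 * \<beta> - \<eta>) * W - (\<beta>\<^sup>2 / (\<beta>' - \<beta>) + \<beta> / (2 * k)) * Q"
  proof -
    have "0 \<le> (\<beta>' - \<beta>) * (norm (w' - w))\<^sup>2 + 2 * \<beta> * ((w' - w) \<bullet> q) + \<beta>\<^sup>2 / (\<beta>' - \<beta>) * Q"
      unfolding Q_def using bb by (intro young_inner) auto
    moreover have "(2 * \<beta> - \<eta>) * (k * W + (w \<bullet> q) + 1 / (4 * k) * Q) \<ge> 0"
    proof -
      have "0 \<le> k * (norm w)\<^sup>2 + 2 * (1 / 2) * (w \<bullet> q) + (1 / 2)\<^sup>2 / k * (norm q)\<^sup>2"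
        by (rule young_inner[OF k(1)])
      then show ?thesis using eta3 by (simp add: W_def Q_def power2_eq_square)
    qed
    moreover have "(2 * \<beta> - \<eta>) * (1 / (4 * k) * Q) \<le> \<beta> / (2 * k) * Q"
    proof -
      have "(2 * \<beta> - \<eta>) * (1 / (4 * k) * Q) \<le> (2 * \<beta>) * (1 / (4 * k) * Q)"
        using eta_pos k pos by (intro mult_right_mono) auto
      then show ?thesis by (simp add: mult.commute)
    qed
    moreover have "2 * \<beta> * (w' \<bullet> w) = \<beta> * (W' + W - (norm (w' - w))\<^sup>2)"
      unfolding W_def W'_def power2_norm_eq_inner
      by (simp add: inner_diff_left inner_diff_right inner_commute)
    moreover have "2 * \<beta> * (w' \<bullet> g) = 2 * \<beta> * (w' \<bullet> w) + 2 * \<beta> * ((w' - w) \<bullet> q) + 2 * \<beta> * (w \<bullet> q)"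
      "\<eta> * (w \<bullet> g) = \<eta> * W + \<eta> * (w \<bullet> q)"
      by (simp_all add: q_def W_def power2_norm_eq_inner inner_diff_left inner_diff_right algebra_simps)
    ultimately show ?thesis using mono by (simp add: algebra_simps)
  qed
  \<comment> \<open>The total weight that remains on \<open>(norm w)\<^sup>2\<close>.\<close>
  have coeff: "\<beta> * (t - \<mu>) * (t - \<mu> - 1) - \<beta> * u + u * ((1 - k) * (2 * \<beta> - \<eta>))
      + (1 - \<mu>) * \<beta>' - (1 - \<mu>) * (\<mu> * \<beta>) \<ge> 0"
  proof -
    have k1: "(1 - k) * (2 * \<beta> - \<eta>) = 2 * \<mu> * \<beta> / (t - \<mu> / 2)"
      unfolding k(2) eta2 using mu by simp
    have "u * (2 * \<mu> * \<beta> / (t - \<mu> / 2)) \<ge> 2 * \<mu> * \<beta> * (t - 1)"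
    proof -
      have "(2 * \<mu> * \<beta> * (t - 1)) * 1 \<le> (2 * \<mu> * \<beta> * (t - 1)) * (t / (t - \<mu> / 2))"
        using t1 mu beta by (intro mult_left_mono) auto
      moreover have "u * (2 * \<mu> * \<beta> / (t - \<mu> / 2)) = (2 * \<mu> * \<beta> * (t - 1)) * (t / (t - \<mu> / 2))"
        by (simp add: u_def)
      ultimately show ?thesis by (simp only: mult_1_right)
    qed
    moreover have "\<beta> * (t - \<mu>) * (t - \<mu> - 1) - \<beta> * u = - (2 * \<mu> * \<beta> * (t - 1)) - (1 - \<mu>) * (\<mu> * \<beta>)"
      by (simp add: u_def algebra_simps)
    moreover have "(1 - \<mu>) * \<beta>' \<ge> (1 - \<mu>) * (2 * \<mu> * \<beta>)"
      using bb mu by (intro mult_left_mono) auto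
    moreover have "(1 - \<mu>) * (2 * \<mu> * \<beta>) = 2 * ((1 - \<mu>) * (\<mu> * \<beta>))" by simp
    ultimately show ?thesis unfolding k1 by linarith
  qed
  define c where "c = \<beta>\<^sup>2 / (\<beta>' - \<beta>) + \<beta> / (2 * k)"
  define V where "V = lyap \<mu> \<beta> xs t w x z"
  have V: "V = \<beta> * (t - \<mu>) * (t - \<mu> - 1) * W + (t - 1) * (w \<bullet> (x - z)) + (1 - \<mu>) * (w \<bullet> (x - z)) + C * Y"
    by (simp add: V_def lyap_def W_def C_def Y_def algebra_simps)
  have V': "lyap \<mu> \<beta> xs (t + \<mu>) w' x' z' = \<beta> * u * W' + t * (w' \<bullet> (x' - z')) + C' * (norm (z' - xs))\<^sup>2"
    by (simp add: lyap_def W'_def C'_def u_def algebra_simps)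
  have "C' * (norm (z' - xs))\<^sup>2 \<le> C * (norm (z' - xs))\<^sup>2" using I3 by (intro mult_right_mono) auto
  moreover have "u * ((w' - w) \<bullet> (x' - x) + 2 * \<beta> * (w' \<bullet> g) - \<eta> * (w \<bullet> g))
      \<ge> u * (A + \<beta> * W' - \<beta> * W + (1 - k) * (2 * \<beta> - \<eta>) * W - c * Q)"
    using u I6 by (intro mult_left_mono) (auto simp: c_def)
  moreover have "(1 - \<mu>) * ((\<mu> * \<eta> / 4) * (norm g)\<^sup>2) \<le> (1 - \<mu>) * (\<mu> * \<beta> * (W + Q))"
    using I5 mu by (intro mult_left_mono) auto
  moreover have "(\<beta> * (t - \<mu>) * (t - \<mu> - 1) - \<beta> * u + u * ((1 - k) * (2 * \<beta> - \<eta>))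
      + (1 - \<mu>) * \<beta>' - (1 - \<mu>) * (\<mu> * \<beta>)) * W \<ge> 0"
    using coeff pos by simp
  moreover have "(1 - \<mu>) * (\<mu> * \<beta> * Q) \<le> u * \<beta> * Q"
  proof -
    have "(1 - \<mu>) * (\<mu> * \<beta> * Q) \<le> 1 * (\<mu> * \<beta> * Q)"
      using mu beta pos by (intro mult_right_mono) auto
    also have "\<dots> \<le> u * \<beta> * Q" using u beta pos by (auto intro!: mult_right_mono)
    finally show ?thesis .
  qed
  ultimately have main: "lyap \<mu> \<beta> xs (t + \<mu>) w' x' z' + u * A \<le> V + (c + \<beta> + 1) * u * Q + Y / (4 * u)"
    using I1 I2 I4 unfolding V' V by (simp add: algebra_simps)
  have "Y / (4 * u) \<le> 2 * \<mu> * \<beta> / (2 - 3 * \<mu>) / u * V"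
  proof -
    have "(2 - 3 * \<mu>) / (8 * \<mu> * \<beta>) * Y \<le> V"
    proof -
      have "\<beta> * (2 - 3 * \<mu>) / (2 - \<mu>) * (t - \<mu>)\<^sup>2 * (norm w)\<^sup>2 \<ge> 0" using mu beta by simp
      with lyap_lower_bound[OF mu beta(1) less_imp_le[OF bb(1)] t mono0, of z]
      show ?thesis unfolding V_def Y_def by linarith
    qed
    then have "(2 * \<mu> * \<beta> / (2 - 3 * \<mu>) / u) * ((2 - 3 * \<mu>) / (8 * \<mu> * \<beta>) * Y) \<le> (2 * \<mu> * \<beta> / (2 - 3 * \<mu>) / u) * V"
      using mu beta u by (intro mult_left_mono) auto
    moreover have "(2 * \<mu> * \<beta> / (2 - 3 * \<mu>) / u) * ((2 - 3 * \<mu>) / (8 * \<mu> * \<beta>) * Y) = Y / (4 * u)"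
      using mu beta u by (simp add: field_simps)
    ultimately show ?thesis by simp
  qed
  with main show ?thesis
    by (simp add: V_def u_def c_def k_def Q_def q_def distrib_right)
qed

section \<open>Real recursions and the step parameters\<close>

lemma discrete_gronwall:
  fixes W N a :: "nat \<Rightarrow> real"
  assumes step: "\<And>k. k < K \<Longrightarrow> W (Suc k) \<le> (1 + a k) * W k + N k"
    and pos: "\<And>k. a k \<ge> 0" "\<And>k. k < K \<Longrightarrow> N k \<ge> 0" "W 0 \<ge> 0"
  shows "W K \<le> exp (\<Sum>k<K. a k) * (W 0 + (\<Sum>k<K. N k))"
proof -
  have "n \<le> K \<Longrightarrow> W n \<le> exp (\<Sum>k<n. a k) * (W 0 + (\<Sum>k<n. N k))" for n
  proof (induction n)
    case (Suc n)
    define S where "S = W 0 + (\<Sum>k<n. N k)"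
    have S: "S \<ge> 0" using pos Suc.prems by (auto simp: S_def intro!: add_nonneg_nonneg sum_nonneg)
    have "W (Suc n) \<le> (1 + a n) * W n + N n" using Suc.prems by (intro step) simp
    also have "\<dots> \<le> exp (a n) * (exp (\<Sum>k<n. a k) * S) + 1 * N n"
    proof (intro add_mono)
      have "(1 + a n) * W n \<le> (1 + a n) * (exp (\<Sum>k<n. a k) * S)"
        using Suc pos by (intro mult_left_mono) (auto simp: S_def add_nonneg_nonneg)
      also have "\<dots> \<le> exp (a n) * (exp (\<Sum>k<n. a k) * S)"
        using S by (intro mult_right_mono) (auto simp: exp_ge_add_one_self)
      finally show "(1 + a n) * W n \<le> exp (a n) * (exp (\<Sum>k<n. a k) * S)" .
    qed simp
    also have "\<dots> \<le> exp (\<Sum>k<Suc n. a k) * S + exp (\<Sum>k<Suc n. a k) * N n"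
    proof (intro add_mono mult_right_mono)
      show "1 \<le> exp (\<Sum>k<Suc n. a k)" unfolding one_le_exp_iff using pos(1) by (rule sum_nonneg)
      show "0 \<le> N n" using pos(2) Suc.prems by simp
    qed (simp add: exp_add)
    finally show ?case by (simp add: S_def algebra_simps)
  qed simp
  then show ?thesis by simp
qed

text \<open>
  The lower bound on \<open>r\<close> keeps \<open>t k - 1\<close> away from 0, where the step size and the weights \<open>\<tau>\<close> degenerate.
\<close>

lemma step_parameter_bounds:
  fixes t :: "nat \<Rightarrow> real"
  assumes mu: "0 < \<mu>" and r: "r \<ge> 5 + 1 / \<mu>" and t: "\<And>k. t k = \<mu> * (real k + r)"
  shows "t k \<ge> 5 * \<mu> + 1 + \<mu> * real k" "t (Suc k) = t k + \<mu>"
proof -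
  have "\<mu> * r \<ge> \<mu> * (5 + 1 / \<mu>)" using mu r by (intro mult_left_mono) auto
  then show "t k \<ge> 5 * \<mu> + 1 + \<mu> * real k" using mu by (simp add: t algebra_simps)
  show "t (Suc k) = t k + \<mu>" by (simp add: t algebra_simps)
qed

text \<open>
  The terms are at most \<open>1 / (\<mu>\<^sup>2 * (k + 1) * (k + 2))\<close>, whose partial sums telescope.
\<close>

lemma sum_inverse_step_parameter:
  fixes t :: "nat \<Rightarrow> real"
  assumes mu: "0 < \<mu>" and r: "r \<ge> 5 + 1 / \<mu>" and t: "\<And>k. t k = \<mu> * (real k + r)"
  shows "(\<Sum>k<n. 1 / (t k * (t k - 1))) \<le> 1 / \<mu>\<^sup>2"
proof -
  have "(\<Sum>k<n. 1 / (t k * (t k - 1))) \<le> 1 / \<mu>\<^sup>2 * (1 - 1 / (real n + 1))"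
  proof (induction n)
    case (Suc n)
    have tn: "t n \<ge> 5 * \<mu> + 1 + \<mu> * real n" by (rule step_parameter_bounds[OF assms])
    have "\<mu>\<^sup>2 * ((real n + 1) * (real n + 2)) = (\<mu> * (real n + 2)) * (\<mu> * (real n + 1))"
      by (simp only: power2_eq_square mult_ac)
    also have "\<dots> \<le> t n * (t n - 1)"
    proof (rule mult_mono)
      show "\<mu> * (real n + 2) \<le> t n" "\<mu> * (real n + 1) \<le> t n - 1"
        using tn mu unfolding distrib_left by linarith+
      show "0 \<le> \<mu> * (real n + 1)" using mu by simp
      have "\<mu> * real n \<ge> 0" using mu by simp
      then show "0 \<le> t n" using tn mu by linarith
    qed
    finally have "1 / (t n * (t n - 1)) \<le> 1 / (\<mu>\<^sup>2 * ((real n + 1) * (real n + 2)))"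
      using mu by (intro frac_le) auto
    also have "\<dots> = 1 / \<mu>\<^sup>2 * (1 / (real n + 1) - 1 / (real n + 2))"
      using mu by (simp add: divide_simps)
    finally have "(\<Sum>k<Suc n. 1 / (t k * (t k - 1)))
        \<le> 1 / \<mu>\<^sup>2 * (1 - 1 / (real n + 1)) + 1 / \<mu>\<^sup>2 * (1 / (real n + 1) - 1 / (real n + 2))"
      using Suc.IH by simp
    also have "\<dots> = 1 / \<mu>\<^sup>2 * (1 - 1 / (real (Suc n) + 1))"
      by (simp add: algebra_simps)
    finally show ?case .
  qed simp
  also have "\<dots> \<le> 1 / \<mu>\<^sup>2 * 1" by (intro mult_left_mono) auto
  finally show ?thesis by simp
qed

text \<open>
  The weight of the hybrid estimator at parameters \<open>s\<close> and \<open>t\<close> of consecutive steps. It is tuned so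
  that the weighted error contracts exactly by \<open>1 - \<epsilon>\<close>. As \<open>\<tau>\<close> is at most \<open>2 * \<mu> / (t - 1) + \<epsilon>\<close>, the
  weighted noise \<open>t * (t - 1) * \<tau>\<^sup>2\<close> stays bounded as long as \<open>t\<close> is of order \<open>1 / \<epsilon>\<close>.
\<close>

lemma hybrid_weight:
  fixes s t \<epsilon> \<mu> :: real
  assumes mu: "0 < \<mu>" "\<mu> < 1" and t: "t \<ge> 5 * \<mu> + 1" and eps: "0 < \<epsilon>" "\<epsilon> \<le> 1"
    and s: "s = t - \<mu>"
    and tau: "\<tau> = 1 - sqrt ((1 - \<epsilon>) * s * (s - 1) / (t * (t - 1)))"
  shows "t * (t - 1) * (1 - \<tau>)\<^sup>2 = (1 - \<epsilon>) * (s * (s - 1))"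
    and "t * (t - 1) * \<tau>\<^sup>2 \<le> 8 * \<mu>\<^sup>2 + 8 * \<mu> + 2 * (\<epsilon> * t)\<^sup>2"
proof -
  define u where "u = t * (t - 1)"
  define p where "p = (1 - \<epsilon>) * s * (s - 1) / u"
  have u: "u > 0" using t mu by (simp add: u_def)
  have s1: "s \<ge> 1" "s \<le> t" using t mu by (auto simp: s)
  have p0: "p \<ge> 0" using u eps s1 by (simp add: p_def)
  have ss: "s * (s - 1) \<le> u" unfolding u_def using s1 by (intro mult_mono) auto
  have "(1 - \<epsilon>) * (s * (s - 1)) \<le> 1 * u" using eps s1 ss by (intro mult_mono) auto
  then have p1: "p \<le> 1" using u by (simp add: p_def mult.assoc)
  have tau': "\<tau> = 1 - sqrt p" by (simp add: tau p_def u_def)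
  have "(1 - \<tau>)\<^sup>2 = p" using p0 by (simp add: tau')
  then show "t * (t - 1) * (1 - \<tau>)\<^sup>2 = (1 - \<epsilon>) * (s * (s - 1))"
    using u by (simp add: p_def flip: u_def)
  have "p \<le> sqrt p"
    using p0 p1 by (intro real_le_rsqrt) (simp add: power2_eq_square mult_left_le)
  then have "\<tau> \<le> 1 - p" by (simp add: tau')
  also have "\<dots> = (u - s * (s - 1)) / u + \<epsilon> * (s * (s - 1) / u)"
    using u by (simp add: p_def field_simps)
  also have "\<dots> \<le> 2 * \<mu> * t / u + \<epsilon> * 1"
  proof (intro add_mono divide_right_mono mult_left_mono)
    have "u - s * (s - 1) = 2 * \<mu> * t - \<mu> * \<mu> - \<mu>" by (simp add: u_def s algebra_simps)
    then show "u - s * (s - 1) \<le> 2 * \<mu> * t" using mu zero_le_square[of \<mu>] by linarith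
  qed (use u ss eps in auto)
  finally have "\<tau> \<le> 2 * \<mu> * t / u + \<epsilon>" by simp
  moreover have "0 \<le> \<tau>" using p1 by (simp add: tau' real_sqrt_le_1_iff)
  ultimately have "\<tau>\<^sup>2 \<le> (2 * \<mu> * t / u + \<epsilon>)\<^sup>2" by (intro power_mono)
  also have "\<dots> \<le> 2 * (2 * \<mu> * t / u)\<^sup>2 + 2 * \<epsilon>\<^sup>2"
    using zero_le_power2[of "2 * \<mu> * t / u - \<epsilon>"] unfolding power2_sum power2_diff by linarith
  finally have "u * \<tau>\<^sup>2 \<le> u * (2 * (2 * \<mu> * t / u)\<^sup>2 + 2 * \<epsilon>\<^sup>2)" using u by (intro mult_left_mono) auto
  also have "\<dots> = 8 * \<mu>\<^sup>2 * (t / (t - 1)) + 2 * \<epsilon>\<^sup>2 * u"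
  proof -
    have "u * (2 * \<mu> * t / u)\<^sup>2 = 4 * \<mu>\<^sup>2 * (t * t / u)"
      using u by (simp add: power2_eq_square)
    also have "t * t / u = t / (t - 1)" using t mu by (simp add: u_def)
    finally have "2 * (u * (2 * \<mu> * t / u)\<^sup>2) = 2 * (4 * \<mu>\<^sup>2 * (t / (t - 1)))" by simp
    then show ?thesis unfolding distrib_left by (simp add: mult_ac)
  qed
  also have "\<dots> \<le> 8 * \<mu>\<^sup>2 * (1 + 1 / \<mu>) + 2 * \<epsilon>\<^sup>2 * t\<^sup>2"
  proof (intro add_mono mult_left_mono)
    have "t / (t - 1) = 1 + 1 / (t - 1)" using t mu by (simp add: field_simps)
    also have "1 / (t - 1) \<le> 1 / \<mu>" using t mu by (intro divide_left_mono) auto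
    finally show "t / (t - 1) \<le> 1 + 1 / \<mu>" by simp
    show "u \<le> t\<^sup>2" using t mu by (simp add: u_def power2_eq_square)
  qed auto
  also have "\<dots> = 8 * \<mu>\<^sup>2 + 8 * \<mu> + 2 * (\<epsilon> * t)\<^sup>2"
    using mu by (simp add: power2_eq_square distrib_left)
  finally show "t * (t - 1) * \<tau>\<^sup>2 \<le> 8 * \<mu>\<^sup>2 + 8 * \<mu> + 2 * (\<epsilon> * t)\<^sup>2" by (simp add: u_def)
qed

text \<open>
  Gronwall's inequality for the sum \<open>v k + (c / \<epsilon>) * u k * e k\<close>. The weight \<open>c / \<epsilon>\<close> is the one for
  which the contraction of \<open>u k * e k\<close> by \<open>1 - \<epsilon>\<close> compensates the term \<open>c * u k * e k\<close> exactly.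
\<close>

lemma coupled_recursion_bound:
  fixes v e d u \<tau> :: "nat \<Rightarrow> real"
  assumes pos: "\<And>k. v k \<ge> 0" "\<And>k. e k \<ge> 0" "\<And>k. d k \<ge> 0" "\<And>k. u k > 0"
    and const: "0 < \<epsilon>" "\<epsilon> \<le> 1" "a \<ge> 0" "c \<ge> 0" "s \<ge> 0" "b > 0" "2 * c / (\<epsilon> * b) \<le> \<Lambda>"
    and v_step: "\<And>k. v (Suc k) + \<Lambda> * u k * d k \<le> (1 + a / u k) * v k + c * u k * e k"
    and e_step: "\<And>k. e (Suc k) \<le> (1 - \<tau> (Suc k))\<^sup>2 * (e k + 2 / b * d k) + 2 * (\<tau> (Suc k))\<^sup>2 * s"
    and tau: "\<And>k. u (Suc k) * (1 - \<tau> (Suc k))\<^sup>2 = (1 - \<epsilon>) * u k"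
    and tau_Q: "\<And>k. k < K \<Longrightarrow> u (Suc k) * (\<tau> (Suc k))\<^sup>2 \<le> Q"
    and sum_u: "(\<Sum>k<K. 1 / u k) \<le> B"
  shows "v K \<le> exp (a * B) * (v 0 + c / \<epsilon> * u 0 * e 0 + real K * (2 * c * Q * s / \<epsilon>))"
proof -
  define W where "W k = v k + c / \<epsilon> * u k * e k" for k
  have W0: "0 \<le> W k" "v k \<le> W k" for k
    using pos[of k] const by (auto simp: W_def intro!: add_nonneg_nonneg mult_nonneg_nonneg divide_nonneg_pos)
  have Lam: "\<Lambda> \<ge> 0"
    using const by (intro order_trans[OF _ const(7)] divide_nonneg_pos mult_pos_pos) auto
  have step: "W (Suc k) \<le> (1 + a / u k) * W k + 2 * c * Q * s / \<epsilon>" if k: "k < K" for k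
  proof -
    have "c / \<epsilon> * u (Suc k) * e (Suc k)
        \<le> c / \<epsilon> * u (Suc k) * ((1 - \<tau> (Suc k))\<^sup>2 * (e k + 2 / b * d k) + 2 * (\<tau> (Suc k))\<^sup>2 * s)"
      using e_step[of k] pos(4)[of "Suc k"] const by (intro mult_left_mono) auto
    also have "\<dots> = c / \<epsilon> * (u (Suc k) * (1 - \<tau> (Suc k))\<^sup>2) * (e k + 2 / b * d k)
        + c / \<epsilon> * (2 * s) * (u (Suc k) * (\<tau> (Suc k))\<^sup>2)"
      unfolding distrib_left by (simp add: mult_ac)
    also have "\<dots> \<le> c / \<epsilon> * ((1 - \<epsilon>) * u k) * (e k + 2 / b * d k) + c / \<epsilon> * (2 * s) * Q"
      unfolding tau using tau_Q[OF k] const by (intro add_left_mono mult_left_mono) auto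
    also have "\<dots> = c / \<epsilon> * u k * e k - c * u k * e k + (1 - \<epsilon>) * ((2 * c / (\<epsilon> * b)) * (u k * d k))
        + 2 * c * Q * s / \<epsilon>"
      using const by (simp add: field_simps)
    also have "(1 - \<epsilon>) * ((2 * c / (\<epsilon> * b)) * (u k * d k)) \<le> 1 * (\<Lambda> * (u k * d k))"
      using const Lam pos(3)[of k] pos(4)[of k]
      by (intro mult_mono) (auto intro!: mult_nonneg_nonneg mult_right_mono)
    finally have "W (Suc k) \<le> (1 + a / u k) * v k + c / \<epsilon> * u k * e k + 2 * c * Q * s / \<epsilon>"
      using v_step[of k] by (simp add: W_def)
    also have "c / \<epsilon> * u k * e k \<le> (1 + a / u k) * (c / \<epsilon> * u k * e k)"
    proof -
      have "1 * (c / \<epsilon> * u k * e k) \<le> (1 + a / u k) * (c / \<epsilon> * u k * e k)"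
        using const pos(2)[of k] pos(4)[of k]
        by (intro mult_right_mono) (auto intro!: mult_nonneg_nonneg divide_nonneg_pos)
      then show ?thesis by simp
    qed
    finally show ?thesis by (simp add: W_def distrib_left)
  qed
  have noise: "0 \<le> 2 * c * Q * s / \<epsilon>" if "k < K" for k
  proof -
    have "0 \<le> u (Suc k) * (\<tau> (Suc k))\<^sup>2" using pos(4)[of "Suc k"] by simp
    also have "\<dots> \<le> Q" using tau_Q[OF that] .
    finally show ?thesis using const by simp
  qed
  have au: "a / u k \<ge> 0" for k using const pos(4)[of k] by simp
  have "W K \<le> exp (\<Sum>k<K. a / u k) * (W 0 + (\<Sum>k<K. 2 * c * Q * s / \<epsilon>))"
    by (rule discrete_gronwall) (use step noise au W0 in auto)
  also have "\<dots> \<le> exp (a * B) * (W 0 + (\<Sum>k<K. 2 * c * Q * s / \<epsilon>))"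
  proof (intro mult_right_mono)
    have "(\<Sum>k<K. a / u k) = a * (\<Sum>k<K. 1 / u k)" by (simp add: sum_distrib_left)
    also have "\<dots> \<le> a * B" using sum_u const by (intro mult_left_mono)
    finally show "exp (\<Sum>k<K. a / u k) \<le> exp (a * B)" by simp
    show "0 \<le> W 0 + (\<Sum>k<K. 2 * c * Q * s / \<epsilon>)"
      using W0 noise by (intro add_nonneg_nonneg sum_nonneg) auto
  qed
  finally show ?thesis using W0(2)[of K] by (simp add: W_def)
qed

section \<open>Independence and second moments\<close>

lemma (in prob_space) indep_vars_imp_indep_var:
  assumes X: "indep_vars N X I" and ij: "i \<in> I" "j \<in> I" "i \<noteq> j"
    and f: "f \<in> measurable (N i) A" and g: "g \<in> measurable (N j) B"
  shows "indep_var A (\<lambda>\<omega>. f (X i \<omega>)) B (\<lambda>\<omega>. g (X j \<omega>))"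
proof -
  have "indep_var (PiM {i} N) (\<lambda>\<omega>. restrict (\<lambda>k. X k \<omega>) {i}) (PiM {j} N) (\<lambda>\<omega>. restrict (\<lambda>k. X k \<omega>) {j})"
    by (rule indep_var_restrict[OF X]) (use ij in auto)
  moreover have "(\<lambda>s. f (s i)) \<in> measurable (PiM {i} N) A" "(\<lambda>s. g (s j)) \<in> measurable (PiM {j} N) B"
    using f g by measurable
  ultimately have "indep_var A ((\<lambda>s. f (s i)) \<circ> (\<lambda>\<omega>. restrict (\<lambda>k. X k \<omega>) {i}))
      B ((\<lambda>s. g (s j)) \<circ> (\<lambda>\<omega>. restrict (\<lambda>k. X k \<omega>) {j}))"
    by (rule indep_var_compose)
  then show ?thesis by (simp add: comp_def)
qed

lemma (in prob_space) expectation_inner_indep: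
  fixes f g :: "'a \<Rightarrow> 'b::euclidean_space"
  assumes ind: "\<And>b. b \<in> Basis \<Longrightarrow> indep_var borel (\<lambda>\<omega>. f \<omega> \<bullet> b) borel (\<lambda>\<omega>. g \<omega> \<bullet> b)"
    and int: "integrable M f" "integrable M g"
  shows "integrable M (\<lambda>\<omega>. f \<omega> \<bullet> g \<omega>)" "expectation (\<lambda>\<omega>. f \<omega> \<bullet> g \<omega>) = expectation f \<bullet> expectation g"
proof -
  have *: "integrable M (\<lambda>\<omega>. (f \<omega> \<bullet> b) * (g \<omega> \<bullet> b))"
    "expectation (\<lambda>\<omega>. (f \<omega> \<bullet> b) * (g \<omega> \<bullet> b)) = (expectation f \<bullet> b) * (expectation g \<bullet> b)"
    if "b \<in> Basis" for b
    using indep_var_integrable[OF ind[OF that]] indep_var_lebesgue_integral[OF ind[OF that]] int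
    by (simp_all)
  show "integrable M (\<lambda>\<omega>. f \<omega> \<bullet> g \<omega>)"
    by (subst euclidean_inner) (use * in auto)
  show "expectation (\<lambda>\<omega>. f \<omega> \<bullet> g \<omega>) = expectation f \<bullet> expectation g"
    by (subst (1 2) euclidean_inner) (use * in \<open>simp add: Bochner_Integration.integral_sum\<close>)
qed

text \<open>
  The variables \<open>h (X i)\<close> are centred and independent, hence orthogonal in mean, so that the square
  of their sum has the mean of the sum of their squares.
\<close>

lemma (in prob_space) iid_mean_square:
  fixes h :: "'s \<Rightarrow> 'b::euclidean_space"
  assumes X: "indep_vars (\<lambda>_. D) X {..<n}" "\<And>i. i < n \<Longrightarrow> distr M D (X i) = D"
    and h: "integrable D h" "(\<integral>s. h s \<partial>D) = 0" "integrable D (\<lambda>s. (norm (h s))\<^sup>2)"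
  shows "integrable M (\<lambda>\<omega>. (norm ((1 / real n) *\<^sub>R (\<Sum>i<n. h (X i \<omega>))))\<^sup>2)"
    "expectation (\<lambda>\<omega>. (norm ((1 / real n) *\<^sub>R (\<Sum>i<n. h (X i \<omega>))))\<^sup>2) = (\<integral>s. (norm (h s))\<^sup>2 \<partial>D) / real n"
    "integrable M (\<lambda>\<omega>. (1 / real n) *\<^sub>R (\<Sum>i<n. h (X i \<omega>)))"
    "expectation (\<lambda>\<omega>. (1 / real n) *\<^sub>R (\<Sum>i<n. h (X i \<omega>))) = 0"
proof -
  have Xm: "X i \<in> measurable M D" if "i < n" for i
    using X(1) that by (auto simp: indep_vars_def)
  have hm: "h \<in> borel_measurable D" using h(1) by auto
  have Y: "integrable M (\<lambda>\<omega>. h (X i \<omega>))" "expectation (\<lambda>\<omega>. h (X i \<omega>)) = 0"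
      "integrable M (\<lambda>\<omega>. (norm (h (X i \<omega>)))\<^sup>2)"
      "expectation (\<lambda>\<omega>. (norm (h (X i \<omega>)))\<^sup>2) = (\<integral>s. (norm (h s))\<^sup>2 \<partial>D)" if i: "i < n" for i
  proof -
    note [simp] = X(2)[OF i]
    show "integrable M (\<lambda>\<omega>. h (X i \<omega>))"
      using integrable_distr_eq[OF Xm[OF i] hm] h by simp
    show "expectation (\<lambda>\<omega>. h (X i \<omega>)) = 0"
      using integral_distr[OF Xm[OF i] hm] h by simp
    show "integrable M (\<lambda>\<omega>. (norm (h (X i \<omega>)))\<^sup>2)"
      using integrable_distr_eq[OF Xm[OF i], of "\<lambda>s. (norm (h s))\<^sup>2"] hm h by simp
    show "expectation (\<lambda>\<omega>. (norm (h (X i \<omega>)))\<^sup>2) = (\<integral>s. (norm (h s))\<^sup>2 \<partial>D)"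
      using integral_distr[OF Xm[OF i], of "\<lambda>s. (norm (h s))\<^sup>2"] hm by simp
  qed
  have YY: "integrable M (\<lambda>\<omega>. h (X i \<omega>) \<bullet> h (X j \<omega>))"
    "expectation (\<lambda>\<omega>. h (X i \<omega>) \<bullet> h (X j \<omega>)) = (if i = j then \<integral>s. (norm (h s))\<^sup>2 \<partial>D else 0)"
    if ij: "i < n" "j < n" for i j
  proof -
    have "integrable M (\<lambda>\<omega>. h (X i \<omega>) \<bullet> h (X j \<omega>)) \<and>
      expectation (\<lambda>\<omega>. h (X i \<omega>) \<bullet> h (X j \<omega>)) = (if i = j then \<integral>s. (norm (h s))\<^sup>2 \<partial>D else 0)"
    proof (cases "i = j")
      case True
      then show ?thesis using Y(3,4)[OF ij(1)] by (simp add: power2_norm_eq_inner)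
    next
      case False
      have ind: "indep_var borel (\<lambda>\<omega>. h (X i \<omega>) \<bullet> b) borel (\<lambda>\<omega>. h (X j \<omega>) \<bullet> b)" for b
        by (rule indep_vars_imp_indep_var[OF X(1), where f = "\<lambda>s. h s \<bullet> b" and g = "\<lambda>s. h s \<bullet> b"])
          (use ij False hm in auto)
      show ?thesis
        using expectation_inner_indep[OF ind Y(1)[OF ij(1)] Y(1)[OF ij(2)]] Y(2)[OF ij(1)] False by simp
    qed
    then show "integrable M (\<lambda>\<omega>. h (X i \<omega>) \<bullet> h (X j \<omega>))"
      "expectation (\<lambda>\<omega>. h (X i \<omega>) \<bullet> h (X j \<omega>)) = (if i = j then \<integral>s. (norm (h s))\<^sup>2 \<partial>D else 0)"
      by auto
  qed
  have eq: "(norm ((1 / real n) *\<^sub>R (\<Sum>i<n. h (X i \<omega>))))\<^sup>2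
      = (\<Sum>i<n. \<Sum>j<n. (1 / (real n)\<^sup>2) * (h (X i \<omega>) \<bullet> h (X j \<omega>)))" for \<omega>
  proof -
    have "(norm ((1 / real n) *\<^sub>R v))\<^sup>2 = (1 / (real n)\<^sup>2) * (v \<bullet> v)" for v :: 'b
      by (simp add: power_divide flip: power2_norm_eq_inner)
    then show ?thesis by (simp only: inner_sum_left inner_sum_right sum_distrib_left) (rule sum.swap)
  qed
  show "integrable M (\<lambda>\<omega>. (norm ((1 / real n) *\<^sub>R (\<Sum>i<n. h (X i \<omega>))))\<^sup>2)"
    unfolding eq using YY by (intro Bochner_Integration.integrable_sum integrable_mult_right) auto
  have "expectation (\<lambda>\<omega>. (norm ((1 / real n) *\<^sub>R (\<Sum>i<n. h (X i \<omega>))))\<^sup>2)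
      = (\<Sum>i<n. \<Sum>j<n. (1 / (real n)\<^sup>2) * (if i = j then \<integral>s. (norm (h s))\<^sup>2 \<partial>D else 0))"
    unfolding eq using YY
    by (subst Bochner_Integration.integral_sum; (intro sum.cong refl Bochner_Integration.integrable_sum)?)
      (auto simp: Bochner_Integration.integral_sum)
  also have "\<dots> = (\<integral>s. (norm (h s))\<^sup>2 \<partial>D) / real n"
    by (simp add: if_distrib cong: if_cong) (simp add: power2_eq_square)
  finally show "expectation (\<lambda>\<omega>. (norm ((1 / real n) *\<^sub>R (\<Sum>i<n. h (X i \<omega>))))\<^sup>2)
      = (\<integral>s. (norm (h s))\<^sup>2 \<partial>D) / real n" .
  show "integrable M (\<lambda>\<omega>. (1 / real n) *\<^sub>R (\<Sum>i<n. h (X i \<omega>)))"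
    using Y by (intro integrable_scaleR_right Bochner_Integration.integrable_sum) auto
  show "expectation (\<lambda>\<omega>. (1 / real n) *\<^sub>R (\<Sum>i<n. h (X i \<omega>))) = 0"
    using Y by (simp add: Bochner_Integration.integral_sum)
qed

text \<open>
  The mean of the square splits into the square of the fixed part \<open>a\<close> and the mean square of the
  centred part. \<open>X\<close> and \<open>Y\<close> may depend on each other, which costs the factor 2.
\<close>

lemma (in prob_space) bias_variance_bound:
  fixes X Y :: "'a \<Rightarrow> 'b::euclidean_space"
  assumes X: "integrable M X" "expectation X = 0" "integrable M (\<lambda>\<omega>. (norm (X \<omega>))\<^sup>2)"
    and Y: "integrable M Y" "expectation Y = 0" "integrable M (\<lambda>\<omega>. (norm (Y \<omega>))\<^sup>2)"
  shows "(\<integral>\<^sup>+\<omega>. ennreal ((norm (a + X \<omega> + Y \<omega>))\<^sup>2) \<partial>M)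
    \<le> ennreal ((norm a)\<^sup>2 + 2 * expectation (\<lambda>\<omega>. (norm (X \<omega>))\<^sup>2) + 2 * expectation (\<lambda>\<omega>. (norm (Y \<omega>))\<^sup>2))"
proof -
  define g where "g \<omega> = (norm a)\<^sup>2 + 2 * (a \<bullet> X \<omega>) + 2 * (a \<bullet> Y \<omega>) + 2 * (norm (X \<omega>))\<^sup>2 + 2 * (norm (Y \<omega>))\<^sup>2" for \<omega>
  have le: "(norm (a + X \<omega> + Y \<omega>))\<^sup>2 \<le> g \<omega>" for \<omega>
  proof -
    have "0 \<le> (norm (X \<omega> - Y \<omega>))\<^sup>2" by simp
    then show ?thesis unfolding g_def power2_norm_eq_inner
      by (simp add: inner_add_left inner_add_right inner_diff_left inner_diff_right inner_commute algebra_simps)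
  qed
  have int: "integrable M g" unfolding g_def using X Y by auto
  have "(\<integral>\<^sup>+\<omega>. ennreal ((norm (a + X \<omega> + Y \<omega>))\<^sup>2) \<partial>M) \<le> (\<integral>\<^sup>+\<omega>. ennreal (g \<omega>) \<partial>M)"
    using le by (intro nn_integral_mono ennreal_leI) auto
  also have "\<dots> = ennreal (expectation g)"
    using le by (intro nn_integral_eq_integral[OF int]) (auto intro: order_trans[OF zero_le_power2])
  also have "expectation g = (norm a)\<^sup>2 + 2 * expectation (\<lambda>\<omega>. (norm (X \<omega>))\<^sup>2) + 2 * expectation (\<lambda>\<omega>. (norm (Y \<omega>))\<^sup>2)"
    unfolding g_def using X Y by (simp add: prob_space)
  finally show ?thesis .
qed

lemma (in prob_space) nn_integral_indep:
  assumes ind: "indep_var N1 X N2 Y" and g: "g \<in> borel_measurable (N1 \<Otimes>\<^sub>M N2)"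
  shows "(\<integral>\<^sup>+\<omega>. g (X \<omega>, Y \<omega>) \<partial>M) = (\<integral>\<^sup>+\<omega>. (\<integral>\<^sup>+\<omega>'. g (X \<omega>, Y \<omega>') \<partial>M) \<partial>M)"
proof -
  have [measurable]: "X \<in> measurable M N1" "Y \<in> measurable M N2"
    using indep_var_rv1[OF ind] indep_var_rv2[OF ind] by auto
  interpret Y: prob_space "distr M N2 Y" by (rule prob_space_distr) simp
  note [measurable] = g
  have "(\<integral>\<^sup>+\<omega>. g (X \<omega>, Y \<omega>) \<partial>M) = (\<integral>\<^sup>+p. g p \<partial>distr M (N1 \<Otimes>\<^sub>M N2) (\<lambda>\<omega>. (X \<omega>, Y \<omega>)))"
    by (subst nn_integral_distr) auto
  also have "\<dots> = (\<integral>\<^sup>+p. g p \<partial>(distr M N1 X \<Otimes>\<^sub>M distr M N2 Y))"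
    using ind by (simp add: indep_var_distribution_eq)
  also have "\<dots> = (\<integral>\<^sup>+x. (\<integral>\<^sup>+y. g (x, y) \<partial>distr M N2 Y) \<partial>distr M N1 X)"
    by (subst Y.nn_integral_fst[symmetric]) (auto cong: measurable_cong_sets sets_pair_measure_cong)
  also have "\<dots> = (\<integral>\<^sup>+\<omega>. (\<integral>\<^sup>+\<omega>'. g (X \<omega>, Y \<omega>') \<partial>M) \<partial>M)"
    by (subst nn_integral_distr) (auto simp: nn_integral_distr intro!: nn_integral_cong)
  finally show ?thesis .
qed

text \<open>
  Conditioning on the past without conditional expectations: the state before step \<open>k\<close> is a
  measurable function of the inputs \<open>\<beta> i\<close> with \<open>i < k\<close>, hence independent of \<open>\<beta> k\<close>, and in the
  integral the input of step \<open>k\<close> can be averaged with the state held fixed.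
\<close>

lemma (in prob_space)
  fixes st :: "nat \<Rightarrow> 'a \<Rightarrow> 'c"
  assumes ind: "indep_vars N \<beta> (UNIV :: nat set)"
    and st0: "\<And>\<omega>. \<omega> \<in> space M \<Longrightarrow> st 0 \<omega> = c" "c \<in> space B"
    and st: "\<And>k \<omega>. \<omega> \<in> space M \<Longrightarrow> st (Suc k) \<omega> = step k (st k \<omega>, \<beta> k \<omega>)"
    and step: "\<And>k. step k \<in> measurable (B \<Otimes>\<^sub>M N k) B"
  shows driven_state_measurable: "st k \<in> measurable M B"
    and driven_state_nn_integral: "\<And>g. g \<in> borel_measurable (B \<Otimes>\<^sub>M N k) \<Longrightarrow>
      (\<integral>\<^sup>+\<omega>. g (st k \<omega>, \<beta> k \<omega>) \<partial>M) = (\<integral>\<^sup>+\<omega>. (\<integral>\<^sup>+\<omega>'. g (st k \<omega>, \<beta> k \<omega>') \<partial>M) \<partial>M)"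
proof -
  have "\<exists>h. h \<in> measurable (PiM {..<k} N) B \<and> (\<forall>\<omega>\<in>space M. st k \<omega> = h (\<lambda>i\<in>{..<k}. \<beta> i \<omega>))"
  proof (induction k)
    case 0
    show ?case using st0 by (intro exI[of _ "\<lambda>_. c"]) auto
  next
    case (Suc k)
    then obtain h where h: "h \<in> measurable (PiM {..<k} N) B"
      "\<And>\<omega>. \<omega> \<in> space M \<Longrightarrow> st k \<omega> = h (\<lambda>i\<in>{..<k}. \<beta> i \<omega>)" by blast
    define h' where "h' = (\<lambda>s. step k (h (restrict s {..<k}), s k))"
    have r: "(\<lambda>s. restrict s {..<k}) \<in> measurable (PiM {..<Suc k} N) (PiM {..<k} N)"
      by (rule measurable_restrict_subset) auto
    have "(\<lambda>s. s k) \<in> measurable (PiM {..<Suc k} N) (N k)"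
      by (rule measurable_component_singleton) simp
    then have "h' \<in> measurable (PiM {..<Suc k} N) B"
      unfolding h'_def
      by (intro measurable_compose[OF _ step] measurable_Pair measurable_compose[OF r h(1)])
    moreover have "st (Suc k) \<omega> = h' (\<lambda>i\<in>{..<Suc k}. \<beta> i \<omega>)" if "\<omega> \<in> space M" for \<omega>
    proof -
      have "restrict (\<lambda>i\<in>{..<Suc k}. \<beta> i \<omega>) {..<k} = (\<lambda>i\<in>{..<k}. \<beta> i \<omega>)" by (auto simp: restrict_def)
      then show ?thesis using st[OF that] h(2)[OF that] by (simp add: h'_def)
    qed
    ultimately show ?case by blast
  qed
  then obtain h where h: "h \<in> measurable (PiM {..<k} N) B"
    "\<And>\<omega>. \<omega> \<in> space M \<Longrightarrow> st k \<omega> = h (\<lambda>i\<in>{..<k}. \<beta> i \<omega>)" by blast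
  have ind2: "indep_var (PiM {..<k} N) (\<lambda>\<omega>. restrict (\<lambda>i. \<beta> i \<omega>) {..<k})
      (PiM {k} N) (\<lambda>\<omega>. restrict (\<lambda>i. \<beta> i \<omega>) {k})"
    by (rule indep_var_restrict[OF ind]) auto
  have "(\<lambda>\<omega>. h (\<lambda>i\<in>{..<k}. \<beta> i \<omega>)) \<in> measurable M B"
    by (rule measurable_compose[OF indep_var_rv1[OF ind2] h(1)])
  then show "st k \<in> measurable M B" using h(2) by (simp cong: measurable_cong)
  fix g :: "'c \<times> 'b \<Rightarrow> ennreal"
  assume g: "g \<in> borel_measurable (B \<Otimes>\<^sub>M N k)"
  define g' where "g' p = g (h (fst p), snd p k)" for p
  have "(\<lambda>s. s k) \<in> measurable (PiM {k} N) (N k)"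
    by (rule measurable_component_singleton) simp
  then have "g' \<in> borel_measurable (PiM {..<k} N \<Otimes>\<^sub>M PiM {k} N)"
    unfolding g'_def
    by (intro measurable_compose[OF _ g] measurable_Pair measurable_compose[OF measurable_fst h(1)]
        measurable_compose[OF measurable_snd])
  note I = nn_integral_indep[OF ind2 this]
  have "(\<integral>\<^sup>+\<omega>. g (st k \<omega>, \<beta> k \<omega>) \<partial>M)
      = (\<integral>\<^sup>+\<omega>. g' (restrict (\<lambda>i. \<beta> i \<omega>) {..<k}, restrict (\<lambda>i. \<beta> i \<omega>) {k}) \<partial>M)"
    by (intro nn_integral_cong) (simp add: g'_def h(2))
  also note I
  also have "(\<integral>\<^sup>+\<omega>. (\<integral>\<^sup>+\<omega>'. g' (restrict (\<lambda>i. \<beta> i \<omega>) {..<k}, restrict (\<lambda>i. \<beta> i \<omega>') {k}) \<partial>M) \<partial>M)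
      = (\<integral>\<^sup>+\<omega>. (\<integral>\<^sup>+\<omega>'. g (st k \<omega>, \<beta> k \<omega>') \<partial>M) \<partial>M)"
    by (intro nn_integral_cong) (simp add: g'_def h(2))
  finally show "(\<integral>\<^sup>+\<omega>. g (st k \<omega>, \<beta> k \<omega>) \<partial>M) = (\<integral>\<^sup>+\<omega>. (\<integral>\<^sup>+\<omega>'. g (st k \<omega>, \<beta> k \<omega>') \<partial>M) \<partial>M)" .
qed

lemma (in prob_space) variance_eq_second_moment:
  fixes Z :: "'a \<Rightarrow> 'b::euclidean_space"
  assumes "integrable M Z" "integrable M (\<lambda>\<omega>. (norm (Z \<omega>))\<^sup>2)"
  shows "integrable M (\<lambda>\<omega>. (norm (Z \<omega> - expectation Z))\<^sup>2)"
    "expectation (\<lambda>\<omega>. (norm (Z \<omega> - expectation Z))\<^sup>2)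
      = expectation (\<lambda>\<omega>. (norm (Z \<omega>))\<^sup>2) - (norm (expectation Z))\<^sup>2"
proof -
  define m where "m = expectation Z"
  have eq: "(norm (Z \<omega> - m))\<^sup>2 = (norm (Z \<omega>))\<^sup>2 - 2 * (Z \<omega> \<bullet> m) + (norm m)\<^sup>2" for \<omega>
    unfolding power2_norm_eq_inner by (simp add: inner_diff_left inner_diff_right inner_commute)
  show "integrable M (\<lambda>\<omega>. (norm (Z \<omega> - expectation Z))\<^sup>2)"
    unfolding m_def[symmetric] eq using assms by auto
  have "expectation (\<lambda>\<omega>. (norm (Z \<omega> - m))\<^sup>2) = expectation (\<lambda>\<omega>. (norm (Z \<omega>))\<^sup>2) - 2 * (m \<bullet> m) + (norm m)\<^sup>2"
    unfolding eq using assms by (simp add: prob_space m_def)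
  then show "expectation (\<lambda>\<omega>. (norm (Z \<omega> - expectation Z))\<^sup>2)
      = expectation (\<lambda>\<omega>. (norm (Z \<omega>))\<^sup>2) - (norm (expectation Z))\<^sup>2"
    by (simp add: m_def power2_norm_eq_inner)
qed

lemma integrable_of_nn_integral_le:
  fixes f :: "'a \<Rightarrow> real"
  assumes "f \<in> borel_measurable M" "\<And>\<omega>. 0 \<le> f \<omega>" "(\<integral>\<^sup>+\<omega>. ennreal (f \<omega>) \<partial>M) \<le> ennreal c" "0 \<le> c"
  shows "integrable M f" "(\<integral>\<omega>. f \<omega> \<partial>M) \<le> c"
proof -
  show i: "integrable M f"
    using assms by (intro integrableI_nonneg) (auto intro: order.strict_trans1)
  have "ennreal (\<integral>\<omega>. f \<omega> \<partial>M) \<le> ennreal c"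
    using assms nn_integral_eq_integral[OF i] by simp
  then show "(\<integral>\<omega>. f \<omega> \<partial>M) \<le> c" using assms(4) by simp
qed

section \<open>The stochastic inclusion\<close>

lemma cocoercive_measurable:
  fixes h :: "'a::euclidean_space \<Rightarrow> 'a"
  assumes c: "c > 0" and h: "\<And>x y. (h x - h y) \<bullet> (x - y) \<ge> c * (norm (h x - h y))\<^sup>2"
  shows "h \<in> borel_measurable borel"
proof -
  have "norm (h x - h y) \<le> (1 / c) * norm (x - y)" for x y
  proof -
    have "c * norm (h x - h y) * norm (h x - h y) \<le> norm (x - y) * norm (h x - h y)"
      using h[of x y] norm_cauchy_schwarz[of "h x - h y" "x - y"]
      by (simp add: power2_eq_square mult.commute mult.left_commute)
    then have "c * norm (h x - h y) \<le> norm (x - y)"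
      by (cases "h x = h y") auto
    then show ?thesis using c by (simp add: field_simps)
  qed
  then have "(1 / c)-lipschitz_on UNIV h" using c by (intro lipschitz_onI) (auto simp: dist_norm)
  then show ?thesis
    by (intro borel_measurable_continuous_onI lipschitz_on_continuous_on)
qed

locale stochastic_inclusion = D: prob_space D
  for D :: "'s measure" +
  fixes Fo :: "'a::euclidean_space \<Rightarrow> 's \<Rightarrow> 'a" and F :: "'a \<Rightarrow> 'a" and T :: "'a \<Rightarrow> 'a set"
    and \<rho> L L' lam \<beta>' :: real
  assumes Fo_meas: "(\<lambda>(x, s). Fo x s) \<in> borel_measurable (borel \<Otimes>\<^sub>M D)"
    and F: "\<And>x. integrable D (Fo x)" "\<And>x. F x = (\<integral>s. Fo x s \<partial>D)"
    and variance: "\<And>x. integrable D (\<lambda>s. (norm (Fo x s - F x))\<^sup>2)"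
    and T: "\<rho> \<ge> 0" "maximally_cohypomonotone \<rho> T"
    and cocoercive: "L > 0"
      "\<And>x y. (F x - F y) \<bullet> (x - y) \<ge> (1 / L) * (\<integral>s. (norm (Fo x s - Fo y s))\<^sup>2 \<partial>D)"
    and L': "L' > L" "L' * \<rho> < 1"
    and lam: "lam > 0" "2 * \<rho> \<le> lam"
    and betabar: "\<beta>' = (lam * (4 - L' * lam) - 4 * \<rho>) / (4 * (1 - \<rho> * L'))" "\<beta>' > 0"
begin

abbreviation G where "G \<equiv> G_op lam F T"

definition oracle_gap :: "'a \<Rightarrow> 'a \<Rightarrow> real" where
  "oracle_gap x y = (\<integral>s. (norm (Fo x s - Fo y s))\<^sup>2 \<partial>D)"

text \<open>
  Only the centred oracle is assumed square integrable; the difference of two values of the oracle is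
  the difference of the centred values plus a constant.
\<close>

lemma oracle_gap_integrable: "integrable D (\<lambda>s. (norm (Fo x s - Fo y s))\<^sup>2)"
proof (rule Bochner_Integration.integrable_bound)
  show "integrable D (\<lambda>s. 3 * (norm (Fo x s - F x))\<^sup>2 + 3 * (norm (Fo y s - F y))\<^sup>2 + 3 * (norm (F x - F y))\<^sup>2)"
    using variance by auto
  show "(\<lambda>s. (norm (Fo x s - Fo y s))\<^sup>2) \<in> borel_measurable D" using F by measurable
  show "AE s in D. norm ((norm (Fo x s - Fo y s))\<^sup>2)
      \<le> norm (3 * (norm (Fo x s - F x))\<^sup>2 + 3 * (norm (Fo y s - F y))\<^sup>2 + 3 * (norm (F x - F y))\<^sup>2)"
  proof (rule AE_I2)
    fix s
    have sq: "(norm (p - q + m))\<^sup>2 \<le> 3 * (norm p)\<^sup>2 + 3 * (norm q)\<^sup>2 + 3 * (norm m)\<^sup>2" for p q m :: 'a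
    proof -
      have "0 \<le> (norm (p + q))\<^sup>2 + (norm (p - m))\<^sup>2 + (norm (q + m))\<^sup>2" by simp
      then show ?thesis unfolding power2_norm_eq_inner
        by (simp add: inner_add_left inner_add_right inner_diff_left inner_diff_right inner_commute)
    qed
    show "norm ((norm (Fo x s - Fo y s))\<^sup>2)
      \<le> norm (3 * (norm (Fo x s - F x))\<^sup>2 + 3 * (norm (Fo y s - F y))\<^sup>2 + 3 * (norm (F x - F y))\<^sup>2)"
      using sq[of "Fo x s - F x" "Fo y s - F y" "F x - F y"] by simp
  qed
qed

lemma oracle_gap_nonneg: "0 \<le> oracle_gap x y"
  by (simp add: oracle_gap_def)

lemma oracle_difference_variance:
  "integrable D (\<lambda>s. (norm (Fo x s - Fo y s - (F x - F y)))\<^sup>2)"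
  "(\<integral>s. (norm (Fo x s - Fo y s - (F x - F y)))\<^sup>2 \<partial>D) = oracle_gap x y - (norm (F x - F y))\<^sup>2"
proof -
  have "(\<integral>s. Fo x s - Fo y s \<partial>D) = F x - F y" using F by simp
  then show "integrable D (\<lambda>s. (norm (Fo x s - Fo y s - (F x - F y)))\<^sup>2)"
    "(\<integral>s. (norm (Fo x s - Fo y s - (F x - F y)))\<^sup>2 \<partial>D) = oracle_gap x y - (norm (F x - F y))\<^sup>2"
    using D.variance_eq_second_moment[OF _ oracle_gap_integrable, of x y] F
    by (simp_all add: oracle_gap_def)
qed

text \<open>
  The difference of the two sides is the variance of the oracle difference.
\<close>

lemma F_diff_le_oracle_gap: "(norm (F x - F y))\<^sup>2 \<le> oracle_gap x y"
proof -
  have "0 \<le> (\<integral>s. (norm (Fo x s - Fo y s - (F x - F y)))\<^sup>2 \<partial>D)" by simp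
  then show ?thesis by (simp add: oracle_difference_variance)
qed

lemma F_measurable [measurable]: "F \<in> borel_measurable borel"
proof (rule cocoercive_measurable)
  fix x y
  have "(1 / L) * (norm (F x - F y))\<^sup>2 \<le> (1 / L) * oracle_gap x y"
    using F_diff_le_oracle_gap cocoercive(1) by (intro mult_left_mono) auto
  also have "\<dots> \<le> (F x - F y) \<bullet> (x - y)" unfolding oracle_gap_def by (rule cocoercive(2))
  finally show "(1 / L) * (norm (F x - F y))\<^sup>2 \<le> (F x - F y) \<bullet> (x - y)" .
qed (use cocoercive in simp)

text \<open>
  Of the factor \<open>1 / L\<close> in front of \<open>oracle_gap x y\<close> the part \<open>1 / L'\<close> is spent, through
  \<open>F_diff_le_oracle_gap\<close>, on the co-coercivity of the residual; the rest is kept.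
\<close>

lemma G_cocoercive:
  "(G x - G y) \<bullet> (x - y) \<ge> \<beta>' * (norm (G x - G y))\<^sup>2 + (1 / L - 1 / L') * oracle_gap x y"
  unfolding betabar(1)
proof (rule residual_cocoercive[OF T(2,1) lam _ L'(2)])
  show "L' > 0" using L'(1) cocoercive(1) by simp
  have "(1 / L') * (norm (F x - F y))\<^sup>2 \<le> (1 / L') * oracle_gap x y"
    using F_diff_le_oracle_gap L'(1) cocoercive(1) by (intro mult_left_mono) auto
  moreover have "(1 / L) * oracle_gap x y \<le> (F x - F y) \<bullet> (x - y)"
    unfolding oracle_gap_def by (rule cocoercive(2))
  ultimately show "(1 / L') * (norm (F x - F y))\<^sup>2 + (1 / L - 1 / L') * oracle_gap x y \<le> (F x - F y) \<bullet> (x - y)"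
    by (simp add: left_diff_distrib)
qed

lemma gap_factor_pos: "1 / L - 1 / L' > 0"
  using L'(1) cocoercive(1) by (simp add: field_simps)

lemma G_cocoercive': "(G x - G y) \<bullet> (x - y) \<ge> \<beta>' * (norm (G x - G y))\<^sup>2"
proof -
  have "(1 / L - 1 / L') * oracle_gap x y \<ge> 0"
    using gap_factor_pos oracle_gap_nonneg by (intro mult_nonneg_nonneg) auto
  with G_cocoercive[of x y] show ?thesis by linarith
qed

lemma G_measurable [measurable]: "G \<in> borel_measurable borel"
  by (rule cocoercive_measurable[OF betabar(2) G_cocoercive'])

lemma oracle_measurable:
  assumes "f \<in> borel_measurable A" "g \<in> measurable A D"
  shows "(\<lambda>w. Fo (f w) (g w)) \<in> borel_measurable A"
  using measurable_compose[OF measurable_Pair[OF assms] Fo_meas] by simp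

lemma residual_measurable':
  assumes "f \<in> borel_measurable A" "g \<in> borel_measurable A"
  shows "(\<lambda>w. residual lam T (f w) (g w)) \<in> borel_measurable A"
  using measurable_compose[OF measurable_Pair[OF assms] residual_measurable[OF T(2,1) lam]] by simp

lemma oracle_gap_measurable:
  assumes [measurable]: "f \<in> borel_measurable A" "g \<in> borel_measurable A"
  shows "(\<lambda>w. oracle_gap (f w) (g w)) \<in> borel_measurable A"
proof -
  have [measurable]: "(\<lambda>p. Fo (f (fst p)) (snd p)) \<in> borel_measurable (A \<Otimes>\<^sub>M D)"
    "(\<lambda>p. Fo (g (fst p)) (snd p)) \<in> borel_measurable (A \<Otimes>\<^sub>M D)"
    by (rule oracle_measurable; measurable)+
  have "(\<lambda>(w, s). (norm (Fo (f w) s - Fo (g w) s))\<^sup>2) \<in> borel_measurable (A \<Otimes>\<^sub>M D)"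
    unfolding case_prod_beta by measurable
  then show ?thesis unfolding oracle_gap_def
    by (rule D.borel_measurable_lebesgue_integral)
qed

end

section \<open>Error of the hybrid estimator\<close>

locale hsgd_run = stochastic_inclusion D Fo F T \<rho> L L' lam \<beta>' + M: prob_space M
  for D :: "'s measure" and Fo :: "'a::euclidean_space \<Rightarrow> 's \<Rightarrow> 'a" and F T \<rho> L L' lam \<beta>'
    and M :: "'w measure" +
  fixes \<sigma> :: real and n0 :: nat and b b' :: "nat \<Rightarrow> nat" and S S' :: "nat \<Rightarrow> nat \<Rightarrow> 'w \<Rightarrow> 's"
    and E0 :: "(nat \<Rightarrow> 's) \<Rightarrow> 'a" and E :: "nat \<Rightarrow> 'a \<Rightarrow> (nat \<Rightarrow> 's) \<Rightarrow> 'a"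
    and \<tau> t \<eta> :: "nat \<Rightarrow> real" and \<nu> :: real and x0 :: 'a and x z f :: "nat \<Rightarrow> 'w \<Rightarrow> 'a"
  assumes fresh: "fresh_samples M D n0 b b' S S'"
    and init: "initial_estimator D \<sigma> n0 (F x0) E0"
    and unbiased: "\<And>k. k \<ge> 1 \<Longrightarrow> unbiased_estimator D \<sigma> (b' k) F (E k)"
    and hsgd: "hsgd_estimates M Fo \<tau> n0 b b' S S' E0 E x f"
    and run: "\<And>\<omega>. \<omega> \<in> space M \<Longrightarrow> vfosa_plus lam T t \<nu> \<eta> x0 (\<lambda>k. f k \<omega>) (\<lambda>k. x k \<omega>) (\<lambda>k. z k \<omega>)"
    and sizes: "n0 \<ge> 1" "\<And>k. b k \<ge> 1" "\<And>k. b' k \<ge> 1"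
begin

text \<open>
  As for the samples themselves, step 0 has an empty first batch and the initial sample as its second
  batch.
\<close>

definition batch_space :: "nat \<Rightarrow> ((nat \<Rightarrow> 's) \<times> (nat \<Rightarrow> 's)) measure" where
  "batch_space k = PiM {..<(b(0 := 0)) k} (\<lambda>_. D) \<Otimes>\<^sub>M PiM {..<(b'(0 := n0)) k} (\<lambda>_. D)"

definition batches :: "nat \<Rightarrow> 'w \<Rightarrow> (nat \<Rightarrow> 's) \<times> (nat \<Rightarrow> 's)" where
  "batches k \<omega> = (batch ((b(0 := 0)) k) (S k) \<omega>, batch ((b'(0 := n0)) k) (S' k) \<omega>)"

lemma batches_indep: "M.indep_vars batch_space batches UNIV"
  using fresh unfolding fresh_samples_def Let_def batch_space_def batches_def by simp

lemma batch_iid: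
  "k \<ge> 1 \<Longrightarrow> iid_sample M D (b k) (S k)" "k \<ge> 1 \<Longrightarrow> iid_sample M D (b' k) (S' k)" "iid_sample M D n0 (S' 0)"
  using fresh unfolding fresh_samples_def Let_def
  by (metis fun_upd_apply not_one_le_zero, metis fun_upd_apply not_one_le_zero, metis fun_upd_apply)

text \<open>
  This transfers the moment bounds of an estimator, which are stated on the product space, to the
  probability space of the run.
\<close>

lemma batch_distr:
  assumes "iid_sample M D n X" "n \<ge> 1"
  shows "batch n X \<in> measurable M (PiM {..<n} (\<lambda>_. D))" "distr M (PiM {..<n} (\<lambda>_. D)) (batch n X) = PiM {..<n} (\<lambda>_. D)"
proof -
  have ind: "M.indep_vars (\<lambda>_. D) X {..<n}" and d: "\<And>i. i < n \<Longrightarrow> distr M D (X i) = D"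
    using assms(1) by (auto simp: iid_sample_def)
  have rv: "X i \<in> measurable M D" if "i \<in> {..<n}" for i
    using ind that by (auto simp: M.indep_vars_def)
  have ne: "{..<n} \<noteq> {}" using assms(2) by (auto simp: lessThan_empty_iff)
  show "batch n X \<in> measurable M (PiM {..<n} (\<lambda>_. D))"
    unfolding batch_def using rv by (intro measurable_restrict) auto
  have "distr M (PiM {..<n} (\<lambda>_. D)) (\<lambda>\<omega>. \<lambda>i\<in>{..<n}. X i \<omega>) = PiM {..<n} (\<lambda>i. distr M D (X i))"
    using M.indep_vars_iff_distr_eq_PiM'[where M' = "\<lambda>_. D", OF ne rv] ind by simp
  also have "\<dots> = PiM {..<n} (\<lambda>_. D)" using d by (intro PiM_cong) auto
  finally show "distr M (PiM {..<n} (\<lambda>_. D)) (batch n X) = PiM {..<n} (\<lambda>_. D)"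
    by (simp add: batch_def[abs_def])
qed

text \<open>
  What step \<open>k\<close> inherits from the past. The estimate \<open>f k\<close> is not part of it, since it already uses
  the batches of step \<open>k\<close>; the zeros at \<open>k = 0\<close> are placeholders for a previous step.
\<close>

definition state :: "nat \<Rightarrow> 'w \<Rightarrow> 'a \<times> 'a \<times> 'a \<times> 'a" where
  "state k \<omega> = (x k \<omega>, z k \<omega>, if k = 0 then (0, 0) else (x (k - 1) \<omega>, f (k - 1) \<omega>))"

definition estimate :: "nat \<Rightarrow> ('a \<times> 'a \<times> 'a \<times> 'a) \<times> ((nat \<Rightarrow> 's) \<times> (nat \<Rightarrow> 's)) \<Rightarrow> 'a" where
  "estimate k = (\<lambda>((x, z, xp, fp), (s, s')).
     if k = 0 then E0 s'
     else (1 - \<tau> k) *\<^sub>R (fp + (1 / real (b k)) *\<^sub>R (\<Sum>i<b k. Fo x (s i) - Fo xp (s i))) + \<tau> k *\<^sub>R E k x s')"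

abbreviation state_space :: "('a \<times> 'a \<times> 'a \<times> 'a) measure" where
  "state_space \<equiv> borel \<Otimes>\<^sub>M (borel \<Otimes>\<^sub>M (borel \<Otimes>\<^sub>M borel))"

lemma estimate_eq:
  assumes "\<omega> \<in> space M"
  shows "f k \<omega> = estimate k (state k \<omega>, batches k \<omega>)"
proof (cases "k = 0")
  case True
  then show ?thesis using hsgd assms by (simp add: hsgd_estimates_def estimate_def state_def batches_def)
next
  case False
  then have "k \<ge> 1" by simp
  with hsgd assms have "f k \<omega> =
           (1 - \<tau> k) *\<^sub>R (f (k - 1) \<omega> +
              (1 / real (b k)) *\<^sub>R (\<Sum>i<b k. Fo (x k \<omega>) (S k i \<omega>) - Fo (x (k - 1) \<omega>) (S k i \<omega>)))
           + \<tau> k *\<^sub>R E k (x k \<omega>) (batch (b' k) (S' k) \<omega>)"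
    unfolding hsgd_estimates_def by blast
  then show ?thesis using False by (simp add: estimate_def state_def batches_def batch_def)
qed

lemma estimate_measurable [measurable]: "estimate k \<in> measurable (state_space \<Otimes>\<^sub>M batch_space k) borel"
proof (cases "k = 0")
  case True
  have E0: "E0 \<in> borel_measurable (PiM {..<n0} (\<lambda>_. D))"
    using init by (simp add: initial_estimator_def Let_def)
  have N0: "batch_space 0 = PiM {} (\<lambda>_. D) \<Otimes>\<^sub>M PiM {..<n0} (\<lambda>_. D)" by (simp add: batch_space_def)
  have "(\<lambda>p. E0 (snd (snd p))) \<in> borel_measurable (state_space \<Otimes>\<^sub>M batch_space 0)"
    unfolding N0 by (rule measurable_compose[OF _ E0]) measurable
  moreover have "estimate 0 = (\<lambda>p. E0 (snd (snd p)))" by (auto simp: estimate_def)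
  ultimately show ?thesis unfolding True by simp
next
  case False
  then have k: "k \<ge> 1" by simp
  have E: "(\<lambda>w. E k (g w) (h w)) \<in> borel_measurable A"
    if "g \<in> borel_measurable A" "h \<in> measurable A (PiM {..<b' k} (\<lambda>_. D))" for g h and A :: "'z measure"
    using measurable_compose[OF measurable_Pair[OF that], of "case_prod (E k)" borel] unbiased[OF k]
    by (simp add: unbiased_estimator_def Let_def)
  have Nk: "batch_space k = PiM {..<b k} (\<lambda>_. D) \<Otimes>\<^sub>M PiM {..<b' k} (\<lambda>_. D)" using False by (simp add: batch_space_def)
  have [measurable]: "(\<lambda>p. E k (fst (fst p)) (snd (snd p))) \<in> borel_measurable (state_space \<Otimes>\<^sub>M batch_space k)"
    unfolding Nk by (rule E; measurable)
  have [measurable]: "(\<lambda>p. fst (snd p) i) \<in> measurable (state_space \<Otimes>\<^sub>M batch_space k) D" if "i < b k" for i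
  proof -
    have "(\<lambda>s. s i) \<in> measurable (PiM {..<b k} (\<lambda>_. D)) D"
      by (rule measurable_component_singleton) (use that in simp)
    then show ?thesis unfolding Nk by (rule measurable_compose[rotated]) measurable
  qed
  have [measurable]: "(\<lambda>p. Fo (fst (fst p)) (fst (snd p) i)) \<in> borel_measurable (state_space \<Otimes>\<^sub>M batch_space k)"
    "(\<lambda>p. Fo (fst (snd (snd (fst p)))) (fst (snd p) i)) \<in> borel_measurable (state_space \<Otimes>\<^sub>M batch_space k)"
    if "i < b k" for i
    by (rule oracle_measurable; use that in measurable)+
  have "(\<lambda>p. (1 - \<tau> k) *\<^sub>R (snd (snd (snd (fst p))) + (1 / real (b k)) *\<^sub>R
        (\<Sum>i<b k. Fo (fst (fst p)) (fst (snd p) i) - Fo (fst (snd (snd (fst p)))) (fst (snd p) i)))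
      + \<tau> k *\<^sub>R E k (fst (fst p)) (snd (snd p))) \<in> borel_measurable (state_space \<Otimes>\<^sub>M batch_space k)"
    by measurable
  moreover have "estimate k = (\<lambda>p. (1 - \<tau> k) *\<^sub>R (snd (snd (snd (fst p))) + (1 / real (b k)) *\<^sub>R
        (\<Sum>i<b k. Fo (fst (fst p)) (fst (snd p) i) - Fo (fst (snd (snd (fst p)))) (fst (snd p) i)))
      + \<tau> k *\<^sub>R E k (fst (fst p)) (snd (snd p)))"
    using False by (auto simp: estimate_def)
  ultimately show ?thesis by simp
qed

definition next_state :: "nat \<Rightarrow> ('a \<times> 'a \<times> 'a \<times> 'a) \<times> ((nat \<Rightarrow> 's) \<times> (nat \<Rightarrow> 's)) \<Rightarrow> 'a \<times> 'a \<times> 'a \<times> 'a" where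
  "next_state k p = (let x = fst (fst p); z = fst (snd (fst p)); fk = estimate k p;
       y = ((t k - 1) / t k) *\<^sub>R x + (1 / t k) *\<^sub>R z;
       x' = y - \<eta> k *\<^sub>R residual lam T x fk
     in (x', z + \<nu> *\<^sub>R (x' - y), x, fk))"

lemma next_state_measurable: "next_state k \<in> measurable (state_space \<Otimes>\<^sub>M batch_space k) state_space"
proof -
  have [measurable]: "(\<lambda>p. residual lam T (fst (fst p)) (estimate k p)) \<in> borel_measurable (state_space \<Otimes>\<^sub>M batch_space k)"
    by (rule residual_measurable'; measurable)
  show ?thesis unfolding next_state_def Let_def by measurable
qed

lemma run_step:
  assumes "\<omega> \<in> space M"
  shows "x 0 \<omega> = x0" "z 0 \<omega> = x0"
    "x (Suc k) \<omega> = ((t k - 1) / t k) *\<^sub>R x k \<omega> + (1 / t k) *\<^sub>R z k \<omega> - \<eta> k *\<^sub>R residual lam T (x k \<omega>) (f k \<omega>)"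
    "z (Suc k) \<omega> = z k \<omega> + \<nu> *\<^sub>R (x (Suc k) \<omega> - (((t k - 1) / t k) *\<^sub>R x k \<omega> + (1 / t k) *\<^sub>R z k \<omega>))"
  using run[OF assms] unfolding vfosa_plus_def Let_def by blast+

lemma state_initial: "\<omega> \<in> space M \<Longrightarrow> state 0 \<omega> = (x0, x0, 0, 0)" "(x0, x0, 0, 0) \<in> space state_space"
  using run_step by (simp_all add: state_def space_pair_measure)

lemma state_step: "\<omega> \<in> space M \<Longrightarrow> state (Suc k) \<omega> = next_state k (state k \<omega>, batches k \<omega>)"
  unfolding next_state_def Let_def
  using run_step(3,4)[of \<omega> k] estimate_eq[of \<omega> k] by (simp add: state_def)

lemmas state_measurable = M.driven_state_measurable[OF batches_indep state_initial state_step next_state_measurable]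
  and state_nn_integral = M.driven_state_nn_integral[OF batches_indep state_initial state_step next_state_measurable]

lemma iterates_measurable [measurable]:
  "x k \<in> borel_measurable M" "z k \<in> borel_measurable M" "f k \<in> borel_measurable M"
proof -
  note s = state_measurable
  have "(\<lambda>\<omega>. fst (state k \<omega>)) \<in> borel_measurable M" "(\<lambda>\<omega>. fst (snd (state k \<omega>))) \<in> borel_measurable M"
    "(\<lambda>\<omega>. snd (snd (snd (state (Suc k) \<omega>)))) \<in> borel_measurable M"
    using s[of k] s[of "Suc k"] by measurable
  then show "x k \<in> borel_measurable M" "z k \<in> borel_measurable M" "f k \<in> borel_measurable M"
    by (simp_all add: state_def)
qed

definition sq_err :: "nat \<Rightarrow> 'w \<Rightarrow> real" where
  "sq_err k \<omega> = (norm (f k \<omega> - F (x k \<omega>)))\<^sup>2"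

definition step_gap :: "nat \<Rightarrow> 'w \<Rightarrow> real" where
  "step_gap k \<omega> = oracle_gap (x (Suc k) \<omega>) (x k \<omega>)"

lemma sq_err_measurable [measurable]: "sq_err k \<in> borel_measurable M"
  unfolding sq_err_def by measurable

lemma step_gap_measurable [measurable]: "step_gap k \<in> borel_measurable M"
  unfolding step_gap_def by (rule oracle_gap_measurable; measurable)

lemma initial_error: "integrable M (sq_err 0)" "M.expectation (sq_err 0) \<le> \<sigma>\<^sup>2 / real n0"
proof -
  define P where "P = PiM {..<n0} (\<lambda>_. D)"
  note bd = batch_distr[OF batch_iid(3) sizes(1), folded P_def]
  have E0: "E0 \<in> borel_measurable P" "integrable P (\<lambda>s. (norm (E0 s - F x0))\<^sup>2)"
    "(\<integral>s. (norm (E0 s - F x0))\<^sup>2 \<partial>P) \<le> \<sigma>\<^sup>2 / real n0"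
    using init by (auto simp: initial_estimator_def Let_def P_def)
  have eq: "sq_err 0 \<omega> = (norm (E0 (batch n0 (S' 0) \<omega>) - F x0))\<^sup>2" if "\<omega> \<in> space M" for \<omega>
    using hsgd run_step(1)[OF that] that by (simp add: sq_err_def hsgd_estimates_def)
  have m: "(\<lambda>s. (norm (E0 s - F x0))\<^sup>2) \<in> borel_measurable P" using E0 by auto
  have "integrable M (\<lambda>\<omega>. (norm (E0 (batch n0 (S' 0) \<omega>) - F x0))\<^sup>2)"
    using integrable_distr_eq[OF bd(1) m] E0(2) bd(2) by simp
  then show "integrable M (sq_err 0)" using eq by (simp cong: Bochner_Integration.integrable_cong)
  have "M.expectation (sq_err 0) = M.expectation (\<lambda>\<omega>. (norm (E0 (batch n0 (S' 0) \<omega>) - F x0))\<^sup>2)"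
    using eq by (intro Bochner_Integration.integral_cong) auto
  also have "\<dots> = (\<integral>s. (norm (E0 s - F x0))\<^sup>2 \<partial>P)"
    using integral_distr[OF bd(1) m] bd(2) by simp
  finally show "M.expectation (sq_err 0) \<le> \<sigma>\<^sup>2 / real n0" using E0(3) by simp
qed

text \<open>
  The error of one update with the past held fixed, so that only the batches of step \<open>k\<close> are random.
  The new error is \<open>1 - \<tau> k\<close> times the old one plus two centred terms: the batch mean of the oracle
  differences, whose variance is at most the gap divided by the batch size, and the fresh unbiased
  estimate.
\<close>

lemma conditional_error:
  assumes k: "k \<ge> 1"
  shows "(\<integral>\<^sup>+\<omega>. ennreal ((norm ((1 - \<tau> k) *\<^sub>R (fp + (1 / real (b k)) *\<^sub>R (\<Sum>i<b k. Fo u (S k i \<omega>) - Fo v (S k i \<omega>)))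
       + \<tau> k *\<^sub>R E k u (batch (b' k) (S' k) \<omega>) - F u))\<^sup>2) \<partial>M)
    \<le> ennreal ((1 - \<tau> k)\<^sup>2 * ((norm (fp - F v))\<^sup>2 + 2 / real (b k) * oracle_gap u v)
        + 2 * (\<tau> k)\<^sup>2 * (\<sigma>\<^sup>2 / real (b' k)))"
proof -
  define h where "h s = Fo u s - Fo v s - (F u - F v)" for s
  define P where "P = PiM {..<b' k} (\<lambda>_. D)"
  define H where "H \<omega> = (1 / real (b k)) *\<^sub>R (\<Sum>i<b k. h (S k i \<omega>))" for \<omega>
  define R where "R \<omega> = E k u (batch (b' k) (S' k) \<omega>) - F u" for \<omega>
  note bd = batch_distr[OF batch_iid(2)[OF k] sizes(3), folded P_def]
  have h: "integrable D h" "(\<integral>s. h s \<partial>D) = 0" "integrable D (\<lambda>s. (norm (h s))\<^sup>2)"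
    "(\<integral>s. (norm (h s))\<^sup>2 \<partial>D) \<le> oracle_gap u v"
    using F oracle_difference_variance[of u v] by (auto simp: h_def[abs_def] D.prob_space)
  have Sk: "M.indep_vars (\<lambda>_. D) (S k) {..<b k}" "\<And>i. i < b k \<Longrightarrow> distr M D (S k i) = D"
    using batch_iid(1)[OF k] by (auto simp: iid_sample_def)
  note Hs = M.iid_mean_square[OF Sk h(1-3), folded H_def]
  have Ek: "integrable P (E k u)" "(\<integral>s. E k u s \<partial>P) = F u" "integrable P (\<lambda>s. (norm (E k u s - F u))\<^sup>2)"
    "(\<integral>s. (norm (E k u s - F u))\<^sup>2 \<partial>P) \<le> \<sigma>\<^sup>2 / real (b' k)"
    using unbiased[OF k] by (auto simp: unbiased_estimator_def Let_def P_def)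
  interpret P: prob_space P unfolding P_def by (rule prob_space_PiM) (rule D.prob_space_axioms)
  have mE: "(\<lambda>s. E k u s - F u) \<in> borel_measurable P" "(\<lambda>s. (norm (E k u s - F u))\<^sup>2) \<in> borel_measurable P"
    using Ek(1) by auto
  have Rs: "integrable M R" "M.expectation R = 0" "integrable M (\<lambda>\<omega>. (norm (R \<omega>))\<^sup>2)"
    "M.expectation (\<lambda>\<omega>. (norm (R \<omega>))\<^sup>2) \<le> \<sigma>\<^sup>2 / real (b' k)"
  proof -
    show "integrable M R"
      using integrable_distr_eq[OF bd(1) mE(1)] Ek(1) bd(2) by (simp add: R_def[abs_def])
    show "integrable M (\<lambda>\<omega>. (norm (R \<omega>))\<^sup>2)"
      using integrable_distr_eq[OF bd(1) mE(2)] Ek(3) bd(2) by (simp add: R_def[abs_def])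
    show "M.expectation R = 0"
      using integral_distr[OF bd(1) mE(1)] Ek(1,2) bd(2) by (simp add: R_def[abs_def] P.prob_space)
    show "M.expectation (\<lambda>\<omega>. (norm (R \<omega>))\<^sup>2) \<le> \<sigma>\<^sup>2 / real (b' k)"
      using integral_distr[OF bd(1) mE(2)] Ek(4) bd(2) by (simp add: R_def[abs_def])
  qed
  have eq: "(1 - \<tau> k) *\<^sub>R (fp + (1 / real (b k)) *\<^sub>R (\<Sum>i<b k. Fo u (S k i \<omega>) - Fo v (S k i \<omega>)))
       + \<tau> k *\<^sub>R E k u (batch (b' k) (S' k) \<omega>) - F u
     = (1 - \<tau> k) *\<^sub>R (fp - F v) + (1 - \<tau> k) *\<^sub>R H \<omega> + \<tau> k *\<^sub>R R \<omega>" for \<omega>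
  proof -
    have "H \<omega> = (1 / real (b k)) *\<^sub>R (\<Sum>i<b k. Fo u (S k i \<omega>) - Fo v (S k i \<omega>)) - (F u - F v)"
    proof -
      have "(\<Sum>i<b k. h (S k i \<omega>)) = (\<Sum>i<b k. Fo u (S k i \<omega>) - Fo v (S k i \<omega>)) - real (b k) *\<^sub>R (F u - F v)"
        unfolding h_def sum_subtractf[of _ "\<lambda>_. F u - F v"] by (simp only: sum_constant_scaleR card_lessThan)
      moreover have "real (b k) \<noteq> 0" using sizes(2)[of k] by simp
      ultimately show ?thesis by (simp add: H_def scaleR_diff_right)
    qed
    then show ?thesis by (simp only: R_def) (simp add: algebra_simps)
  qed
  have "(\<integral>\<^sup>+\<omega>. ennreal ((norm ((1 - \<tau> k) *\<^sub>R (fp - F v) + (1 - \<tau> k) *\<^sub>R H \<omega> + \<tau> k *\<^sub>R R \<omega>))\<^sup>2) \<partial>M)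
    \<le> ennreal ((norm ((1 - \<tau> k) *\<^sub>R (fp - F v)))\<^sup>2 + 2 * M.expectation (\<lambda>\<omega>. (norm ((1 - \<tau> k) *\<^sub>R H \<omega>))\<^sup>2)
        + 2 * M.expectation (\<lambda>\<omega>. (norm (\<tau> k *\<^sub>R R \<omega>))\<^sup>2))"
    using Hs Rs by (intro M.bias_variance_bound) (auto simp: power_mult_distrib)
  also have "\<dots> \<le> ennreal ((1 - \<tau> k)\<^sup>2 * ((norm (fp - F v))\<^sup>2 + 2 / real (b k) * oracle_gap u v)
        + 2 * (\<tau> k)\<^sup>2 * (\<sigma>\<^sup>2 / real (b' k)))"
  proof (rule ennreal_leI)
    have "M.expectation (\<lambda>\<omega>. (norm (H \<omega>))\<^sup>2) \<le> oracle_gap u v / real (b k)"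
    proof -
      have "M.expectation (\<lambda>\<omega>. (norm (H \<omega>))\<^sup>2) = (\<integral>s. (norm (h s))\<^sup>2 \<partial>D) / real (b k)" by (rule Hs(2))
      also have "\<dots> \<le> oracle_gap u v / real (b k)" using h(4) by (intro divide_right_mono) auto
      finally show ?thesis .
    qed
    then have "(1 - \<tau> k)\<^sup>2 * M.expectation (\<lambda>\<omega>. (norm (H \<omega>))\<^sup>2) \<le> (1 - \<tau> k)\<^sup>2 * (oracle_gap u v / real (b k))"
      by (intro mult_left_mono) auto
    have "(\<tau> k)\<^sup>2 * M.expectation (\<lambda>\<omega>. (norm (R \<omega>))\<^sup>2) \<le> (\<tau> k)\<^sup>2 * (\<sigma>\<^sup>2 / real (b' k))"
      using Rs(4) by (intro mult_left_mono) auto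
    show "(norm ((1 - \<tau> k) *\<^sub>R (fp - F v)))\<^sup>2 + 2 * M.expectation (\<lambda>\<omega>. (norm ((1 - \<tau> k) *\<^sub>R H \<omega>))\<^sup>2)
        + 2 * M.expectation (\<lambda>\<omega>. (norm (\<tau> k *\<^sub>R R \<omega>))\<^sup>2)
      \<le> (1 - \<tau> k)\<^sup>2 * ((norm (fp - F v))\<^sup>2 + 2 / real (b k) * oracle_gap u v)
        + 2 * (\<tau> k)\<^sup>2 * (\<sigma>\<^sup>2 / real (b' k))"
    proof -
      have "(norm ((1 - \<tau> k) *\<^sub>R v))\<^sup>2 = (1 - \<tau> k)\<^sup>2 * (norm v)\<^sup>2"
        "(norm (\<tau> k *\<^sub>R v))\<^sup>2 = (\<tau> k)\<^sup>2 * (norm v)\<^sup>2" for v :: 'a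
        by (simp_all add: power_mult_distrib)
      then have 1: "M.expectation (\<lambda>\<omega>. (norm ((1 - \<tau> k) *\<^sub>R H \<omega>))\<^sup>2) = (1 - \<tau> k)\<^sup>2 * M.expectation (\<lambda>\<omega>. (norm (H \<omega>))\<^sup>2)"
        "M.expectation (\<lambda>\<omega>. (norm (\<tau> k *\<^sub>R R \<omega>))\<^sup>2) = (\<tau> k)\<^sup>2 * M.expectation (\<lambda>\<omega>. (norm (R \<omega>))\<^sup>2)"
        "(norm ((1 - \<tau> k) *\<^sub>R (fp - F v)))\<^sup>2 = (1 - \<tau> k)\<^sup>2 * (norm (fp - F v))\<^sup>2"
        by simp_all
      have 2: "(1 - \<tau> k)\<^sup>2 * ((norm (fp - F v))\<^sup>2 + 2 / real (b k) * oracle_gap u v)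
          = (1 - \<tau> k)\<^sup>2 * (norm (fp - F v))\<^sup>2 + 2 * ((1 - \<tau> k)\<^sup>2 * (oracle_gap u v / real (b k)))"
        "2 * (\<tau> k)\<^sup>2 * (\<sigma>\<^sup>2 / real (b' k)) = 2 * ((\<tau> k)\<^sup>2 * (\<sigma>\<^sup>2 / real (b' k)))"
        by (simp_all add: distrib_left)
      from \<open>(1 - \<tau> k)\<^sup>2 * M.expectation _ \<le> _\<close> \<open>(\<tau> k)\<^sup>2 * M.expectation _ \<le> _\<close>
      show ?thesis unfolding 1 2 by linarith
    qed
  qed
  finally show ?thesis unfolding eq .
qed

text \<open>
  The bound of \<open>conditional_error\<close>, averaged over the past.
\<close>

lemma error_step:
  assumes int: "integrable M (sq_err j)" "integrable M (step_gap j)"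
  shows "integrable M (sq_err (Suc j))"
    "M.expectation (sq_err (Suc j)) \<le> (1 - \<tau> (Suc j))\<^sup>2 * (M.expectation (sq_err j)
       + 2 / real (b (Suc j)) * M.expectation (step_gap j)) + 2 * (\<tau> (Suc j))\<^sup>2 * (\<sigma>\<^sup>2 / real (b' (Suc j)))"
proof -
  define k where "k = Suc j"
  have k: "k \<ge> 1" by (simp add: k_def)
  define g where "g p = ennreal ((norm (estimate k p - F (fst (fst p))))\<^sup>2)" for p
  have [measurable]: "g \<in> borel_measurable (state_space \<Otimes>\<^sub>M batch_space k)" unfolding g_def by measurable
  define R where "R \<omega> = (1 - \<tau> k)\<^sup>2 * (sq_err j \<omega> + 2 / real (b k) * step_gap j \<omega>)
        + 2 * (\<tau> k)\<^sup>2 * (\<sigma>\<^sup>2 / real (b' k))" for \<omega>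
  have R0: "0 \<le> R \<omega>" for \<omega>
    by (auto simp: R_def sq_err_def step_gap_def oracle_gap_nonneg intro!: add_nonneg_nonneg mult_nonneg_nonneg)
  have intR: "integrable M R" unfolding R_def using int by auto
  have "(\<integral>\<^sup>+\<omega>. ennreal (sq_err k \<omega>) \<partial>M) = (\<integral>\<^sup>+\<omega>. g (state k \<omega>, batches k \<omega>) \<partial>M)"
    by (intro nn_integral_cong) (simp add: g_def sq_err_def estimate_eq, simp add: state_def)
  also have "\<dots> = (\<integral>\<^sup>+\<omega>. (\<integral>\<^sup>+\<omega>'. g (state k \<omega>, batches k \<omega>') \<partial>M) \<partial>M)"
    by (rule state_nn_integral) measurable
  also have "\<dots> \<le> (\<integral>\<^sup>+\<omega>. ennreal (R \<omega>) \<partial>M)"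
  proof (rule nn_integral_mono)
    fix \<omega> assume w: "\<omega> \<in> space M"
    have "state k \<omega> = (x k \<omega>, z k \<omega>, x j \<omega>, f j \<omega>)" by (simp add: state_def k_def)
    then have "g (state k \<omega>, batches k \<omega>') = ennreal ((norm ((1 - \<tau> k) *\<^sub>R (f j \<omega> + (1 / real (b k)) *\<^sub>R
          (\<Sum>i<b k. Fo (x k \<omega>) (S k i \<omega>') - Fo (x j \<omega>) (S k i \<omega>')))
       + \<tau> k *\<^sub>R E k (x k \<omega>) (batch (b' k) (S' k) \<omega>') - F (x k \<omega>)))\<^sup>2)" for \<omega>'
      using k by (simp add: g_def estimate_def batches_def batch_def)
    then show "(\<integral>\<^sup>+\<omega>'. g (state k \<omega>, batches k \<omega>') \<partial>M) \<le> ennreal (R \<omega>)"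
      using conditional_error[OF k, of "f j \<omega>" "x k \<omega>" "x j \<omega>"]
      by (simp add: R_def sq_err_def step_gap_def flip: k_def)
  qed
  also have "\<dots> = ennreal (M.expectation R)"
    using R0 by (intro nn_integral_eq_integral[OF intR]) auto
  finally have le: "(\<integral>\<^sup>+\<omega>. ennreal (sq_err k \<omega>) \<partial>M) \<le> ennreal (M.expectation R)" .
  have ER: "M.expectation R = (1 - \<tau> k)\<^sup>2 * (M.expectation (sq_err j) + 2 / real (b k) * M.expectation (step_gap j))
        + 2 * (\<tau> k)\<^sup>2 * (\<sigma>\<^sup>2 / real (b' k))"
    unfolding R_def using int by (simp add: M.prob_space)
  have "0 \<le> M.expectation R" using R0 by simp
  have "0 \<le> sq_err k \<omega>" for \<omega> by (simp add: sq_err_def)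
  note err_k = integrable_of_nn_integral_le[OF sq_err_measurable this le \<open>0 \<le> M.expectation R\<close>]
  then show "integrable M (sq_err (Suc j))"
    "M.expectation (sq_err (Suc j)) \<le> (1 - \<tau> (Suc j))\<^sup>2 * (M.expectation (sq_err j)
       + 2 / real (b (Suc j)) * M.expectation (step_gap j)) + 2 * (\<tau> (Suc j))\<^sup>2 * (\<sigma>\<^sup>2 / real (b' (Suc j)))"
    unfolding ER unfolding k_def by auto
qed

end

section \<open>Expected residual and oracle complexity\<close>

context hsgd_run
begin

text \<open>
  The pathwise decrease of the potential and the error recursion are integrated and fed into
  \<open>coupled_recursion_bound\<close>. Integrability has to be carried along the induction: the potential
  inequality bounds the next potential and the gap by integrable functions, and the gap in turn
  bounds the next error.
\<close>

lemma expected_residual_bound: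
  fixes \<mu> \<beta> r \<epsilon> Q c a :: real and xs :: 'a and m m' K :: nat
  assumes mu: "0 < \<mu>" "\<mu> < 2 / 3" and beta: "0 < \<beta>" "(2 + \<mu>) * \<beta> \<le> (2 - \<mu>) * \<beta>'"
    and r: "r \<ge> 5 + 1 / \<mu>" and t: "\<And>k. t k = \<mu> * (real k + r)"
    and eta: "\<And>k. \<eta> k = 2 * \<beta> * (t k - 1) / (t k - \<nu>)" and nu: "\<nu> = \<mu> / 2"
    and xs: "xs \<in> zer (op_sum F T)"
    and eps: "0 < \<epsilon>" "\<epsilon> \<le> 1"
    and tau: "\<And>k. \<tau> (Suc k) = 1 - sqrt ((1 - \<epsilon>) * t k * (t k - 1) / (t (Suc k) * (t (Suc k) - 1)))"
    and const_sizes: "\<And>k. b (Suc k) = m" "\<And>k. b' (Suc k) = m'"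
    and c: "c = \<beta>\<^sup>2 / (\<beta>' - \<beta>) + \<beta> * (2 - \<mu>) / (2 * (2 - 3 * \<mu>)) + \<beta> + 1"
    and a: "a = 2 * \<mu> * \<beta> / (2 - 3 * \<mu>)"
    and m: "2 * c / (\<epsilon> * real m) \<le> 1 / L - 1 / L'"
    and Q: "8 * \<mu>\<^sup>2 + 8 * \<mu> + 2 * (\<epsilon> * t K)\<^sup>2 \<le> Q"
  shows "integrable M (\<lambda>\<omega>. (norm (G (x K \<omega>)))\<^sup>2)"
    and "\<beta> * (2 - 3 * \<mu>) / (2 - \<mu>) * (t K - \<mu>)\<^sup>2 * M.expectation (\<lambda>\<omega>. (norm (G (x K \<omega>)))\<^sup>2)
      \<le> exp (a * (1 / \<mu>\<^sup>2)) * (lyap \<mu> \<beta> xs (t 0) (G x0) x0 x0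
          + c / \<epsilon> * (t 0 * (t 0 - 1)) * (\<sigma>\<^sup>2 / real n0) + real K * (2 * c * Q * (\<sigma>\<^sup>2 / real m') / \<epsilon>))"
proof -
  define V where "V k \<omega> = lyap \<mu> \<beta> xs (t k) (G (x k \<omega>)) (x k \<omega>) (z k \<omega>)" for k \<omega>
  define u where "u k = t k * (t k - 1)" for k
  define \<Lambda> where "\<Lambda> = 1 / L - 1 / L'"
  define a0 where "a0 = \<beta> * (2 - 3 * \<mu>) / (2 - \<mu>)"
  have a0: "a0 > 0" using mu beta by (simp add: a0_def)
  have a_pos: "a \<ge> 0" using mu beta by (simp add: a)
  note t_bounds = step_parameter_bounds[OF mu(1) r t]
  have t1: "t k \<ge> 5 * \<mu> + 1" for k
    using t_bounds(1)[of k] mu by (smt (verit) mult_nonneg_nonneg of_nat_0_le_iff)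
  have u_pos: "u k > 0" for k using t1[of k] mu by (auto simp: u_def intro!: mult_pos_pos)
  have Lam: "\<Lambda> > 0" unfolding \<Lambda>_def by (rule gap_factor_pos)
  have bb: "\<beta> < \<beta>'"
  proof -
    have "(2 - \<mu>) * \<beta> < (2 + \<mu>) * \<beta>" using mu beta by (intro mult_strict_right_mono) auto
    then have "(2 - \<mu>) * \<beta> < (2 - \<mu>) * \<beta>'" using beta by linarith
    then show ?thesis using mu by simp
  qed
  have c_pos: "c \<ge> 0" unfolding c using bb mu beta by (intro add_nonneg_nonneg divide_nonneg_pos) auto
  have G_xs: "G xs = 0"
    using T(2) by (intro G_op_zero[OF _ lam xs]) (simp add: maximally_cohypomonotone_def)
  have mono0: "G y \<bullet> (y - xs) \<ge> \<beta>' * (norm (G y))\<^sup>2" for y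
    using G_cocoercive'[of y xs] by (simp add: G_xs)
  have low: "V k \<omega> \<ge> a0 * (t k - \<mu>)\<^sup>2 * (norm (G (x k \<omega>)))\<^sup>2" for k \<omega>
  proof -
    have "(2 - 3 * \<mu>) / (8 * \<mu> * \<beta>) * (norm (z k \<omega> - xs))\<^sup>2 \<ge> 0" using mu beta by simp
    with lyap_lower_bound[OF mu beta(1) less_imp_le[OF bb] t1 mono0, of k "x k \<omega>" "z k \<omega>"]
    show ?thesis unfolding V_def a0_def by linarith
  qed
  have V_pos: "0 \<le> V k \<omega>" for k \<omega>
    by (rule order_trans[OF _ low]) (use a0 in simp)
  have err_pos: "0 \<le> sq_err k \<omega>" and gap_pos: "0 \<le> step_gap k \<omega>" for k \<omega>
    by (simp_all add: sq_err_def step_gap_def oracle_gap_nonneg)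
  have V_meas [measurable]: "V k \<in> borel_measurable M" for k
    unfolding V_def lyap_def by measurable
  have V_step: "V (Suc k) \<omega> + \<Lambda> * u k * step_gap k \<omega> \<le> (1 + a / u k) * V k \<omega> + c * u k * sq_err k \<omega>"
    if w: "\<omega> \<in> space M" for k \<omega>
  proof -
    define y where "y = ((t k - 1) / t k) *\<^sub>R x k \<omega> + (1 / t k) *\<^sub>R z k \<omega>"
    define g where "g = residual lam T (x k \<omega>) (f k \<omega>)"
    have x': "x (Suc k) \<omega> = y - \<eta> k *\<^sub>R g" and z': "z (Suc k) \<omega> = z k \<omega> + (\<mu> / 2) *\<^sub>R (x (Suc k) \<omega> - y)"
      using run_step(3,4)[OF w, of k] by (simp_all add: y_def g_def nu)
    have "V (Suc k) \<omega> + u k * (\<Lambda> * step_gap k \<omega>) \<le> (1 + a / u k) * V k \<omega> + c * u k * (norm (g - G (x k \<omega>)))\<^sup>2"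
      unfolding V_def u_def c a t_bounds(2) step_gap_def \<Lambda>_def
      by (rule lyap_step[OF mu beta t1 eta[unfolded nu] y_def x' z' G_cocoercive mono0])
    also have "\<dots> \<le> (1 + a / u k) * V k \<omega> + c * u k * sq_err k \<omega>"
    proof -
      have "(norm (g - G (x k \<omega>)))\<^sup>2 \<le> sq_err k \<omega>"
        unfolding sq_err_def g_def G_op_def
        by (intro power_mono residual_lipschitz_estimate[OF T(2,1) lam]) auto
      then show ?thesis using c_pos u_pos[of k] by (intro add_left_mono mult_left_mono) auto
    qed
    finally show ?thesis by (simp add: mult_ac)
  qed
  have gap_int: "integrable M (V (Suc k)) \<and> integrable M (step_gap k)"
    if int: "integrable M (V k)" "integrable M (sq_err k)" for k
  proof -
    have R: "integrable M (\<lambda>\<omega>. (1 + a / u k) * V k \<omega> + c * u k * sq_err k \<omega>)" using int by auto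
    have Lu: "\<Lambda> * u k > 0" using Lam u_pos by simp
    have "integrable M (V (Suc k))"
    proof (rule Bochner_Integration.integrable_bound[OF R])
      show "AE \<omega> in M. norm (V (Suc k) \<omega>) \<le> norm ((1 + a / u k) * V k \<omega> + c * u k * sq_err k \<omega>)"
      proof (rule AE_I2)
        fix \<omega> assume w: "\<omega> \<in> space M"
        have "0 \<le> \<Lambda> * u k * step_gap k \<omega>" using Lu gap_pos[of k \<omega>] by simp
        then show "norm (V (Suc k) \<omega>) \<le> norm ((1 + a / u k) * V k \<omega> + c * u k * sq_err k \<omega>)"
          using V_step[OF w, of k] V_pos[of "Suc k" \<omega>] by simp
      qed
    qed simp
    moreover have "integrable M (\<lambda>\<omega>. \<Lambda> * u k * step_gap k \<omega>)"
    proof (rule Bochner_Integration.integrable_bound[OF R])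
      show "AE \<omega> in M. norm (\<Lambda> * u k * step_gap k \<omega>) \<le> norm ((1 + a / u k) * V k \<omega> + c * u k * sq_err k \<omega>)"
      proof (rule AE_I2)
        fix \<omega> assume w: "\<omega> \<in> space M"
        have "0 \<le> \<Lambda> * u k * step_gap k \<omega>" using Lu gap_pos[of k \<omega>] by simp
        then show "norm (\<Lambda> * u k * step_gap k \<omega>) \<le> norm ((1 + a / u k) * V k \<omega> + c * u k * sq_err k \<omega>)"
          using V_step[OF w, of k] V_pos[of "Suc k" \<omega>] unfolding real_norm_def by linarith
      qed
    qed simp
    then have "integrable M (step_gap k)" using Lu by auto
    ultimately show ?thesis by blast
  qed
  have V0: "V 0 \<omega> = lyap \<mu> \<beta> xs (t 0) (G x0) x0 x0" if "\<omega> \<in> space M" for \<omega>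
    using run_step(1,2)[OF that] by (simp add: V_def)
  have int: "integrable M (V k) \<and> integrable M (sq_err k)" for k
  proof (induction k)
    case 0
    have "integrable M (V 0)" using V0 by (simp cong: Bochner_Integration.integrable_cong)
    then show ?case using initial_error by simp
  next
    case (Suc k)
    with gap_int[of k] error_step(1)[of k] show ?case by blast
  qed
  note gap_int' = gap_int[OF conjunct1[OF int] conjunct2[OF int]]
  have "M.expectation (V K) \<le> exp (a * (1 / \<mu>\<^sup>2)) * (M.expectation (V 0)
      + c / \<epsilon> * u 0 * M.expectation (sq_err 0) + real K * (2 * c * Q * (\<sigma>\<^sup>2 / real m') / \<epsilon>))"
  proof (rule coupled_recursion_bound[where d = "\<lambda>k. M.expectation (step_gap k)" and u = u and \<tau> = \<tau> and b = "real m"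
        and \<Lambda> = \<Lambda>])
    fix k
    show "0 \<le> M.expectation (V k)" "0 \<le> M.expectation (sq_err k)" "0 \<le> M.expectation (step_gap k)"
      using V_pos err_pos gap_pos by simp_all
    show "u k > 0" by (rule u_pos)
    show "M.expectation (V (Suc k)) + \<Lambda> * u k * M.expectation (step_gap k)
        \<le> (1 + a / u k) * M.expectation (V k) + c * u k * M.expectation (sq_err k)"
    proof -
      have "M.expectation (\<lambda>\<omega>. V (Suc k) \<omega> + \<Lambda> * u k * step_gap k \<omega>)
          \<le> M.expectation (\<lambda>\<omega>. (1 + a / u k) * V k \<omega> + c * u k * sq_err k \<omega>)"
        using gap_int'[of k] int[of k] V_step by (intro integral_mono) auto
      then show ?thesis using gap_int'[of k] int[of k] by simp
    qed
    show "M.expectation (sq_err (Suc k)) \<le> (1 - \<tau> (Suc k))\<^sup>2 * (M.expectation (sq_err k)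
        + 2 / real m * M.expectation (step_gap k)) + 2 * (\<tau> (Suc k))\<^sup>2 * (\<sigma>\<^sup>2 / real m')"
      using error_step(2)[of k] int[of k] gap_int'[of k] by (simp add: const_sizes)
    have s: "t k = t (Suc k) - \<mu>" by (simp add: t_bounds(2))
    have mu1: "\<mu> < 1" using mu by simp
    note hw = hybrid_weight[OF mu(1) mu1 t1[of "Suc k"] eps s tau]
    show "u (Suc k) * (1 - \<tau> (Suc k))\<^sup>2 = (1 - \<epsilon>) * u k"
      using hw(1) by (simp add: u_def)
    show "u (Suc k) * (\<tau> (Suc k))\<^sup>2 \<le> Q" if "k < K"
    proof -
      have "t (Suc k) \<le> t K" unfolding t using that mu by (intro mult_left_mono) auto
      then have "(\<epsilon> * t (Suc k))\<^sup>2 \<le> (\<epsilon> * t K)\<^sup>2"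
        using eps t1[of "Suc k"] mu by (intro power_mono mult_left_mono mult_nonneg_nonneg) auto
      then show ?thesis using hw(2) Q by (simp add: u_def)
    qed
  next
    show "(\<Sum>k<K. 1 / u k) \<le> 1 / \<mu>\<^sup>2"
      unfolding u_def by (rule sum_inverse_step_parameter[OF mu(1) r t])
    show "0 < real m" using sizes(2)[of "Suc 0"] const_sizes(1)[of 0] by simp
  qed (use eps a_pos c_pos m in \<open>auto simp: \<Lambda>_def\<close>)
  also have "\<dots> \<le> exp (a * (1 / \<mu>\<^sup>2)) * (lyap \<mu> \<beta> xs (t 0) (G x0) x0 x0
          + c / \<epsilon> * u 0 * (\<sigma>\<^sup>2 / real n0) + real K * (2 * c * Q * (\<sigma>\<^sup>2 / real m') / \<epsilon>))"
  proof -
    have "M.expectation (V 0) = M.expectation (\<lambda>_. lyap \<mu> \<beta> xs (t 0) (G x0) x0 x0)"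
      using V0 by (intro Bochner_Integration.integral_cong) auto
    moreover have "c / \<epsilon> * u 0 * M.expectation (sq_err 0) \<le> c / \<epsilon> * u 0 * (\<sigma>\<^sup>2 / real n0)"
      using initial_error(2) c_pos eps u_pos[of 0] by (intro mult_left_mono) auto
    ultimately show ?thesis by (intro mult_left_mono) (auto simp: M.prob_space)
  qed
  finally have bound: "M.expectation (V K) \<le> exp (a * (1 / \<mu>\<^sup>2)) * (lyap \<mu> \<beta> xs (t 0) (G x0) x0 x0
          + c / \<epsilon> * u 0 * (\<sigma>\<^sup>2 / real n0) + real K * (2 * c * Q * (\<sigma>\<^sup>2 / real m') / \<epsilon>))" .
  define s2 where "s2 = a0 * (t K - \<mu>)\<^sup>2"
  have s2: "s2 > 0" using a0 t1[of K] mu by (simp add: s2_def)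
  have "integrable M (\<lambda>\<omega>. s2 * (norm (G (x K \<omega>)))\<^sup>2)"
  proof (rule Bochner_Integration.integrable_bound[OF conjunct1[OF int]])
    show "AE \<omega> in M. norm (s2 * (norm (G (x K \<omega>)))\<^sup>2) \<le> norm (V K \<omega>)"
      using low[of K] V_pos[of K] s2 by (auto simp: s2_def)
  qed measurable
  then show i: "integrable M (\<lambda>\<omega>. (norm (G (x K \<omega>)))\<^sup>2)" using s2 by simp
  have "s2 * M.expectation (\<lambda>\<omega>. (norm (G (x K \<omega>)))\<^sup>2) = M.expectation (\<lambda>\<omega>. s2 * (norm (G (x K \<omega>)))\<^sup>2)" by simp
  also have "\<dots> \<le> M.expectation (V K)"
    using i int low[of K] by (intro integral_mono) (auto simp: s2_def)
  also note bound
  finally show "\<beta> * (2 - 3 * \<mu>) / (2 - \<mu>) * (t K - \<mu>)\<^sup>2 * M.expectation (\<lambda>\<omega>. (norm (G (x K \<omega>)))\<^sup>2)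
      \<le> exp (a * (1 / \<mu>\<^sup>2)) * (lyap \<mu> \<beta> xs (t 0) (G x0) x0 x0
          + c / \<epsilon> * (t 0 * (t 0 - 1)) * (\<sigma>\<^sup>2 / real n0) + real K * (2 * c * Q * (\<sigma>\<^sup>2 / real m') / \<epsilon>))"
    by (simp add: s2_def a0_def u_def)
qed

end

text \<open>
  The rounding in a batch size of the form \<open>c / e\<close> costs at most 1 in the constant \<open>c\<close>.
\<close>

lemma nat_floor_divide_lower:
  fixes c e p :: real
  assumes "0 < e" "e \<le> 1" "0 \<le> p" "p + 1 \<le> c"
  shows "p \<le> e * real (nat \<lfloor>c / e\<rfloor>)" "nat \<lfloor>c / e\<rfloor> \<ge> 1"
proof -
  have ce: "c \<le> e * (c / e)" "1 \<le> c / e" using assms by (simp_all add: field_simps)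
  have "real (nat \<lfloor>c / e\<rfloor>) = of_int \<lfloor>c / e\<rfloor>" using ce by simp
  also have "\<dots> \<ge> c / e - 1" by linarith
  finally have "e * (c / e - 1) \<le> e * real (nat \<lfloor>c / e\<rfloor>)" using assms by (intro mult_left_mono) auto
  then show "p \<le> e * real (nat \<lfloor>c / e\<rfloor>)" using assms ce by (simp add: right_diff_distrib)
  show "nat \<lfloor>c / e\<rfloor> \<ge> 1" using ce by (simp add: le_nat_iff)
qed

lemma total_work_le:
  "real (total_work n0 (\<lambda>_. b) (\<lambda>_. b') K) \<le> real n0 + real K * (2 * real b + real b' + 1)"
proof -
  have "real (total_work n0 (\<lambda>_. b) (\<lambda>_. b') K)
      \<le> (\<Sum>k<K. (if k = 0 then real n0 else 0) + (2 * real b + real b' + 1))"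
    unfolding total_work_def of_nat_sum by (intro sum_mono) (auto simp: oracle_calls_def)
  also have "\<dots> \<le> real n0 + real K * (2 * real b + real b' + 1)"
    by (simp add: sum.distrib)
  finally show ?thesis .
qed

theorem corollary24:
  fixes D :: "'s measure"
    and Fo :: "real ^ 'p \<Rightarrow> 's \<Rightarrow> real ^ 'p"
    and F :: "real ^ 'p \<Rightarrow> real ^ 'p"
    and T :: "real ^ 'p \<Rightarrow> (real ^ 'p) set"
    and x0 :: "real ^ 'p"
    and \<sigma> \<rho> L L' \<beta>' lam \<mu> \<nu> \<beta> r :: real
    and t \<eta> :: "nat \<Rightarrow> real"
  assumes D: "prob_space D"
    and Fo_meas: "(\<lambda>(x, s). Fo x s) \<in> borel_measurable (borel \<Otimes>\<^sub>M D)"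
    and F: "\<And>x. integrable D (Fo x)" "\<And>x. F x = (\<integral>s. Fo x s \<partial>D)"
    and zer: "zer (op_sum F T) \<noteq> {}"
    and sigma: "\<sigma> \<ge> 0"
    and variance: "\<And>x. integrable D (\<lambda>s. (norm (Fo x s - F x))\<^sup>2)"
      "\<And>x. (\<integral>s. (norm (Fo x s - F x))\<^sup>2 \<partial>D) \<le> \<sigma>\<^sup>2"
    and T: "\<rho> \<ge> 0" "maximally_cohypomonotone \<rho> T"
    and cocoercive: "L > 0"
      "\<And>x y. (F x - F y) \<bullet> (x - y) \<ge> (1 / L) * (\<integral>s. (norm (Fo x s - Fo y s))\<^sup>2 \<partial>D)"
    and L_rho: "L * \<rho> < 1" "L' > L" "L' * \<rho> < 1"
    and betabar: "\<beta>' = (lam * (4 - L' * lam) - 4 * \<rho>) / (4 * (1 - \<rho> * L'))"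
    and lambda: "lam > 0" "2 * \<rho> \<le> lam" "lam < 2 * (1 + sqrt (1 - L' * \<rho>)) / L'"
    and mu: "0 < \<mu>" "\<mu> < 2 / 3"
    and nu: "\<nu> = \<mu> / 2"
    and beta: "0 < \<beta>" "\<beta> \<le> (2 - \<mu>) * \<beta>' / (2 + \<mu>)"
    and r: "r \<ge> 5 + 1 / \<mu>"
    and t: "\<And>k. t k = \<mu> * (real k + r)"
    and eta: "\<And>k. \<eta> k = 2 * \<beta> * (t k - 1) / (t k - \<nu>)"
    and x0: "x0 \<in> op_dom (op_sum F T)"
  shows "\<exists>c\<^sub>b > 0. \<exists>c\<^sub>b' > 0. \<exists>c\<^sub>n > 0. \<exists>C. \<forall>\<epsilon>. 0 < \<epsilon> \<and> \<epsilon> \<le> 1 / 2 \<longrightarrow>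
    (let \<tau> = (\<lambda>k. 1 - sqrt ((1 - \<epsilon>) * t (k - 1) * (t (k - 1) - 1) / (t k * (t k - 1))));
         b = (\<lambda>k. nat \<lfloor>c\<^sub>b / \<epsilon>\<rfloor>);
         b' = (\<lambda>k. nat \<lfloor>c\<^sub>b' / \<epsilon>\<^sup>2\<rfloor>);
         n0 = nat \<lfloor>c\<^sub>n / \<epsilon>\<rfloor>
     in n0 \<ge> 1 \<and> (\<forall>k. b k \<ge> 1 \<and> b' k \<ge> 1) \<and>
        (\<forall>(M :: 'w measure) S S' E0 E x z f.
           prob_space M \<longrightarrow>
           fresh_samples M D n0 b b' S S' \<longrightarrow>
           initial_estimator D \<sigma> n0 (F x0) E0 \<longrightarrow>
           (\<forall>k \<ge> 1. unbiased_estimator D \<sigma> (b' k) F (E k)) \<longrightarrow>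
           hsgd_estimates M Fo \<tau> n0 b b' S S' E0 E x f \<longrightarrow>
           (\<forall>\<omega> \<in> space M. vfosa_plus lam T t \<nu> \<eta> x0 (\<lambda>k. f k \<omega>) (\<lambda>k. x k \<omega>) (\<lambda>k. z k \<omega>)) \<longrightarrow>
           (\<exists>K. integrable M (\<lambda>\<omega>. (norm (G_op lam F T (x K \<omega>)))\<^sup>2) \<and>
                (\<integral>\<omega>. (norm (G_op lam F T (x K \<omega>)))\<^sup>2 \<partial>M) \<le> \<epsilon>\<^sup>2 \<and>
                real (total_work n0 b b' K) \<le> C / \<epsilon> ^ 3)))"
proof -
  obtain xs where xs: "xs \<in> zer (op_sum F T)" using zer by blast
  have beta': "(2 + \<mu>) * \<beta> \<le> (2 - \<mu>) * \<beta>'" using beta mu by (simp add: field_simps)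
  have "0 < (2 + \<mu>) * \<beta>" using beta mu by simp
  then have "0 < (2 - \<mu>) * \<beta>'" using beta' by linarith
  then have betabar_pos: "\<beta>' > 0" using mu by (simp add: zero_less_mult_iff)
  interpret stochastic_inclusion D Fo F T \<rho> L L' lam \<beta>'
    using D Fo_meas F variance(1) T cocoercive L_rho lambda betabar betabar_pos
    by (intro stochastic_inclusion.intro stochastic_inclusion_axioms.intro) auto
  define c where "c = \<beta>\<^sup>2 / (\<beta>' - \<beta>) + \<beta> * (2 - \<mu>) / (2 * (2 - 3 * \<mu>)) + \<beta> + 1"
  define a where "a = 2 * \<mu> * \<beta> / (2 - 3 * \<mu>)"
  define \<Lambda> where "\<Lambda> = 1 / L - 1 / L'"
  define a0 where "a0 = \<beta> * (2 - 3 * \<mu>) / (2 - \<mu>)"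
  define u0 where "u0 = t 0 * (t 0 - 1)"
  \<comment> \<open>An upper bound for the mean potential after \<open>K\<close> steps, with 1 as the allowance for the accumulated noise; \<open>m\<close> is large enough that this bound gives the accuracy \<open>\<epsilon>\<^sup>2\<close> after \<open>m / \<epsilon>\<close> steps.\<close>
  define W where "W = exp (a * (1 / \<mu>\<^sup>2)) * (lyap \<mu> \<beta> xs (t 0) (G x0) x0 x0 + c * u0 * \<sigma>\<^sup>2 + 1)"
  define m where "m = \<bar>W / (a0 * \<mu>\<^sup>2)\<bar> + 1"
  define Q where "Q = 8 * \<mu>\<^sup>2 + 8 * \<mu> + 2 * (\<mu> * (m + 1 + r))\<^sup>2"
  \<comment> \<open>The accumulated noise over \<open>K\<close> steps is at most \<open>q / (\<epsilon>\<^sup>2 * b')\<close>, so \<open>cb'\<close> is chosen to make this at most 1.\<close>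
  define q where "q = 2 * (m + 1) * c * Q * \<sigma>\<^sup>2"
  define cb where "cb = 2 * c / \<Lambda> + 1"
  define cb' where "cb' = q + 1"
  define C where "C = 2 + (m + 1) * (2 * cb + cb' + 1)"
  have bb: "\<beta> < \<beta>'"
  proof -
    have "(2 - \<mu>) * \<beta> < (2 + \<mu>) * \<beta>" using mu beta by (intro mult_strict_right_mono) auto
    then have "(2 - \<mu>) * \<beta> < (2 - \<mu>) * \<beta>'" using beta' by linarith
    then show ?thesis using mu by simp
  qed
  have c_pos: "c > 0" unfolding c_def using bb mu beta by (intro add_nonneg_pos add_nonneg_nonneg divide_nonneg_pos) auto
  have Lam: "\<Lambda> > 0" unfolding \<Lambda>_def by (rule gap_factor_pos)
  have a0: "a0 > 0" using mu beta by (simp add: a0_def)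
  have m: "m \<ge> 1" by (simp add: m_def)
  have r1: "r \<ge> 1" using r mu by (smt (verit) divide_nonneg_pos)
  have Q: "Q \<ge> 0" using mu by (simp add: Q_def)
  have q: "q \<ge> 0" using m c_pos Q by (simp add: q_def)
  have cb: "2 * c / \<Lambda> \<ge> 0" using c_pos Lam by simp
  have u0: "u0 \<ge> 0"
    using step_parameter_bounds(1)[OF mu(1) r t, of 0] mu by (simp add: u0_def)
  have W_le: "W \<le> a0 * \<mu>\<^sup>2 * m\<^sup>2"
  proof -
    have "W / (a0 * \<mu>\<^sup>2) \<le> m * 1"
      unfolding m_def mult_1_right by (rule order_trans[OF abs_ge_self]) simp
    also have "\<dots> \<le> m * m" using m by (intro mult_left_mono) auto
    finally show ?thesis using a0 mu by (simp add: pos_divide_le_eq power2_eq_square mult_ac)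
  qed
  show ?thesis
  proof (rule exI[of _ cb], intro conjI, use cb in \<open>simp add: cb_def\<close>,
      rule exI[of _ cb'], intro conjI, use q in \<open>simp add: cb'_def\<close>,
      rule exI[of _ 2], intro conjI, simp, rule exI[of _ C], intro allI impI)
    fix \<epsilon> :: real assume eps': "0 < \<epsilon> \<and> \<epsilon> \<le> 1 / 2"
    then have eps: "0 < \<epsilon>" "\<epsilon> \<le> 1" by auto
    define \<tau> where "\<tau> = (\<lambda>k. 1 - sqrt ((1 - \<epsilon>) * t (k - 1) * (t (k - 1) - 1) / (t k * (t k - 1))))"
    define b where "b = nat \<lfloor>cb / \<epsilon>\<rfloor>"
    define b' where "b' = nat \<lfloor>cb' / \<epsilon>\<^sup>2\<rfloor>"
    define n0 where "n0 = nat \<lfloor>2 / \<epsilon>\<rfloor>"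
    have eps2: "0 < \<epsilon>\<^sup>2" "\<epsilon>\<^sup>2 \<le> 1" using eps by (simp_all add: power_le_one)
    have b: "2 * c / \<Lambda> \<le> \<epsilon> * real b" "b \<ge> 1"
      unfolding b_def by (rule nat_floor_divide_lower[OF eps cb]; simp add: cb_def)+
    have b': "q \<le> \<epsilon>\<^sup>2 * real b'" "b' \<ge> 1"
      unfolding b'_def by (rule nat_floor_divide_lower[OF eps2 q]; simp add: cb'_def)+
    have n0: "1 \<le> \<epsilon> * real n0" "n0 \<ge> 1"
      unfolding n0_def by (rule nat_floor_divide_lower[OF eps, of 1]; simp)+
    have upper: "real b \<le> cb / \<epsilon>" "real b' \<le> cb' / \<epsilon>\<^sup>2" "real n0 \<le> 2 / \<epsilon>"
      unfolding b_def b'_def n0_def using cb q eps eps2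
      by (auto simp: cb_def cb'_def intro!: of_nat_floor)
    define K where "K = nat \<lceil>m / \<epsilon>\<rceil>"
    have K: "m / \<epsilon> \<le> real K" "real K \<le> (m + 1) / \<epsilon>"
    proof -
      have "0 \<le> m / \<epsilon>" using m eps by simp
      then have "real K = of_int \<lceil>m / \<epsilon>\<rceil>" by (simp add: K_def)
      moreover have "1 \<le> 1 / \<epsilon>" using eps by simp
      ultimately show "m / \<epsilon> \<le> real K" "real K \<le> (m + 1) / \<epsilon>"
        unfolding add_divide_distrib by linarith+
    qed
    have main: "integrable M (\<lambda>\<omega>. (norm (G (x K \<omega>)))\<^sup>2) \<and> (\<integral>\<omega>. (norm (G (x K \<omega>)))\<^sup>2 \<partial>M) \<le> \<epsilon>\<^sup>2"
      if "prob_space M" "fresh_samples M D n0 (\<lambda>_. b) (\<lambda>_. b') S S'" "initial_estimator D \<sigma> n0 (F x0) E0"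
        "\<forall>k\<ge>1. unbiased_estimator D \<sigma> b' F (E k)" "hsgd_estimates M Fo \<tau> n0 (\<lambda>_. b) (\<lambda>_. b') S S' E0 E x f"
        "\<forall>\<omega>\<in>space M. vfosa_plus lam T t \<nu> \<eta> x0 (\<lambda>k. f k \<omega>) (\<lambda>k. x k \<omega>) (\<lambda>k. z k \<omega>)"
      for M :: "'w measure" and S S' E0 E x z f
    proof -
      interpret R: hsgd_run D Fo F T \<rho> L L' lam \<beta>' M \<sigma> n0 "\<lambda>_. b" "\<lambda>_. b'" S S' E0 E \<tau> t \<eta> \<nu> x0 x z f
        using that n0 b b' stochastic_inclusion_axioms
        by (intro hsgd_run.intro hsgd_run_axioms.intro) auto
      have tau: "\<tau> (Suc k) = 1 - sqrt ((1 - \<epsilon>) * t k * (t k - 1) / (t (Suc k) * (t (Suc k) - 1)))" for k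
        by (simp add: \<tau>_def)
      have mm: "2 * c / (\<epsilon> * real b) \<le> 1 / L - 1 / L'"
        using b Lam eps unfolding \<Lambda>_def[symmetric] by (simp add: field_simps)
      have QK: "8 * \<mu>\<^sup>2 + 8 * \<mu> + 2 * (\<epsilon> * t K)\<^sup>2 \<le> Q"
      proof -
        have "\<epsilon> * real K \<le> m + 1" using K(2) eps by (simp add: field_simps)
        moreover have "\<epsilon> * r \<le> 1 * r" using eps r1 by (intro mult_right_mono) auto
        ultimately have "\<mu> * (\<epsilon> * real K + \<epsilon> * r) \<le> \<mu> * (m + 1 + r)"
          using mu by (intro mult_left_mono) auto
        then have "\<epsilon> * t K \<le> \<mu> * (m + 1 + r)" by (simp add: t algebra_simps)
        moreover have "0 \<le> \<epsilon> * t K" using eps mu r1 by (simp add: t)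
        ultimately show ?thesis unfolding Q_def by (intro add_left_mono mult_left_mono power_mono) auto
      qed
      note bound = R.expected_residual_bound[OF mu beta(1) beta' r t eta nu xs eps tau refl refl c_def a_def mm QK]
      define X where "X = (\<integral>\<omega>. (norm (G (x K \<omega>)))\<^sup>2 \<partial>M)"
      have "c / \<epsilon> * u0 * (\<sigma>\<^sup>2 / real n0) \<le> c * u0 * \<sigma>\<^sup>2"
      proof -
        have "c / \<epsilon> * u0 * (\<sigma>\<^sup>2 / real n0) = c * u0 * \<sigma>\<^sup>2 * (1 / (\<epsilon> * real n0))" by simp
        also have "\<dots> \<le> c * u0 * \<sigma>\<^sup>2 * 1"
          using n0 c_pos u0 eps by (intro mult_left_mono) auto
        finally show ?thesis by simp
      qed
      moreover have "real K * (2 * c * Q * (\<sigma>\<^sup>2 / real b') / \<epsilon>) \<le> 1"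
      proof -
        have "real K * (2 * c * Q * (\<sigma>\<^sup>2 / real b') / \<epsilon>) \<le> (m + 1) / \<epsilon> * (2 * c * Q * (\<sigma>\<^sup>2 / real b') / \<epsilon>)"
          using K(2) c_pos Q eps by (intro mult_right_mono) auto
        also have "\<dots> = q / (\<epsilon>\<^sup>2 * real b')" using eps b'(2) by (simp add: q_def power2_eq_square field_simps)
        also have "\<dots> \<le> 1" using b' eps by (simp add: divide_le_eq)
        finally show ?thesis .
      qed
      ultimately have "exp (a * (1 / \<mu>\<^sup>2)) * (lyap \<mu> \<beta> xs (t 0) (G x0) x0 x0
          + c / \<epsilon> * u0 * (\<sigma>\<^sup>2 / real n0) + real K * (2 * c * Q * (\<sigma>\<^sup>2 / real b') / \<epsilon>)) \<le> W"
        unfolding W_def by (intro mult_left_mono) auto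
      then have "a0 * (t K - \<mu>)\<^sup>2 * X \<le> a0 * \<mu>\<^sup>2 * m\<^sup>2"
        using bound(2) W_le unfolding X_def a0_def u0_def by linarith
      moreover have "a0 * (\<mu> * (m / \<epsilon>))\<^sup>2 * X \<le> a0 * (t K - \<mu>)\<^sup>2 * X"
      proof -
        have "\<mu> * (m / \<epsilon>) \<le> \<mu> * (real K + r - 1)" using K(1) r1 mu by (intro mult_left_mono) auto
        then have "\<mu> * (m / \<epsilon>) \<le> t K - \<mu>" by (simp add: t algebra_simps)
        moreover have "0 \<le> \<mu> * (m / \<epsilon>)" using mu m eps by simp
        moreover have "0 \<le> X" by (simp add: X_def)
        ultimately show ?thesis using a0 by (intro mult_right_mono mult_left_mono power_mono) auto
      qed
      ultimately have "(a0 * \<mu>\<^sup>2 * m\<^sup>2) * (X / \<epsilon>\<^sup>2) \<le> (a0 * \<mu>\<^sup>2 * m\<^sup>2) * 1"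
        by (simp add: power_mult_distrib power_divide mult_ac)
      moreover have "a0 * \<mu>\<^sup>2 * m\<^sup>2 > 0" using a0 mu m by simp
      ultimately have "X / \<epsilon>\<^sup>2 \<le> 1" by (rule mult_left_le_imp_le)
      then have "X \<le> \<epsilon>\<^sup>2" using eps2 by (simp add: divide_le_eq)
      with bound(1) show ?thesis by (simp add: X_def)
    qed
    have work: "real (total_work n0 (\<lambda>_. b) (\<lambda>_. b') K) \<le> C / \<epsilon> ^ 3"
    proof -
      have e3: "1 / \<epsilon> \<le> 1 / \<epsilon> ^ 3" "1 / \<epsilon> \<le> 1 / \<epsilon>\<^sup>2" "1 \<le> 1 / \<epsilon>\<^sup>2"
        using eps by (auto intro!: divide_left_mono simp: power_le_one power3_eq_cube power2_eq_square mult_le_one)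
      have "2 * real b + real b' + 1 \<le> (2 * cb + cb' + 1) / \<epsilon>\<^sup>2"
      proof -
        have "cb * (1 / \<epsilon>) \<le> cb * (1 / \<epsilon>\<^sup>2)" using e3(2) cb by (intro mult_left_mono) (auto simp: cb_def)
        then show ?thesis using upper e3(3) by (simp add: add_divide_distrib)
      qed
      then have "real K * (2 * real b + real b' + 1) \<le> (m + 1) / \<epsilon> * ((2 * cb + cb' + 1) / \<epsilon>\<^sup>2)"
        using K(2) m eps by (intro mult_mono) auto
      moreover have "real n0 \<le> 2 / \<epsilon> ^ 3" using upper(3) e3(1) by simp
      ultimately have "real (total_work n0 (\<lambda>_. b) (\<lambda>_. b') K)
          \<le> 2 / \<epsilon> ^ 3 + (m + 1) / \<epsilon> * ((2 * cb + cb' + 1) / \<epsilon>\<^sup>2)"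
        using total_work_le[of n0 b b' K] by linarith
      also have "\<dots> = C / \<epsilon> ^ 3"
      proof -
        have "(m + 1) / \<epsilon> * ((2 * cb + cb' + 1) / \<epsilon>\<^sup>2) = ((m + 1) * (2 * cb + cb' + 1)) / \<epsilon> ^ 3"
          unfolding times_divide_times_eq power3_eq_cube power2_eq_square mult.assoc ..
        then show ?thesis unfolding C_def by (simp only: add_divide_distrib)
      qed
      finally show ?thesis .
    qed
    show "let \<tau> = (\<lambda>k. 1 - sqrt ((1 - \<epsilon>) * t (k - 1) * (t (k - 1) - 1) / (t k * (t k - 1))));
         b = (\<lambda>k. nat \<lfloor>cb / \<epsilon>\<rfloor>);
         b' = (\<lambda>k. nat \<lfloor>cb' / \<epsilon>\<^sup>2\<rfloor>);
         n0 = nat \<lfloor>2 / \<epsilon>\<rfloor>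
     in n0 \<ge> 1 \<and> (\<forall>k. b k \<ge> 1 \<and> b' k \<ge> 1) \<and>
        (\<forall>(M :: 'w measure) S S' E0 E x z f.
           prob_space M \<longrightarrow>
           fresh_samples M D n0 b b' S S' \<longrightarrow>
           initial_estimator D \<sigma> n0 (F x0) E0 \<longrightarrow>
           (\<forall>k \<ge> 1. unbiased_estimator D \<sigma> (b' k) F (E k)) \<longrightarrow>
           hsgd_estimates M Fo \<tau> n0 b b' S S' E0 E x f \<longrightarrow>
           (\<forall>\<omega> \<in> space M. vfosa_plus lam T t \<nu> \<eta> x0 (\<lambda>k. f k \<omega>) (\<lambda>k. x k \<omega>) (\<lambda>k. z k \<omega>)) \<longrightarrow>
           (\<exists>K. integrable M (\<lambda>\<omega>. (norm (G_op lam F T (x K \<omega>)))\<^sup>2) \<and>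
                (\<integral>\<omega>. (norm (G_op lam F T (x K \<omega>)))\<^sup>2 \<partial>M) \<le> \<epsilon>\<^sup>2 \<and>
                real (total_work n0 b b' K) \<le> C / \<epsilon> ^ 3))"
      unfolding Let_def b_def[symmetric] b'_def[symmetric] n0_def[symmetric] \<tau>_def[symmetric]
      using b(2) b'(2) n0(2) main work by blast
  qed
qed

end
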